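(* Let $G$ be a finitely generated soluble group. Then at least one of the following holds: (i) $G$ is virtually abelian; (ii) the derived subgroup $G'$ has a subgroup isomorphic to $\mathbb{Z}^\infty$; (iii) $G$ has a subgroup isomorphic to a proper Gc-group; (iv) $G$ has a finitely generated subgroup $H$ with an infinite normal torsion subgroup $U$ such that $H/U$ is either free abelian or a proper Gc-group.
   Context: $\mathbb{Z}^\infty$ denotes a free abelian group of countably infinite rank. Conventions: $x^y = y^{-1}xy$, $[x,y]=x^{-1}y^{-1}xy$. For an integer $s \ge 1$ and $\mathbf{c} = (c_0,\ldots,c_s)\in \mathbb{Z}^{s+1}$ with $c_0 \neq 0$, $c_s\neq 0$ and $\gcd(c_0,\ldots,c_s)=1$, let $G(\mathbf{c})$ be the group defined by the presentation $\langle \alpha,\beta \mid [\beta,\beta^{\alpha^i}]\ (i\in\mathbb{Z}),\ \beta^{c_0}(\beta^{\alpha})^{c_1}\cdots(\beta^{\alpha^s})^{c_s}\rangle$. A Gc-group is a group isomorphic to some such $G(\mathbf{c})$. A proper Gc-group is a Gc-group that is not virtually abelian. *)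

theory Defs
  imports "HOL-Algebra.Solvable_Groups" "HOL-Algebra.Free_Abelian_Groups"
begin

definition finitely_generated :: "('a, 'b) monoid_scheme \<Rightarrow> bool" where
  "finitely_generated G \<longleftrightarrow> (\<exists>S. finite S \<and> S \<subseteq> carrier G \<and> generate G S = carrier G)"

definition virtually_abelian :: "('a, 'b) monoid_scheme \<Rightarrow> bool" where
  "virtually_abelian G \<longleftrightarrow>
     (\<exists>A. subgroup A G \<and> comm_group (G\<lparr>carrier := A\<rparr>) \<and> finite (rcosets\<^bsub>G\<^esub> A))"

definition torsion_set :: "('a, 'b) monoid_scheme \<Rightarrow> 'a set \<Rightarrow> bool" where
  "torsion_set G U \<longleftrightarrow> (\<forall>u\<in>U. \<exists>n::nat. n > 0 \<and> u [^]\<^bsub>G\<^esub> n = \<one>\<^bsub>G\<^esub>)"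

text \<open>A basis of a free abelian group is a subset of its carrier, so letting the index set
  range over sets of elements of the carrier type loses no generality. The trivial group
  (empty basis) is free abelian.\<close>

definition free_abelian :: "('a, 'b) monoid_scheme \<Rightarrow> bool" where
  "free_abelian G \<longleftrightarrow> group G \<and> (\<exists>S :: 'a set. G \<cong> free_Abelian_group S)"

text \<open>The letter \<open>(g, True)\<close> stands for the generator \<open>g\<close> and \<open>(g, False)\<close> for its formal
  inverse.\<close>

type_synonym 'g word = "('g \<times> bool) list"

definition word_inv :: "'g word \<Rightarrow> 'g word" where
  "word_inv w = rev (map (\<lambda>(g, b). (g, \<not> b)) w)"

definition word_pow :: "'g word \<Rightarrow> int \<Rightarrow> 'g word" where
  "word_pow w n = concat (replicate (nat \<bar>n\<bar>) (if n \<ge> 0 then w else word_inv w))"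

definition word_conj :: "'g word \<Rightarrow> 'g word \<Rightarrow> 'g word" where
  "word_conj x y = word_inv y @ x @ y"

definition word_comm :: "'g word \<Rightarrow> 'g word \<Rightarrow> 'g word" where
  "word_comm x y = word_inv x @ word_inv y @ x @ y"

text \<open>Equality of words modulo relators: the least congruence on words that cancels adjacent
  mutually inverse letters and identifies each relator with the empty word.\<close>

inductive pres_eq :: "'g word set \<Rightarrow> 'g word \<Rightarrow> 'g word \<Rightarrow> bool" for R where
  refl: "pres_eq R u u"
| sym: "pres_eq R u v \<Longrightarrow> pres_eq R v u"
| trans: "pres_eq R u v \<Longrightarrow> pres_eq R v w \<Longrightarrow> pres_eq R u w"
| append: "pres_eq R u u' \<Longrightarrow> pres_eq R v v' \<Longrightarrow> pres_eq R (u @ v) (u' @ v')"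
| cancel: "pres_eq R [(g, b), (g, \<not> b)] []"
| relator: "r \<in> R \<Longrightarrow> pres_eq R r []"

definition pres_class :: "'g word set \<Rightarrow> 'g word \<Rightarrow> 'g word set" where
  "pres_class R u = {v. pres_eq R u v}"

text \<open>The group with generators all elements of the type \<open>'g\<close> and relators \<open>R\<close>.\<close>

definition presented_group :: "'g word set \<Rightarrow> 'g word set monoid" where
  "presented_group R =
     \<lparr>carrier = range (pres_class R),
      monoid.mult = (\<lambda>A B. \<Union>u\<in>A. \<Union>v\<in>B. pres_class R (u @ v)),
      one = pres_class R []\<rparr>"

lemma pres_class_eq_iff: "pres_class R u = pres_class R v \<longleftrightarrow> pres_eq R u v"
  unfolding pres_class_def by (auto intro: pres_eq.refl pres_eq.sym pres_eq.trans)

lemma presented_group_mult: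
  "pres_class R u \<otimes>\<^bsub>presented_group R\<^esub> pres_class R v = pres_class R (u @ v)"
  unfolding presented_group_def pres_class_def
  by (auto intro: pres_eq.refl pres_eq.sym pres_eq.trans pres_eq.append)

lemma pres_eq_word_inv_append: "pres_eq R (word_inv w @ w) []"
proof (induction w)
  case Nil
  show ?case by (simp add: word_inv_def pres_eq.refl)
next
  case (Cons x w)
  obtain g b where x: "x = (g, b)" by (cases x)
  have "pres_eq R ([(g, \<not> b), (g, b)] @ w) ([] @ w)"
    using pres_eq.cancel[of R g "\<not> b"] by (intro pres_eq.append pres_eq.refl) simp
  then have "pres_eq R (word_inv w @ [(g, \<not> b), (g, b)] @ w) (word_inv w @ w)"
    using pres_eq.append[OF pres_eq.refl] by fastforce
  then show ?case
    using Cons pres_eq.trans by (fastforce simp: x word_inv_def)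
qed

lemma group_presented_group: "group (presented_group R)"
proof (rule groupI)
  fix x assume "x \<in> carrier (presented_group R)"
  then obtain u where u: "x = pres_class R u" by (auto simp: presented_group_def)
  have "pres_class R (word_inv u) \<otimes>\<^bsub>presented_group R\<^esub> x = \<one>\<^bsub>presented_group R\<^esub>"
    unfolding u presented_group_mult
    by (simp add: presented_group_def pres_class_eq_iff pres_eq_word_inv_append)
  then show "\<exists>y\<in>carrier (presented_group R). y \<otimes>\<^bsub>presented_group R\<^esub> x = \<one>\<^bsub>presented_group R\<^esub>"
    by (auto simp: presented_group_def)
  show "\<one>\<^bsub>presented_group R\<^esub> \<otimes>\<^bsub>presented_group R\<^esub> x = x"
    using presented_group_mult[of R "[]" u] by (simp add: u presented_group_def)
next
  fix x y assume "x \<in> carrier (presented_group R)" "y \<in> carrier (presented_group R)"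
  then obtain u v where "x = pres_class R u" "y = pres_class R v"
    by (auto simp: presented_group_def)
  then show "x \<otimes>\<^bsub>presented_group R\<^esub> y \<in> carrier (presented_group R)"
    by (simp add: presented_group_mult) (simp add: presented_group_def)
next
  fix x y z
  assume "x \<in> carrier (presented_group R)" "y \<in> carrier (presented_group R)"
    "z \<in> carrier (presented_group R)"
  then obtain u v w where "x = pres_class R u" "y = pres_class R v" "z = pres_class R w"
    by (auto simp: presented_group_def)
  then show "x \<otimes>\<^bsub>presented_group R\<^esub> y \<otimes>\<^bsub>presented_group R\<^esub> z =
      x \<otimes>\<^bsub>presented_group R\<^esub> (y \<otimes>\<^bsub>presented_group R\<^esub> z)"
    by (simp add: presented_group_mult)
qed (simp add: presented_group_def)

datatype Gc_gen = Alpha | Beta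

abbreviation Gc_alpha :: "Gc_gen word" where "Gc_alpha \<equiv> [(Alpha, True)]"
abbreviation Gc_beta :: "Gc_gen word" where "Gc_beta \<equiv> [(Beta, True)]"

definition Gc_conj :: "int \<Rightarrow> Gc_gen word" where
  "Gc_conj i = word_conj Gc_beta (word_pow Gc_alpha i)"

text \<open>A tuple \<open>(c\<^sub>0, \<dots>, c\<^sub>s)\<close> is given by \<open>s\<close> and a function of which only the values at
  \<open>0, \<dots>, s\<close> matter.\<close>

definition Gc_relators :: "nat \<Rightarrow> (nat \<Rightarrow> int) \<Rightarrow> Gc_gen word set" where
  "Gc_relators s c =
     range (\<lambda>i. word_comm Gc_beta (Gc_conj i)) \<union>
     {concat (map (\<lambda>i. word_pow (Gc_conj (int i)) (c i)) [0..<Suc s])}"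

definition Gc :: "nat \<Rightarrow> (nat \<Rightarrow> int) \<Rightarrow> Gc_gen word set monoid" where
  "Gc s c = presented_group (Gc_relators s c)"

definition Gc_group :: "('a, 'b) monoid_scheme \<Rightarrow> bool" where
  "Gc_group G \<longleftrightarrow> group G \<and>
     (\<exists>s c. s \<ge> 1 \<and> c 0 \<noteq> 0 \<and> c s \<noteq> 0 \<and> Gcd (c ` {0..s}) = 1 \<and> G \<cong> Gc s c)"

definition proper_Gc_group :: "('a, 'b) monoid_scheme \<Rightarrow> bool" where
  "proper_Gc_group G \<longleftrightarrow> Gc_group G \<and> \<not> virtually_abelian G"

end

(* If none of (ii), (iii), (iv) holds, let T be the largest normal torsion subgroup of G and Q = G/T.
   Lifting along G -> Q shows that Q contains no proper Gc-group and Q' no free abelian group of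
   infinite rank: an infinite intersection with T would give (iv), and a finite one disappears after
   passing to powers. The key point is that if the conjugates of a under powers of g commute and
   generate a torsion-free group, then either some powers of a and g commute or <a, g> is a proper
   Gc-group, defined by the primitive integer polynomial of least degree that annihilates a.
   Take a maximal normal abelian subgroup A of Q. It is torsion-free and self-centralizing, since
   otherwise two elements of its centralizer generate a Heisenberg group, which is a proper Gc-group.
   Every element of Q has a power that centralizes A, so Q/A is a finitely generated soluble torsion
   group, hence finite. Finally the preimage of A is finitely generated with free abelian quotient by T,
   so T is finite and G is virtually abelian. *)

theory Submission
  imports Defs "HOL-Algebra.SndIsomorphismGrp" "HOL-Computational_Algebra.Polynomial_Factorial"
begin

section \<open>Subgroups of finite index\<close>

text \<open>The torsion radical T may be infinite without being finitely generated, so nothing lifts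
  from Q to G in one stroke. The failure of (iv) only speaks of finitely generated subgroups: one
  whose image in Q is torsion-free abelian or a proper Gc-group meets T in a finite set. Every
  lifting argument therefore takes place in a subgroup generated by finitely many lifts, where the
  finite kernel allows a passage to powers. This dictates the notion \<open>Gc_pair\<close>. It
  mentions no polynomial, only commuting conjugates, torsion-freeness and the absence of commuting
  powers, and these can be restored after lifting by taking powers. The polynomial enters only when
  a pair is turned into a Gc-group. Free abelian groups of infinite rank are likewise handled as
  sequences without integer relations. The failure of (ii) does two jobs. The conjugates of [a, g]
  under the powers of g lie in the derived subgroup, so they satisfy a relation, which is the
  polynomial annihilating a. It also provides, for each g in Q, one power that centralizes all of A,
  where the argument with pairs only gives a power for each element of A.\<close>

definition centralizer :: "('a, 'b) monoid_scheme \<Rightarrow> 'a set \<Rightarrow> 'a set" where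
  "centralizer G S = {x \<in> carrier G. \<forall>s\<in>S. x \<otimes>\<^bsub>G\<^esub> s = s \<otimes>\<^bsub>G\<^esub> x}"

text \<open>Turns exponents found for each element separately into one exponent for a finite set:
  their product is a multiple of each, and \<open>mult\<close> lets \<open>P\<close> pass to
  multiples.\<close>

lemma common_multiple:
  fixes P :: "'i \<Rightarrow> nat \<Rightarrow> bool"
  assumes "finite F" "\<And>i. i \<in> F \<Longrightarrow> \<exists>n>0. P i n"
    and mult: "\<And>i n k. i \<in> F \<Longrightarrow> P i n \<Longrightarrow> k > 0 \<Longrightarrow> P i (n * k)"
  shows "\<exists>n>0. \<forall>i\<in>F. P i n"
proof -
  obtain f where f: "\<And>i. i \<in> F \<Longrightarrow> f i > 0 \<and> P i (f i)"
    using assms(2) by metis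
  have "P i (prod f F)" if "i \<in> F" for i
  proof -
    have "prod f (F - {i}) > 0"
      using f assms(1) by (intro prod_pos) auto
    then show ?thesis
      using mult[OF that] f[OF that] prod.remove[OF assms(1) that, of f] by auto
  qed
  moreover have "prod f F > 0"
    using f by (intro prod_pos) auto
  ultimately show ?thesis by blast
qed

context group
begin

lemma inv_mult_cancel [simp]:
  "\<lbrakk>x \<in> carrier G; y \<in> carrier G\<rbrakk> \<Longrightarrow> inv x \<otimes> (x \<otimes> y) = y"
  "\<lbrakk>x \<in> carrier G; y \<in> carrier G\<rbrakk> \<Longrightarrow> x \<otimes> (inv x \<otimes> y) = y"
  by (simp_all add: m_assoc[symmetric])

lemma subgroup_centralizer:
  assumes "S \<subseteq> carrier G"
  shows "subgroup (centralizer G S) G"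
proof (rule subgroupI)
  fix a assume a: "a \<in> centralizer G S"
  have "inv a \<otimes> s = s \<otimes> inv a" if "s \<in> S" for s
  proof -
    have c: "a \<in> carrier G" "s \<in> carrier G" "a \<otimes> s = s \<otimes> a"
      using a that assms by (auto simp: centralizer_def)
    have "inv a \<otimes> s = inv a \<otimes> (s \<otimes> a) \<otimes> inv a"
      using c by (simp add: m_assoc)
    also have "\<dots> = s \<otimes> inv a"
      using c by (simp flip: c(3))
    finally show ?thesis .
  qed
  then show "inv a \<in> centralizer G S"
    using a by (auto simp: centralizer_def)
next
  fix a b assume a: "a \<in> centralizer G S" and b: "b \<in> centralizer G S"
  have "a \<otimes> b \<otimes> s = s \<otimes> (a \<otimes> b)" if "s \<in> S" for s
  proof -
    have c: "a \<in> carrier G" "b \<in> carrier G" "s \<in> carrier G" "a \<otimes> s = s \<otimes> a" "b \<otimes> s = s \<otimes> b"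
      using a b that assms by (auto simp: centralizer_def)
    have "a \<otimes> b \<otimes> s = a \<otimes> s \<otimes> b"
      using c(1-3) by (simp add: m_assoc c(5))
    also have "\<dots> = s \<otimes> a \<otimes> b" by (simp only: c(4))
    finally show ?thesis using c(1-3) by (simp add: m_assoc)
  qed
  then show "a \<otimes> b \<in> centralizer G S"
    using a b by (auto simp: centralizer_def)
next
  have "\<one> \<in> centralizer G S" using assms by (auto simp: centralizer_def subset_iff)
  then show "centralizer G S \<noteq> {}" by blast
qed (auto simp: centralizer_def)

lemma commute_int_pow:
  assumes "x \<otimes> y = y \<otimes> x" "x \<in> carrier G" "y \<in> carrier G"
  shows "x [^] (i::int) \<otimes> y = y \<otimes> x [^] i"
proof -
  have "x [^] i \<in> centralizer G {y}"
    using assms by (intro subgroup_int_pow_closed subgroup_centralizer) (auto simp: centralizer_def)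
  then show ?thesis by (simp add: centralizer_def)
qed

text \<open>Two passes through centralizers: \<open>S\<close> lies in the centralizer of
  \<open>T\<close>, hence so does the subgroup generated by \<open>S\<close>; then \<open>T\<close>
  lies in the centralizer of each such \<open>x\<close>.\<close>

lemma commute_generate:
  assumes "S \<subseteq> carrier G" "T \<subseteq> carrier G"
    and "\<And>s t. s \<in> S \<Longrightarrow> t \<in> T \<Longrightarrow> s \<otimes> t = t \<otimes> s"
    and "x \<in> generate G S" "y \<in> generate G T"
  shows "x \<otimes> y = y \<otimes> x"
proof -
  have "S \<subseteq> centralizer G T"
    using assms(1,3) by (auto simp: centralizer_def)
  then have "generate G S \<subseteq> centralizer G T"
    by (intro generate_subgroup_incl subgroup_centralizer assms)
  then have "T \<subseteq> centralizer G {x}"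
    using assms(2,4) by (auto simp: centralizer_def)
  moreover have "x \<in> carrier G"
    using assms generate_in_carrier by blast
  ultimately have "generate G T \<subseteq> centralizer G {x}"
    by (intro generate_subgroup_incl subgroup_centralizer) auto
  then show ?thesis using assms(5) by (auto simp: centralizer_def)
qed

lemma comm_group_generate:
  assumes "S \<subseteq> carrier G" "\<And>s t. s \<in> S \<Longrightarrow> t \<in> S \<Longrightarrow> s \<otimes> t = t \<otimes> s"
  shows "comm_group (G\<lparr>carrier := generate G S\<rparr>)"
  using commute_generate[OF assms(1) assms(1) assms(2)]
  by (intro group.group_comm_groupI subgroup_imp_group generate_is_subgroup assms) auto

lemma conj_nat_pow:
  assumes "x \<in> carrier G" "g \<in> carrier G"
  shows "(inv g \<otimes> x \<otimes> g) [^] (n::nat) = inv g \<otimes> x [^] n \<otimes> g"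
  using assms by (induction n) (simp_all add: m_assoc)

lemma conj_int_pow:
  assumes "x \<in> carrier G" "g \<in> carrier G"
  shows "(inv g \<otimes> x \<otimes> g) [^] (n::int) = inv g \<otimes> x [^] n \<otimes> g"
proof -
  have "inv (inv g \<otimes> x [^] m \<otimes> g) = inv g \<otimes> inv (x [^] m) \<otimes> g" for m :: nat
    using assms by (simp add: inv_mult_group m_assoc)
  then show ?thesis by (simp only: int_pow_def2 conj_nat_pow[OF assms] split: if_splits) blast
qed

lemma conj_iff_commute:
  assumes "x \<in> carrier G" "g \<in> carrier G"
  shows "inv g \<otimes> x \<otimes> g = x \<longleftrightarrow> x \<otimes> g = g \<otimes> x"
proof
  assume "inv g \<otimes> x \<otimes> g = x"
  then have "g \<otimes> (inv g \<otimes> x \<otimes> g) = g \<otimes> x" by simp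
  then show "x \<otimes> g = g \<otimes> x" using assms by (simp add: m_assoc)
next
  assume "x \<otimes> g = g \<otimes> x"
  then show "inv g \<otimes> x \<otimes> g = x" using assms by (simp add: m_assoc)
qed

lemma ex_pow_collision:
  assumes "finite (range (f :: nat \<Rightarrow> 'c))"
  shows "\<exists>m k. k > 0 \<and> f (m + k) = f m"
proof -
  have "\<not> inj f" using assms finite_imageD infinite_UNIV_nat by blast
  then obtain i j where "i < j" "f i = f j"
    by (metis injI linorder_neqE_nat)
  then have "j - i > 0 \<and> f (i + (j - i)) = f i" by simp
  then show ?thesis by blast
qed

text \<open>The cosets of the powers of \<open>x\<close> cannot all differ, and in a coincidence the
  common factor \<open>x [^] m\<close> cancels.\<close>

lemma finite_index_pow:
  assumes "subgroup V G" "finite (rcosets V)" "x \<in> carrier G"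
  obtains n where "n > (0::nat)" "x [^] n \<in> V"
proof -
  have "range (\<lambda>i::nat. V #> x [^] i) \<subseteq> rcosets V"
    using assms by (auto intro!: rcosetsI subgroup.subset)
  then have "finite (range (\<lambda>i::nat. V #> x [^] i))"
    using assms(2) finite_subset by blast
  then obtain m k :: nat where k: "k > 0" "V #> x [^] (m + k) = V #> x [^] m"
    using ex_pow_collision[of "\<lambda>i. V #> x [^] i"] by blast
  have "x [^] (m + k) \<in> V #> x [^] m"
    using assms k(2) by (metis rcos_self nat_pow_closed)
  then have "x [^] (m + k) \<otimes> inv (x [^] m) \<in> V"
    using subgroup.rcos_module_imp[OF assms(1) is_group] assms(3) by blast
  moreover have "x [^] (m + k) \<otimes> inv (x [^] m) = x [^] k"
    using assms(3) nat_pow_mult[of x k m] by (metis add.commute inv_solve_right nat_pow_closed)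
  ultimately show ?thesis using that k(1) by simp
qed

lemma finitely_generated_subgroup_iff:
  assumes "subgroup H G"
  shows "finitely_generated (G\<lparr>carrier := H\<rparr>) \<longleftrightarrow> (\<exists>S. finite S \<and> S \<subseteq> H \<and> generate G S = H)"
  using generate_consistent[OF _ assms] by (auto simp: finitely_generated_def)

lemma finitely_generated_generate:
  assumes "finite S" "S \<subseteq> carrier G"
  shows "finitely_generated (G\<lparr>carrier := generate G S\<rparr>)"
  unfolding finitely_generated_subgroup_iff[OF generate_is_subgroup[OF assms(2)]]
  using assms by (auto intro: generate.incl)

text \<open>Schreier's lemma; the generators are the elements \<open>r s r'\<inverse>\<close> that lie in the subgroup, with
  \<open>r\<close> and \<open>r'\<close> coset representatives and \<open>s\<close> a generator or its inverse.\<close>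

lemma finitely_generated_finite_index:
  assumes fg: "finitely_generated G" and V: "subgroup V G" and fin: "finite (rcosets V)"
  shows "finitely_generated (G\<lparr>carrier := V\<rparr>)"
proof -
  interpret V: subgroup V G by fact
  obtain S where S: "finite S" "S \<subseteq> carrier G" "generate G S = carrier G"
    using fg by (auto simp: finitely_generated_def)
  define rep where "rep x = (SOME y. y \<in> V #> x)" for x
  have rep: "rep x \<in> carrier G" "x \<otimes> inv (rep x) \<in> V" if "x \<in> carrier G" for x
  proof -
    have r: "rep x \<in> V #> x"
      unfolding rep_def using rcos_self[OF that V] by (rule someI)
    then show c: "rep x \<in> carrier G"
      using V.elemrcos_carrier[OF is_group that] by blast
    have "rep x \<otimes> inv x \<in> V"
      using V.rcos_module_imp[OF is_group that r] .
    then have "inv (rep x \<otimes> inv x) \<in> V" by (rule V.m_inv_closed)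
    then show "x \<otimes> inv (rep x) \<in> V" using c that by (simp add: inv_mult_group)
  qed
  \<comment> \<open>\<open>rep\<close> need not choose \<open>\<one>\<close> for the coset
    \<open>V\<close> itself, so \<open>\<one>\<close> is added; the products in \<open>X\<close>
    start from it.\<close>
  define R where "R = insert \<one> (rep ` carrier G)"
  have "rep ` carrier G \<subseteq> (\<lambda>X. SOME y. y \<in> X) ` (rcosets V)"
    unfolding rep_def by (auto intro!: imageI rcosetsI V.subset)
  then have finR: "finite R"
    unfolding R_def using fin by (meson finite_imageI finite_insert finite_subset)
  have RG: "R \<subseteq> carrier G" using rep unfolding R_def by auto
  define S' where "S' = insert \<one> (S \<union> m_inv G ` S)"
  have S'G: "S' \<subseteq> carrier G" using S(2) by (auto simp: S'_def)
  define T where "T = V \<inter> (\<lambda>(r, s, q). r \<otimes> s \<otimes> inv q) ` (R \<times> S' \<times> R)"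
  have finT: "finite T" using finR S(1) by (auto simp: T_def S'_def)
  have TV: "T \<subseteq> V" by (auto simp: T_def)
  then have TG: "T \<subseteq> carrier G" by auto
  define W where "W = generate G T"
  interpret W: subgroup W G unfolding W_def by (rule generate_is_subgroup[OF TG])
  define X where "X = (\<lambda>(w, r). w \<otimes> r) ` (W \<times> R)"
  have XG: "X \<subseteq> carrier G" using RG by (auto simp: X_def)
  \<comment> \<open>Writing \<open>r \<otimes> s\<close> as
    \<open>(r \<otimes> s \<otimes> inv ?q) \<otimes> ?q\<close> puts the bracket into
    \<open>T\<close> and \<open>?q\<close> into \<open>R\<close>. So \<open>X\<close> absorbs
    generators on the right and, containing \<open>\<one>\<close>, is the whole group.\<close>
  have step: "x \<otimes> s \<in> X" if x: "x \<in> X" and s: "s \<in> S'" for x s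
  proof -
    obtain w r where wr: "w \<in> W" "r \<in> R" "x = w \<otimes> r" using x by (auto simp: X_def)
    have c: "w \<in> carrier G" "r \<in> carrier G" "s \<in> carrier G" using wr RG s S'G by auto
    let ?q = "rep (r \<otimes> s)"
    have q: "?q \<in> R" "?q \<in> carrier G" "r \<otimes> s \<otimes> inv ?q \<in> V"
      using rep[of "r \<otimes> s"] c by (auto simp: R_def)
    then have "r \<otimes> s \<otimes> inv ?q \<in> T" using wr s by (force simp: T_def)
    then have "w \<otimes> (r \<otimes> s \<otimes> inv ?q) \<in> W"
      using wr by (auto simp: W_def intro: generate.eng generate.incl)
    moreover have "x \<otimes> s = w \<otimes> (r \<otimes> s \<otimes> inv ?q) \<otimes> ?q"
      using c q wr by (simp add: m_assoc)
    ultimately show ?thesis using q by (force simp: X_def)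
  qed
  have "\<forall>x\<in>X. x \<otimes> h \<in> X" if "h \<in> generate G S" for h
    using that
  proof induction
    case one
    then show ?case using XG by auto
  next
    case (incl h)
    then show ?case using step by (auto simp: S'_def)
  next
    case (inv h)
    then show ?case using step by (auto simp: S'_def)
  next
    case (eng h1 h2)
    have "h1 \<in> carrier G" "h2 \<in> carrier G" using eng S by auto
    then show ?case using eng(3,4) XG by (auto simp: m_assoc[symmetric] subset_iff)
  qed
  moreover have "\<one> \<in> X" unfolding X_def by (rule image_eqI[of _ _ "(\<one>, \<one>)"]) (auto simp: R_def)
  ultimately have GX: "carrier G \<subseteq> X" using S(3) by force
  have "V \<subseteq> W"
  proof
    fix v assume v: "v \<in> V"
    then have "v \<in> X" using GX by auto
    then obtain w r where wr: "w \<in> W" "r \<in> R" "v = w \<otimes> r" by (auto simp: X_def)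
    have WV: "W \<subseteq> V" unfolding W_def by (rule generate_subgroup_incl[OF TV V])
    have c: "w \<in> carrier G" "r \<in> carrier G" using wr RG by auto
    have "inv w \<otimes> v \<in> V" using v wr(1) WV by auto
    then have "r \<in> V" using wr(3) c by simp
    \<comment> \<open>The trivial letter in \<open>S'\<close> and the trivial representative in
      \<open>R\<close> make every element of \<open>R\<close> that lies in \<open>V\<close> a member
      of \<open>T\<close>.\<close>
    moreover have "r = r \<otimes> \<one> \<otimes> inv \<one>" using c by simp
    moreover have "\<one> \<in> S'" "\<one> \<in> R" by (auto simp: S'_def R_def)
    ultimately have "r \<in> T" using wr(2) unfolding T_def
      by (intro IntI rev_image_eqI[of "(r, \<one>, \<one>)"]) simp_all
    then show "v \<in> W" using wr by (auto simp: W_def intro: generate.eng generate.incl)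
  qed
  then have "generate G T = V"
    using generate_subgroup_incl[OF TV V] unfolding W_def by blast
  then show ?thesis
    using finT TV by (auto simp: finitely_generated_subgroup_iff[OF V])
qed

end

section \<open>Finiteness of finitely generated soluble torsion groups\<close>

lemma finitely_generated_img:
  assumes "group_hom G H h" "h ` carrier G = carrier H" "finitely_generated G"
  shows "finitely_generated H"
proof -
  obtain S where "finite S" "S \<subseteq> carrier G" "generate G S = carrier G"
    using assms(3) by (auto simp: finitely_generated_def)
  then show ?thesis
    using group_hom.generate_img[OF assms(1), of S] assms(2)
    unfolding finitely_generated_def by (metis finite_imageI image_mono)
qed

lemma (in comm_group) finite_generate_torsion:
  assumes "finite S" "S \<subseteq> carrier G" "torsion_set G S"
  shows "finite (generate G S)"
  using assms
proof (induction S rule: finite_induct)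
  case empty
  then show ?case by (simp add: generate_empty)
next
  case (insert s S)
  have fin: "finite (generate G S)" and sc: "s \<in> carrier G"
    using insert by (auto simp: torsion_set_def)
  obtain n :: nat where n: "n > 0" "s [^] n = \<one>"
    using insert.prems(2) by (auto simp: torsion_set_def)
  let ?X = "range (\<lambda>i::nat. s [^] i) <#> generate G S"
  have SG: "generate G S \<subseteq> carrier G" using insert generate_incl by auto
  have "s [^] i \<in> (\<lambda>i. s [^] i) ` {..<n}" for i :: nat
  proof -
    have "s [^] i = s [^] (n * (i div n) + i mod n)" by simp
    also have "\<dots> = s [^] (i mod n)"
      using sc n(2) by (simp only: nat_pow_mult[symmetric] nat_pow_pow[symmetric]) simp
    finally show ?thesis using n(1) by auto
  qed
  then have "range (\<lambda>i::nat. s [^] i) \<subseteq> (\<lambda>i. s [^] i) ` {..<n}" by blast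
  then have fr: "finite (range (\<lambda>i::nat. s [^] i))" by (rule finite_subset) auto
  have "subgroup (range (\<lambda>i::nat. s [^] i)) G"
  proof (rule subgroupI)
    fix a assume "a \<in> range (\<lambda>i::nat. s [^] i)"
    then obtain i :: nat where a: "a = s [^] i" by auto
    \<comment> \<open>The inverse has to be a natural power of \<open>s\<close>; this exponent works
      because \<open>i * (n - 1) + i\<close> is a multiple of \<open>n\<close>.\<close>
    have "s [^] (i * (n - 1)) \<otimes> a = s [^] (i * (n - 1) + i)"
      unfolding a using sc by (simp add: nat_pow_mult)
    also have "i * (n - 1) + i = n * i" using n(1) by (cases n) auto
    also have "s [^] (n * i) = \<one>" using sc n(2) by (simp flip: nat_pow_pow)
    finally have "inv a = s [^] (i * (n - 1))" using a sc by (simp add: inv_equality)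
    then show "inv a \<in> range (\<lambda>i::nat. s [^] i)" by auto
  qed (use sc in \<open>auto simp: nat_pow_mult\<close>)
  moreover have sg: "subgroup (generate G S) G"
    using insert by (intro generate_is_subgroup) auto
  ultimately have "subgroup ?X G" by (rule mult_subgroups)
  moreover have "insert s S \<subseteq> ?X"
  proof -
    have "s [^] (1::nat) \<otimes> \<one> \<in> ?X"
      unfolding set_mult_def using generate.one by blast
    then have "s \<in> ?X" using sc by simp
    moreover have "x \<in> ?X" if "x \<in> S" for x
    proof -
      have "s [^] (0::nat) \<otimes> x \<in> ?X"
        unfolding set_mult_def using generate.incl[OF that] by blast
      then show ?thesis using that insert.prems by auto
    qed
    ultimately show ?thesis by auto
  qed
  ultimately have "generate G (insert s S) \<subseteq> ?X" by (intro generate_subgroup_incl)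
  moreover have "finite ?X"
    unfolding set_mult_def by (intro finite_UN_I fr fin) auto
  ultimately show ?case by (rule finite_subset)
qed

lemma (in group) finite_of_finite_index:
  assumes "subgroup V G" "finite V" "finite (rcosets V)"
  shows "finite (carrier G)"
  using rcosets_part_G[OF assms(1)] assms rcosets_finite[OF _ subgroup.subset[OF assms(1)]]
  by (metis finite_Union)

text \<open>Induction on the derived length. The abelianization is a finitely generated abelian
  torsion group, hence finite. So the derived subgroup has finite index, Schreier's lemma makes it
  finitely generated, and the induction hypothesis applies to it.\<close>

lemma finite_of_solvable_torsion:
  assumes "group G" "finitely_generated G" "torsion_set G (carrier G)"
    and "(derived G ^^ n) (carrier G) = {\<one>\<^bsub>G\<^esub>}"
  shows "finite (carrier G)"
  using assms
proof (induction n arbitrary: G)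
  case 0
  then show ?case by simp
next
  case (Suc n)
  interpret group G by fact
  let ?D = "derived G (carrier G)"
  interpret D: normal ?D G by (rule derived_self_is_normal)
  interpret Q: comm_group "G Mod ?D" by (rule derived_quot_is_comm_group)
  interpret h: group_hom G "G Mod ?D" "\<lambda>x. ?D #>\<^bsub>G\<^esub> x"
    by (intro group_hom.intro group_hom_axioms.intro Q.is_group D.r_coset_hom_Mod is_group)
  have surj: "(\<lambda>x. ?D #>\<^bsub>G\<^esub> x) ` carrier G = carrier (G Mod ?D)" by (simp add: carrier_FactGroup)
  obtain S where S: "finite S" "S \<subseteq> carrier (G Mod ?D)" "generate (G Mod ?D) S = carrier (G Mod ?D)"
    using finitely_generated_img[OF h.group_hom_axioms surj Suc.prems(2)]
    by (auto simp: finitely_generated_def)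
  have "torsion_set (G Mod ?D) (carrier (G Mod ?D))"
    unfolding torsion_set_def surj[symmetric]
  proof (intro ballI, elim imageE)
    fix u x assume x: "x \<in> carrier G" and u: "u = ?D #>\<^bsub>G\<^esub> x"
    obtain m :: nat where m: "m > 0" "x [^]\<^bsub>G\<^esub> m = \<one>\<^bsub>G\<^esub>"
      using Suc.prems(3) x by (auto simp: torsion_set_def)
    then have "u [^]\<^bsub>G Mod ?D\<^esub> m = \<one>\<^bsub>G Mod ?D\<^esub>"
      using h.hom_nat_pow[OF x, of m] h.hom_one u by metis
    then show "\<exists>m::nat. m > 0 \<and> u [^]\<^bsub>G Mod ?D\<^esub> m = \<one>\<^bsub>G Mod ?D\<^esub>" using m(1) by blast
  qed
  then have "finite (carrier (G Mod ?D))"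
    using Q.finite_generate_torsion[OF S(1,2)] S by (auto simp: torsion_set_def subset_iff)
  then have fi: "finite (rcosets\<^bsub>G\<^esub> ?D)" by (simp add: FactGroup_def)
  have "finite (carrier (G\<lparr>carrier := ?D\<rparr>))"
  proof (rule Suc.IH)
    show "group (G\<lparr>carrier := ?D\<rparr>)" by (rule subgroup_imp_group[OF D.is_subgroup])
    show "finitely_generated (G\<lparr>carrier := ?D\<rparr>)"
      by (rule finitely_generated_finite_index[OF Suc.prems(2) D.is_subgroup fi])
    show "torsion_set (G\<lparr>carrier := ?D\<rparr>) (carrier (G\<lparr>carrier := ?D\<rparr>))"
      using Suc.prems(3) by (auto simp: torsion_set_def simp flip: nat_pow_consistent)
    \<comment> \<open>The derived series of \<open>?D\<close> is the same inside \<open>?D\<close>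
      and inside \<open>G\<close>. The inclusion in \<open>?D\<close> is carried along because the
      comparison at the next stage needs it.\<close>
    have "(derived (G\<lparr>carrier := ?D\<rparr>) ^^ m) ?D = (derived G ^^ m) ?D \<and> (derived G ^^ m) ?D \<subseteq> ?D" for m
    proof (induction m)
      case (Suc m)
      then show ?case
        using derived_consistent[OF _ D.is_subgroup] derived_incl[OF _ D.is_subgroup] by auto
    qed simp
    then show "(derived (G\<lparr>carrier := ?D\<rparr>) ^^ n) (carrier (G\<lparr>carrier := ?D\<rparr>)) = {\<one>\<^bsub>G\<lparr>carrier := ?D\<rparr>\<^esub>}"
      using Suc.prems(4) by (simp add: funpow_swap1)
  qed
  then show ?case using finite_of_finite_index[OF D.is_subgroup _ fi] by simp
qed

section \<open>Products of powers in a commuting family\<close>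

text \<open>Ordered, because the ambient group is in general not abelian. For a sequence of
  conjugates it is the value of the last relator of a Gc-group.\<close>

primrec eprod :: "('a, 'b) monoid_scheme \<Rightarrow> (nat \<Rightarrow> 'a) \<Rightarrow> (nat \<Rightarrow> int) \<Rightarrow> nat \<Rightarrow> 'a" where
  "eprod G z c 0 = \<one>\<^bsub>G\<^esub>"
| "eprod G z c (Suc n) = eprod G z c n \<otimes>\<^bsub>G\<^esub> z n [^]\<^bsub>G\<^esub> c n"

definition commuting_family :: "('a, 'b) monoid_scheme \<Rightarrow> (nat \<Rightarrow> 'a) \<Rightarrow> bool" where
  "commuting_family G z \<longleftrightarrow>
     range z \<subseteq> carrier G \<and> (\<forall>i j. z i \<otimes>\<^bsub>G\<^esub> z j = z j \<otimes>\<^bsub>G\<^esub> z i)"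

text \<open>For a commuting family and \<open>I = UNIV\<close> this makes the sequence a basis of a
  free abelian group of infinite rank. Exponents outside \<open>I\<close> are unrestricted, which
  leaves room for trivial entries of \<open>z\<close>.\<close>

definition independent_on :: "('a, 'b) monoid_scheme \<Rightarrow> nat set \<Rightarrow> (nat \<Rightarrow> 'a) \<Rightarrow> bool" where
  "independent_on G I z \<longleftrightarrow> (\<forall>c n. eprod G z c n = \<one>\<^bsub>G\<^esub> \<longrightarrow> (\<forall>i<n. i \<in> I \<longrightarrow> c i = 0))"

lemma eprod_cong:
  assumes "\<And>i. i < n \<Longrightarrow> z i [^]\<^bsub>G\<^esub> c i = w i [^]\<^bsub>G\<^esub> d i"
  shows "eprod G z c n = eprod G w d n"
  using assms by (induction n) auto

lemma (in group_hom) hom_eprod: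
  assumes "range z \<subseteq> carrier G"
  shows "h (eprod G z c n) = eprod H (\<lambda>i. h (z i)) c n"
proof -
  have "z i \<in> carrier G" for i using assms by auto
  moreover from this have "eprod G z c n \<in> carrier G" for n by (induction n) auto
  ultimately show ?thesis by (induction n) (auto simp: hom_int_pow)
qed

context group
begin

lemma eprod_in_subgroup:
  assumes "subgroup K G" "\<And>i. i < n \<Longrightarrow> z i \<in> K"
  shows "eprod G z c n \<in> K"
  using assms(2)
  by (induction n) (auto intro: subgroup.one_closed[OF assms(1)] subgroup.m_closed[OF assms(1)]
      subgroup_int_pow_closed[OF assms(1)])

lemma eprod_closed [simp]: "range z \<subseteq> carrier G \<Longrightarrow> eprod G z c n \<in> carrier G"
  by (rule eprod_in_subgroup[OF subgroup_self]) auto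

lemma eprod_consistent:
  assumes "subgroup K G" "range z \<subseteq> K"
  shows "eprod (G\<lparr>carrier := K\<rparr>) z c n = eprod G z c n"
proof -
  have "z i [^]\<^bsub>G\<lparr>carrier := K\<rparr>\<^esub> c i = z i [^] c i" for i
    using int_pow_consistent[OF assms(1), of "z i" "c i"] assms(2) by (metis rangeI subsetD)
  then show ?thesis by (induction n) auto
qed

lemma eprod_trivial:
  assumes "\<And>i. i < n \<Longrightarrow> z i [^] c i = \<one>"
  shows "eprod G z c n = \<one>"
  using assms by (induction n) auto

lemma eprod_extend:
  assumes "range z \<subseteq> carrier G" "n \<le> m" "\<And>i. n \<le> i \<Longrightarrow> i < m \<Longrightarrow> z i [^] c i = \<one>"
  shows "eprod G z c m = eprod G z c n"
  using assms(2,3)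
proof (induction m)
  case (Suc m)
  then show ?case using assms(1) by (cases "n = Suc m") auto
qed simp

lemma eprod_single:
  assumes "range z \<subseteq> carrier G" "k < n" "\<And>i. i < n \<Longrightarrow> i \<noteq> k \<Longrightarrow> z i [^] c i = \<one>"
  shows "eprod G z c n = z k [^] c k"
proof -
  have zk: "z k \<in> carrier G" using assms(1) by auto
  have "eprod G z c n = eprod G z c (Suc k)"
    using assms by (intro eprod_extend) auto
  also have "\<dots> = z k [^] c k"
    using assms zk eprod_trivial[of k z c] by simp
  finally show ?thesis .
qed

lemma eprod_pow:
  assumes "range z \<subseteq> carrier G"
  shows "eprod G (\<lambda>i. z i [^] (m i :: int)) c n = eprod G z (\<lambda>i. m i * c i) n"
proof (rule eprod_cong)
  show "(z i [^] m i) [^] c i = z i [^] (m i * c i)" for i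
    using assms by (intro int_pow_pow) auto
qed

lemma eprod_in_generate:
  assumes "range z \<subseteq> carrier G"
  shows "eprod G z c n \<in> generate G (range z)"
  using assms by (intro eprod_in_subgroup generate_is_subgroup) (auto intro: generate.incl)

lemma commuting_family_generate:
  assumes "commuting_family G z" "x \<in> generate G (range z)" "y \<in> generate G (range z)"
  shows "x \<otimes> y = y \<otimes> x"
  using assms commute_generate[of "range z" "range z" x y] by (auto simp: commuting_family_def)

lemma eprod_add:
  assumes "commuting_family G z"
  shows "eprod G z (\<lambda>i. c i + d i) n = eprod G z c n \<otimes> eprod G z d n"
proof (induction n)
  case (Suc n)
  have z: "range z \<subseteq> carrier G" "z n \<in> carrier G" using assms by (auto simp: commuting_family_def)
  have "z n \<in> generate G (range z)" by (rule generate.incl) simp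
  then have "z n [^] c n \<in> generate G (range z)"
    by (intro subgroup_int_pow_closed generate_is_subgroup z)
  then have comm: "eprod G z d n \<otimes> z n [^] c n = z n [^] c n \<otimes> eprod G z d n"
    by (intro commuting_family_generate[OF assms] eprod_in_generate z)
  have "eprod G z (\<lambda>i. c i + d i) (Suc n)
      = eprod G z c n \<otimes> (eprod G z d n \<otimes> z n [^] c n) \<otimes> z n [^] d n"
    using z by (simp add: Suc int_pow_mult m_assoc)
  also have "\<dots> = eprod G z c (Suc n) \<otimes> eprod G z d (Suc n)"
    unfolding comm using z by (simp add: m_assoc)
  finally show ?case .
qed simp

lemma eprod_zero: "eprod G z (\<lambda>i. 0) n = \<one>"
  by (rule eprod_trivial) simp

lemma eprod_nat_pow:
  assumes "commuting_family G z"
  shows "eprod G z (\<lambda>i. int k * c i) n = eprod G z c n [^] k"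
proof (induction k)
  case (Suc k)
  have "eprod G z (\<lambda>i. int (Suc k) * c i) n = eprod G z (\<lambda>i. int k * c i + c i) n"
    by (simp add: algebra_simps)
  then show ?case by (simp add: eprod_add[OF assms] Suc)
qed (simp add: eprod_zero)

text \<open>The vanishing of \<open>c\<close> from \<open>n\<close> on is carried along so that two
  such products can be extended to a common length and their exponents added.\<close>

lemma generate_range_eprod:
  assumes "commuting_family G z" "x \<in> generate G (range z)"
  shows "\<exists>c n. (\<forall>i\<ge>n. c i = 0) \<and> x = eprod G z c n"
  using assms(2)
proof induction
  have z: "range z \<subseteq> carrier G" "z k \<in> carrier G" for k
    using assms by (auto simp: commuting_family_def)
  have s: "eprod G z (\<lambda>i. if i = k then e else 0) (Suc k) = z k [^] e" for k e
    using eprod_single[OF z(1), of k "Suc k" "\<lambda>i. if i = k then e else 0"] by simp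
  {
    case one
    show ?case by (intro exI[of _ "\<lambda>_. 0"] exI[of _ 0]) simp
  next
    case (incl h)
    then obtain k where "h = z k" by auto
    then show ?case using s[of k 1] z
      by (intro exI[of _ "\<lambda>i. if i = k then 1 else 0"] exI[of _ "Suc k"]) auto
  next
    case (inv h)
    then obtain k where "h = z k" by auto
    then show ?case using s[of k "-1"] z by (intro exI[of _ "\<lambda>i. if i = k then -1 else 0"] exI[of _ "Suc k"])
       (simp add: int_pow_neg)
  next
    case (eng h1 h2)
    obtain c n d m where *: "\<forall>i\<ge>n. c i = 0" "h1 = eprod G z c n" "\<forall>i\<ge>m. d i = 0" "h2 = eprod G z d m"
      using eng.IH by blast
    have "h1 = eprod G z c (max n m)" "h2 = eprod G z d (max n m)"
      using * z by (auto intro!: eprod_extend[symmetric])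
    then have "h1 \<otimes> h2 = eprod G z (\<lambda>i. c i + d i) (max n m)" by (simp add: eprod_add[OF assms(1)])
    then show ?case using * by (intro exI[of _ "\<lambda>i. c i + d i"] exI[of _ "max n m"]) auto
  }
qed

text \<open>Indices outside \<open>I\<close> are idle: there \<open>z\<close> takes the value \<open>\<one>\<close>. This covers finite and
  infinite bases at once.\<close>

lemma iso_free_Abelian_group:
  assumes comm: "commuting_family G z" and gen: "generate G (range z) = carrier G"
    and ind: "independent_on G I z" and idle: "\<And>i. i \<notin> I \<Longrightarrow> z i = \<one>" and inj: "inj_on b I"
  shows "G \<cong> free_Abelian_group (b ` I)"
proof -
  interpret comm_group G
    using commuting_family_generate[OF comm] gen
    by (intro group_comm_groupI) auto
  let ?F = "free_Abelian_group (b ` I)"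
  interpret F: comm_group ?F by (rule abelian_free_Abelian_group)
  have z: "range z \<subseteq> carrier G" using comm by (simp add: commuting_family_def)
  have "(\<lambda>s. z (inv_into I b s)) ` (b ` I) \<subseteq> carrier G" using z by auto
  \<comment> \<open>The universal property only gives maps out of the free group, so the isomorphism
    is built in that direction and inverted at the end.\<close>
  then obtain h where h: "h \<in> hom ?F G" "\<And>s. s \<in> b ` I \<Longrightarrow> h (frag_of s) = z (inv_into I b s)"
    by (rule free_Abelian_group_universal) blast
  interpret h: group_hom ?F G h by unfold_locales (rule h)
  \<comment> \<open>A preimage of the family \<open>z\<close>, trivial at the idle indices, so that
    \<open>h\<close> carries each \<open>eprod\<close> over \<open>w\<close> to the
    \<open>eprod\<close> over \<open>z\<close> with the same exponents.\<close>
  define w where "w i = (if i \<in> I then frag_of (b i) else 0)" for i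
  have w: "range w \<subseteq> carrier ?F" by (auto simp: w_def)
  have wcomm: "commuting_family ?F w" using w by (auto simp: commuting_family_def add.commute)
  have hw: "h (w i) = z i" for i
    using h(2)[of "b i"] inj idle[of i] h.hom_one by (auto simp: w_def)
  have hE: "h (eprod ?F w c n) = eprod G z c n" for c n
    using h.hom_eprod[OF w] by (simp add: hw)
  have "x \<in> generate ?F (range w)" if "Poly_Mapping.keys x \<subseteq> b ` I" for x
    using that
  proof (induction x rule: free_Abelian_group_induct[consumes 1, case_names zero diff frag_of])
    case zero
    then show ?case using generate.one[of ?F] by simp
  next
    case (diff x y)
    then have "x \<otimes>\<^bsub>?F\<^esub> inv\<^bsub>?F\<^esub> y \<in> generate ?F (range w)"
      by (intro generate.eng F.generate_m_inv_closed[OF w])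
    then show ?case using diff by simp
  next
    case (frag_of s)
    then obtain i where "i \<in> I" "frag_of s = w i" by (auto simp: w_def)
    then show ?case by (metis generate.incl rangeI)
  qed
  then have surjF: "\<exists>c n. x = eprod ?F w c n" if "x \<in> carrier ?F" for x
    using F.generate_range_eprod[OF wcomm, of x] that by (simp only: carrier_free_Abelian_group_iff) blast
  have "x = \<one>\<^bsub>?F\<^esub>" if hx: "x \<in> carrier ?F" "h x = \<one>" for x
  proof -
    obtain c n where x: "x = eprod ?F w c n" using surjF[OF hx(1)] by blast
    then have "eprod G z c n = \<one>" using hx(2) by (simp only: hE)
    then have "\<forall>i<n. i \<in> I \<longrightarrow> c i = 0"
      using ind unfolding independent_on_def by blast
    then have "eprod ?F w c n = \<one>\<^bsub>?F\<^esub>"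
      using w by (intro F.eprod_trivial) (auto simp: w_def)
    then show ?thesis using x by simp
  qed
  moreover have "carrier G \<subseteq> h ` carrier ?F"
  proof
    fix x assume "x \<in> carrier G"
    then obtain c n where "x = eprod G z c n" using generate_range_eprod[OF comm] gen by blast
    then show "x \<in> h ` carrier ?F" using hE[of c n] F.eprod_closed[OF w] by (metis imageI)
  qed
  ultimately have "h \<in> iso ?F G" by (auto simp: h.iso_iff simp del: one_free_Abelian_group)
  then show ?thesis
    using F.iso_set_sym unfolding is_iso_def by blast
qed

lemma free_Abelian_group_of_independent_family:
  assumes "commuting_family G z" "independent_on G UNIV z"
  shows "G\<lparr>carrier := generate G (range z)\<rparr> \<cong> free_Abelian_group (UNIV :: nat set)"
proof -
  have z: "range z \<subseteq> carrier G" using assms by (simp add: commuting_family_def)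
  let ?K = "generate G (range z)"
  have K: "subgroup ?K G" by (rule generate_is_subgroup[OF z])
  interpret K: group "G\<lparr>carrier := ?K\<rparr>" by (rule subgroup_imp_group[OF K])
  have zK: "range z \<subseteq> ?K" by (auto intro: generate.incl)
  have "G\<lparr>carrier := ?K\<rparr> \<cong> free_Abelian_group (id ` (UNIV :: nat set))"
  proof (rule K.iso_free_Abelian_group)
    show "commuting_family (G\<lparr>carrier := ?K\<rparr>) z"
      using assms(1) zK by (simp add: commuting_family_def)
    show "generate (G\<lparr>carrier := ?K\<rparr>) (range z) = carrier (G\<lparr>carrier := ?K\<rparr>)"
      using generate_consistent[OF zK K] by simp
    show "independent_on (G\<lparr>carrier := ?K\<rparr>) UNIV z"
      using assms(2) eprod_consistent[OF K zK] by (simp add: independent_on_def)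
  qed auto
  then show ?thesis by simp
qed

end

definition torsion_free_set :: "('a, 'b) monoid_scheme \<Rightarrow> 'a set \<Rightarrow> bool" where
  "torsion_free_set G B \<longleftrightarrow> (\<forall>x\<in>B. \<forall>n>0. x [^]\<^bsub>G\<^esub> (n::nat) = \<one>\<^bsub>G\<^esub> \<longrightarrow> x = \<one>\<^bsub>G\<^esub>)"

lemma (in group) torsion_free_int_pow:
  assumes "torsion_free_set G B" "x \<in> B" "x \<in> carrier G" "x [^] (k::int) = \<one>" "k \<noteq> 0"
  shows "x = \<one>"
proof -
  obtain n where n: "k = int n \<or> k = - int n" by (metis int_cases2)
  then have "x [^] n = \<one>"
    using assms(3,4) int_pow_int[of G x n] int_pow_neg_int[of x n] by (metis inv_eq_1_iff nat_pow_closed)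
  then show ?thesis using n assms(1,2,5) by (auto simp: torsion_free_set_def)
qed

section \<open>Torsion-free abelian groups\<close>

context comm_group
begin

lemma commuting_family: "range z \<subseteq> carrier G \<Longrightarrow> commuting_family G z"
  by (auto simp: commuting_family_def intro: m_comm)

lemma eprod_mult:
  assumes "range z \<subseteq> carrier G" "range w \<subseteq> carrier G"
  shows "eprod G (\<lambda>i. z i \<otimes> w i) c n = eprod G z c n \<otimes> eprod G w c n"
proof (induction n)
  case (Suc n)
  have "z n \<in> carrier G" "w n \<in> carrier G" using assms by auto
  then show ?case using Suc assms by (simp add: int_pow_distrib m_ac)
qed simp

text \<open>The new generator at \<open>j\<close> contributes an extra factor
  \<open>z i [^] (e * c j)\<close>, which the lowered exponent at \<open>i\<close> takes away
  again.\<close>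

lemma eprod_transvection:
  assumes z: "range z \<subseteq> carrier G" and ij: "i < n" "j < n" "i \<noteq> j"
  shows "eprod G (z(j := z j \<otimes> z i [^] (e::int))) (c(i := c i - e * c j)) n = eprod G z c n"
proof -
  have zi: "z i \<in> carrier G" "z j \<in> carrier G" and zk: "\<And>k. z k \<in> carrier G" using z by auto
  define c' where "c' = c(i := c i - e * c j)"
  define w where "w = (\<lambda>k. if k = j then z i [^] e else \<one>)"
  define d where "d = (\<lambda>k. if k = i then e * c j else 0)"
  have w: "range w \<subseteq> carrier G" using zi by (auto simp: w_def)
  have "z(j := z j \<otimes> z i [^] e) = (\<lambda>k. z k \<otimes> w k)"
    using zk by (auto simp: w_def fun_eq_iff)
  moreover have "eprod G w c' n = z i [^] (e * c j)"
    using eprod_single[OF w ij(2), of c'] zi ij(3) by (auto simp: w_def c'_def int_pow_pow)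
  moreover have "eprod G z d n = z i [^] (e * c j)"
    using eprod_single[OF z ij(1), of d] by (auto simp: d_def)
  ultimately have "eprod G (z(j := z j \<otimes> z i [^] e)) c' n = eprod G z c' n \<otimes> eprod G z d n"
    using eprod_mult[OF z w] by simp
  also have "\<dots> = eprod G z (\<lambda>k. c' k + d k) n"
    by (rule eprod_add[OF commuting_family[OF z], symmetric])
  also have "(\<lambda>k. c' k + d k) = c" by (auto simp: c'_def d_def)
  finally show ?thesis unfolding c'_def .
qed

text \<open>In a nontrivial relation between a minimal number of generators, Euclid's algorithm on the
  exponents, realised by transvections of the generators, leaves one generator of finite order.\<close>

lemma free_abelian_of_torsion_free:
  assumes fg: "finitely_generated G" and tf: "torsion_free_set G (carrier G)"
  shows "free_abelian G"
proof -
  define gens where "gens z n \<longleftrightarrow> range z \<subseteq> carrier G \<and> generate G (range z) = carrier G \<and> (\<forall>i\<ge>n. z i = \<one>)"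
    for z :: "nat \<Rightarrow> 'a" and n
  obtain S where S: "finite S" "S \<subseteq> carrier G" "generate G S = carrier G"
    using fg by (auto simp: finitely_generated_def)
  obtain xs where xs: "set xs = S" using finite_list[OF S(1)] by blast
  have "gens (\<lambda>i. if i < length xs then xs ! i else \<one>) (length xs)"
  proof -
    have "xs ! i \<in> carrier G" if "i < length xs" for i using that xs S(2) nth_mem by blast
    then have 1: "range (\<lambda>i. if i < length xs then xs ! i else \<one>) \<subseteq> carrier G" by auto
    have "S \<subseteq> range (\<lambda>i. if i < length xs then xs ! i else \<one>)"
    proof
      fix s assume "s \<in> S"
      then obtain i where "i < length xs" "s = xs ! i" using xs by (metis in_set_conv_nth)
      then show "s \<in> range (\<lambda>i. if i < length xs then xs ! i else \<one>)"
        by (intro rev_image_eqI[of i]) auto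
    qed
    then have "generate G (range (\<lambda>i. if i < length xs then xs ! i else \<one>)) = carrier G"
      using S(3) mono_generate generate_incl[OF 1] by blast
    then show ?thesis using 1 unfolding gens_def by simp
  qed
  then obtain N where "\<exists>z. gens z N" and N: "\<And>n. n < N \<Longrightarrow> \<not> (\<exists>z. gens z n)"
    using exists_least_iff[of "\<lambda>n. \<exists>z. gens z n"] by blast
  \<comment> \<open>The induction on the total size of the exponents ranges over all generating
    systems of the minimal length \<open>N\<close>, since a transvection changes \<open>z\<close>
    along with \<open>c\<close>.\<close>
  have no_relation: "c i = 0" if "gens z N" "eprod G z c N = \<one>" "i < N" for z c i
    using that
  proof (induction "\<Sum>i<N. nat \<bar>c i\<bar>" arbitrary: z c i rule: less_induct)
    case less
    have z: "range z \<subseteq> carrier G" "\<And>i. z i \<in> carrier G" using less.prems by (auto simp: gens_def)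
    show ?case
    proof (rule ccontr)
      assume ci: "c i \<noteq> 0"
      show False
      proof (cases "\<exists>j<N. j \<noteq> i \<and> c j \<noteq> 0")
        case True
        then obtain k j where kj: "k < N" "j < N" "k \<noteq> j" "c j \<noteq> 0" "\<bar>c j\<bar> \<le> \<bar>c k\<bar>"
          using ci less.prems(3) by (metis nle_le)
        \<comment> \<open>With this sign the absolute value of \<open>c k - e * c j\<close> is
          \<open>\<bar>c k\<bar> - \<bar>c j\<bar>\<close>, which is smaller than
          \<open>\<bar>c k\<bar>\<close> because \<open>c j \<noteq> 0\<close>.\<close>
        define e where "e = sgn (c k) * sgn (c j)"
        define z' where "z' = z(j := z j \<otimes> z k [^] e)"
        define c' where "c' = c(k := c k - e * c j)"
        have abs: "\<bar>c k - e * c j\<bar> < \<bar>c k\<bar>"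
          using kj(4,5) by (auto simp: e_def sgn_if abs_if split: if_splits)
        have z': "range z' \<subseteq> carrier G" using z by (auto simp: z'_def)
        have "range z \<subseteq> generate G (range z')"
        proof safe
          fix i
          show "z i \<in> generate G (range z')"
          proof (cases "i = j")
            case True
            have "z' k = z k" using kj by (simp add: z'_def)
            then have "z k [^] (- e) \<in> generate G (range z')"
              by (intro subgroup_int_pow_closed generate_is_subgroup z') (metis generate.incl rangeI)
            then have "z' j \<otimes> z k [^] (- e) \<in> generate G (range z')"
              using generate.eng[OF generate.incl[OF rangeI[of z' j]]] by blast
            moreover have "z' j \<otimes> z k [^] (- e) = z j"
              using z by (simp add: z'_def m_assoc int_pow_neg)
            ultimately show ?thesis using True by simp
          next
            case False
            then have "z i = z' i" by (simp add: z'_def)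
            then show ?thesis by (metis generate.incl rangeI)
          qed
        qed
        then have "generate G (range z') = carrier G"
          using less.prems(1) generate_subgroup_incl[OF _ generate_is_subgroup[OF z']] generate_incl[OF z']
          unfolding gens_def by blast
        then have "gens z' N" using z' less.prems(1) kj by (auto simp: gens_def z'_def)
        moreover have "eprod G z' c' N = \<one>"
          unfolding z'_def c'_def using eprod_transvection[OF z(1) kj(1-3)] less.prems(2) by simp
        moreover have "(\<Sum>i<N. nat \<bar>c' i\<bar>) < (\<Sum>i<N. nat \<bar>c i\<bar>)"
          using kj(1) abs by (intro sum_strict_mono_ex1) (auto simp: c'_def)
        \<comment> \<open>The transvection leaves the exponent at \<open>j\<close> alone, yet the
          induction hypothesis forces it to vanish.\<close>
        ultimately have "c' j = 0" using less.hyps kj(2) by blast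
        then show False using kj by (simp add: c'_def)
      next
        case False
        then have "z k [^] c k = \<one>" if "k < N" "k \<noteq> i" for k using that by auto
        then have "z i [^] c i = \<one>"
          using eprod_single[OF z(1) less.prems(3), of c] less.prems(2) by metis
        then have zi: "z i = \<one>" using torsion_free_int_pow[OF tf] z(2) ci by blast
        obtain M where M: "N = Suc M" using less.prems(3) by (cases N) auto
        \<comment> \<open>The trivial generator is dropped: the last one takes its place, so the
          system becomes shorter. For \<open>i = M\<close> only the second update has an
          effect.\<close>
        define z' where "z' = z(i := z M, M := \<one>)"
        have z': "range z' \<subseteq> carrier G" using z by (auto simp: z'_def)
        have "range z \<subseteq> insert \<one> (range z')"
        proof safe
          fix k assume "z k \<notin> range z'"
          moreover have "z k = z' k" if "k \<noteq> i" "k \<noteq> M" using that by (simp add: z'_def)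
          moreover have "z M = z' i" if "i \<noteq> M" using that by (simp add: z'_def)
          ultimately show "z k = \<one>" using zi by (metis rangeI)
        qed
        then have "range z \<subseteq> generate G (range z')"
          by (meson generate.one generate.incl insert_subset order_trans subsetI)
        then have "generate G (range z') = carrier G"
          using less.prems(1) generate_subgroup_incl[OF _ generate_is_subgroup[OF z']] generate_incl[OF z']
          unfolding gens_def by blast
        moreover have "z' k = \<one>" if "k \<ge> M" for k
          using that less.prems(1,3) M zi by (cases "k = M") (auto simp: z'_def gens_def)
        ultimately have "gens z' M" using z' by (simp add: gens_def)
        then show False using N[of M] M by blast
      qed
    qed
  qed
  obtain z where z: "gens z N" using \<open>\<exists>z. gens z N\<close> by blast
  then have zc: "range z \<subseteq> carrier G" by (simp add: gens_def)
  have "inj_on z {..<N}"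
  proof (rule inj_onI, rule ccontr)
    fix i j assume ij: "i \<in> {..<N}" "j \<in> {..<N}" "z i = z j" "i \<noteq> j"
    define c where "c = (\<lambda>k. if k = i then 1 else 0 :: int)"
    define d where "d = (\<lambda>k. if k = j then - 1 else 0 :: int)"
    have "eprod G z (\<lambda>k. c k + d k) N = z i [^] (1::int) \<otimes> z j [^] (- 1 :: int)"
      using eprod_single[OF zc, of i N c] eprod_single[OF zc, of j N d] ij
      by (simp add: eprod_add[OF commuting_family[OF zc]] c_def d_def)
    also have "\<dots> = \<one>" using ij(3) zc by (simp add: int_pow_neg range_subsetD)
    finally have "c i + d i = 0" using no_relation[OF z] ij(1) by blast
    then show False using ij(4) by (simp add: c_def d_def)
  qed
  moreover have "independent_on G {..<N} z"
    unfolding independent_on_def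
  proof (intro allI impI)
    fix c n i assume c: "eprod G z c n = \<one>" and i: "i < n" "i \<in> {..<N}"
    \<comment> \<open>From \<open>n\<close> on the exponents are cut off, from \<open>N\<close> on
      the generators are trivial; thus a relation of any length \<open>n\<close> becomes one of
      length \<open>N\<close>.\<close>
    let ?c = "\<lambda>i. if i < n then c i else 0"
    have "eprod G z ?c N = eprod G z ?c (max n N)"
      using zc z by (intro eprod_extend[symmetric]) (auto simp: gens_def)
    also have "\<dots> = eprod G z ?c n" using zc by (intro eprod_extend) auto
    also have "\<dots> = eprod G z c n" by (rule eprod_cong) auto
    finally have "eprod G z ?c N = \<one>" using c by simp
    then have "?c i = 0" using no_relation[OF z, of ?c i] i(2) by simp
    then show "c i = 0" using i by simp
  qed
  ultimately have "G \<cong> free_Abelian_group (z ` {..<N})"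
    using z by (intro iso_free_Abelian_group[of z] commuting_family) (auto simp: gens_def)
  then show ?thesis unfolding free_abelian_def using is_group by blast
qed

end

section \<open>Evaluation of words and polynomials\<close>

primrec weval :: "('a, 'b) monoid_scheme \<Rightarrow> ('g \<Rightarrow> 'a) \<Rightarrow> 'g word \<Rightarrow> 'a" where
  "weval G v [] = \<one>\<^bsub>G\<^esub>"
| "weval G v (x # w) = (if snd x then v (fst x) else inv\<^bsub>G\<^esub> v (fst x)) \<otimes>\<^bsub>G\<^esub> weval G v w"

context group
begin

context
  fixes v :: "'g \<Rightarrow> 'a"
  assumes v: "range v \<subseteq> carrier G"
begin

lemma gen_closed [simp]: "v x \<in> carrier G"
  using v by auto

lemma weval_closed [simp]: "weval G v w \<in> carrier G"
  by (induction w) auto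

lemma weval_append: "weval G v (u @ w) = weval G v u \<otimes> weval G v w"
  by (induction u) (auto simp: m_assoc)

lemma weval_word_inv: "weval G v (word_inv w) = inv (weval G v w)"
proof (induction w)
  case Nil
  then show ?case by (simp add: word_inv_def)
next
  case (Cons x w)
  have "word_inv (x # w) = word_inv w @ [(fst x, \<not> snd x)]"
    by (simp add: word_inv_def case_prod_unfold)
  then show ?case by (simp add: weval_append Cons inv_mult_group)
qed

lemma weval_word_conj:
  "weval G v (word_conj x y) = inv (weval G v y) \<otimes> weval G v x \<otimes> weval G v y"
  by (simp add: word_conj_def weval_append weval_word_inv m_assoc)

lemma weval_word_comm:
  "weval G v (word_comm x y) = \<one> \<longleftrightarrow> weval G v x \<otimes> weval G v y = weval G v y \<otimes> weval G v x"
proof -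
  have "weval G v (word_comm x y) = inv (weval G v y \<otimes> weval G v x) \<otimes> (weval G v x \<otimes> weval G v y)"
    by (simp add: word_comm_def weval_append weval_word_inv m_assoc inv_mult_group)
  then show ?thesis
    using inv_solve_left'[of "\<one>" "weval G v y \<otimes> weval G v x" "weval G v x \<otimes> weval G v y"] by auto
qed

lemma weval_word_pow: "weval G v (word_pow w n) = weval G v w [^] n"
proof -
  have rep: "weval G v (concat (replicate k u)) = weval G v u [^] k" for k u
    by (induction k) (auto simp: weval_append simp flip: nat_pow_Suc2)
  show ?thesis
  proof (cases "n \<ge> 0")
    case True
    then show ?thesis using rep[of "nat n" w] by (simp add: word_pow_def pow_nat)
  next
    case False
    then obtain m where "n = - int m" by (metis nle_le int_cases2 of_nat_0_le_iff)
    then show ?thesis using rep[of m "word_inv w"] False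
      by (simp add: word_pow_def weval_word_inv nat_pow_inv int_pow_neg_int)
  qed
qed

lemma weval_pres_eq:
  assumes "\<And>r. r \<in> R \<Longrightarrow> weval G v r = \<one>" "pres_eq R u w"
  shows "weval G v u = weval G v w"
  using assms(2) by induction (auto simp: weval_append assms(1) split: if_splits)

text \<open>Von Dyck's theorem. The value on a class is read off an arbitrary representative, which
  is legitimate because \<open>weval\<close> respects \<open>pres_eq\<close>.\<close>

lemma hom_presented_group:
  assumes "\<And>r. r \<in> R \<Longrightarrow> weval G v r = \<one>"
  shows "\<exists>h \<in> hom (presented_group R) G. \<forall>w. h (pres_class R w) = weval G v w"
proof -
  define h where "h X = weval G v (SOME w. X = pres_class R w)" for X
  have h: "h (pres_class R w) = weval G v w" for w
  proof -
    have "pres_class R w = pres_class R (SOME u. pres_class R w = pres_class R u)"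
      by (rule someI) simp
    then have "pres_eq R (SOME u. pres_class R w = pres_class R u) w"
      by (metis pres_class_eq_iff)
    then show ?thesis unfolding h_def using assms by (intro weval_pres_eq[of R]) auto
  qed
  have "h \<in> hom (presented_group R) G"
  proof (rule homI)
    fix x assume "x \<in> carrier (presented_group R)"
    then show "h x \<in> carrier G" by (auto simp: presented_group_def h)
  next
    fix x y assume "x \<in> carrier (presented_group R)" "y \<in> carrier (presented_group R)"
    then obtain u w where "x = pres_class R u" "y = pres_class R w" by (auto simp: presented_group_def)
    then show "h (x \<otimes>\<^bsub>presented_group R\<^esub> y) = h x \<otimes> h y"
      by (simp add: presented_group_mult h weval_append)
  qed
  then show ?thesis using h by blast
qed

end

end

text \<open>Makes facts about evaluation in an arbitrary group available in the presented group
  itself, under the tautological valuation of the generators.\<close>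

lemma pres_class_weval:
  "pres_class R w = weval (presented_group R) (\<lambda>x. pres_class R [(x, True)]) w"
proof (induction w)
  case Nil
  then show ?case by (simp add: presented_group_def)
next
  case (Cons x w)
  interpret group "presented_group R" by (rule group_presented_group)
  have c: "pres_class R u \<in> carrier (presented_group R)" for u by (simp add: presented_group_def)
  have "pres_class R [(g, False)] \<otimes>\<^bsub>presented_group R\<^esub> pres_class R [(g, True)] = \<one>\<^bsub>presented_group R\<^esub>" for g
    using pres_eq.cancel[of R g False]
    by (simp add: presented_group_mult) (simp add: presented_group_def pres_class_eq_iff)
  then have "inv\<^bsub>presented_group R\<^esub> (pres_class R [(g, True)]) = pres_class R [(g, False)]" for g
    using c by (intro inv_equality)
  then have "weval (presented_group R) (\<lambda>x. pres_class R [(x, True)]) (x # w)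
      = pres_class R [x] \<otimes>\<^bsub>presented_group R\<^esub> pres_class R w"
    by (cases x) (auto simp flip: Cons)
  then show ?case by (simp add: presented_group_mult)
qed

section \<open>Integer polynomials acting on an element by conjugation\<close>

definition conj_seq :: "('a, 'b) monoid_scheme \<Rightarrow> 'a \<Rightarrow> 'a \<Rightarrow> nat \<Rightarrow> 'a" where
  "conj_seq G a g i = inv\<^bsub>G\<^esub> (g [^]\<^bsub>G\<^esub> i) \<otimes>\<^bsub>G\<^esub> a \<otimes>\<^bsub>G\<^esub> g [^]\<^bsub>G\<^esub> i"

text \<open>For \<open>z = conj_seq G a g\<close> this is module notation: the polynomial acts on
  \<open>a\<close>, with X acting as conjugation by \<open>g\<close>. The bound
  \<open>Suc (degree p)\<close> includes the leading coefficient; a larger one gives the same value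
  (\<open>peval_eq\<close>).\<close>

definition peval :: "('a, 'b) monoid_scheme \<Rightarrow> (nat \<Rightarrow> 'a) \<Rightarrow> int poly \<Rightarrow> 'a" where
  "peval G z p = eprod G z (coeff p) (Suc (degree p))"

context group
begin

lemma peval_eq:
  assumes "range z \<subseteq> carrier G" "degree p < n"
  shows "eprod G z (coeff p) n = peval G z p"
  unfolding peval_def using assms by (intro eprod_extend) (auto simp: coeff_eq_0)

lemma peval_closed [simp]: "range z \<subseteq> carrier G \<Longrightarrow> peval G z p \<in> carrier G"
  by (simp add: peval_def)

lemma peval_0 [simp]: "peval G z 0 = \<one>"
  by (simp add: peval_def)

lemma peval_add:
  assumes "commuting_family G z"
  shows "peval G z (p + q) = peval G z p \<otimes> peval G z q"
proof -
  let ?n = "Suc (max (degree p) (degree q))"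
  have z: "range z \<subseteq> carrier G" using assms by (simp add: commuting_family_def)
  have "peval G z (p + q) = eprod G z (coeff (p + q)) ?n"
    using degree_add_le_max[of p q] by (intro peval_eq[symmetric] z) simp
  also have "\<dots> = eprod G z (coeff p) ?n \<otimes> eprod G z (coeff q) ?n"
    using eprod_add[OF assms, of "coeff p" "coeff q" ?n] by (simp add: plus_poly.rep_eq)
  also have "\<dots> = peval G z p \<otimes> peval G z q" by (simp only: peval_eq[OF z] less_Suc_eq_le max.cobounded1 max.cobounded2)
  finally show ?thesis .
qed

lemma peval_uminus:
  assumes "commuting_family G z"
  shows "peval G z (- p) = inv (peval G z p)"
proof -
  have "peval G z (- p) \<otimes> peval G z p = \<one>"
    using peval_add[OF assms, of "- p" p] by simp
  then show ?thesis using assms by (simp add: inv_equality commuting_family_def)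
qed

lemma peval_smult_nat:
  assumes "commuting_family G z"
  shows "peval G z (smult (int k) p) = peval G z p [^] k"
proof (induction k)
  case (Suc k)
  have "smult (int (Suc k)) p = smult (int k) p + p" by (simp add: smult_add_left)
  then show ?case by (simp only: peval_add[OF assms] Suc nat_pow_Suc)
qed simp

lemma peval_smult_trivial:
  assumes "commuting_family G z" "peval G z p = \<one>"
  shows "peval G z (smult k p) = \<one>"
proof (cases k rule: int_cases2)
  case (nonneg n)
  then show ?thesis using peval_smult_nat[OF assms(1)] assms(2) by simp
next
  case (nonpos n)
  then have "smult k p = - smult (int n) p" by simp
  then show ?thesis using peval_smult_nat[OF assms(1)] assms by (simp only: peval_uminus) simp
qed

lemma eprod_Suc_shift:
  assumes "range z \<subseteq> carrier G"
  shows "eprod G z c (Suc n) = z 0 [^] c 0 \<otimes> eprod G (\<lambda>i. z (Suc i)) (\<lambda>i. c (Suc i)) n"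
proof (induction n)
  have z: "z i \<in> carrier G" "range (\<lambda>i. z (Suc i)) \<subseteq> carrier G" for i using assms by auto
  {
    case 0
    then show ?case using z by simp
  next
    case (Suc n)
    then show ?case using z by (simp add: m_assoc)
  }
qed

lemma eprod_conj:
  assumes "range z \<subseteq> carrier G" "g \<in> carrier G"
  shows "eprod G (\<lambda>i. inv g \<otimes> z i \<otimes> g) c n = inv g \<otimes> eprod G z c n \<otimes> g"
proof (induction n)
  case (Suc n)
  have z: "z n \<in> carrier G" using assms by auto
  have "eprod G (\<lambda>i. inv g \<otimes> z i \<otimes> g) c (Suc n)
      = (inv g \<otimes> eprod G z c n \<otimes> g) \<otimes> (inv g \<otimes> z n [^] c n \<otimes> g)"
    by (simp only: eprod.simps Suc conj_int_pow[OF z assms(2)])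
  then show ?case using assms z by (simp add: m_assoc)
qed (use assms in simp)

lemma conj_seq_closed [simp]:
  assumes "a \<in> carrier G" "g \<in> carrier G"
  shows "conj_seq G a g i \<in> carrier G" "range (conj_seq G a g) \<subseteq> carrier G"
  using assms by (auto simp: conj_seq_def)

lemma conj_seq_0 [simp]: "a \<in> carrier G \<Longrightarrow> conj_seq G a g 0 = a"
  by (simp add: conj_seq_def)

lemma conj_seq_add:
  assumes "a \<in> carrier G" "g \<in> carrier G"
  shows "conj_seq G a g (i + j) = inv (g [^] i) \<otimes> conj_seq G a g j \<otimes> g [^] i"
proof -
  have "g [^] (i + j) = g [^] j \<otimes> g [^] i"
    using assms by (simp add: nat_pow_mult add.commute)
  then show ?thesis using assms by (simp add: conj_seq_def inv_mult_group m_assoc)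
qed

lemma conj_seq_Suc:
  assumes "a \<in> carrier G" "g \<in> carrier G"
  shows "conj_seq G a g (Suc i) = inv g \<otimes> conj_seq G a g i \<otimes> g"
  using conj_seq_add[OF assms, of 1 i] assms by simp

lemma commute_conj:
  assumes "x \<in> carrier G" "y \<in> carrier G" "g \<in> carrier G" "x \<otimes> y = y \<otimes> x"
  shows "(inv g \<otimes> x \<otimes> g) \<otimes> (inv g \<otimes> y \<otimes> g) = (inv g \<otimes> y \<otimes> g) \<otimes> (inv g \<otimes> x \<otimes> g)"
proof -
  have "(inv g \<otimes> u \<otimes> g) \<otimes> (inv g \<otimes> w \<otimes> g) = inv g \<otimes> (u \<otimes> w) \<otimes> g"
    if "u \<in> carrier G" "w \<in> carrier G" for u w
    using that assms(3) by (simp add: m_assoc)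
  then show ?thesis using assms by simp
qed

text \<open>Conjugation by \<open>g [^] i\<close> carries \<open>a\<close> and its
  \<open>k\<close>-th conjugate to the conjugates with indices \<open>i\<close> and
  \<open>i + k\<close>, so it is enough to commute with \<open>a\<close>.\<close>

lemma commuting_conj_seq:
  assumes "a \<in> carrier G" "g \<in> carrier G"
    and "\<And>i. a \<otimes> conj_seq G a g i = conj_seq G a g i \<otimes> a"
  shows "commuting_family G (conj_seq G a g)"
proof -
  have *: "conj_seq G a g i \<otimes> conj_seq G a g (i + k) = conj_seq G a g (i + k) \<otimes> conj_seq G a g i" for i k
    using commute_conj[of a "conj_seq G a g k" "g [^] i"] assms
      conj_seq_add[OF assms(1,2), of i k] conj_seq_add[OF assms(1,2), of i 0] by simp
  have "conj_seq G a g i \<otimes> conj_seq G a g j = conj_seq G a g j \<otimes> conj_seq G a g i" for i j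
    using *[of i "j - i"] *[of j "i - j"] by (cases "i \<le> j") auto
  then show ?thesis using assms by (auto simp: commuting_family_def)
qed

context
  fixes a g
  assumes a: "a \<in> carrier G" and g: "g \<in> carrier G"
    and comm: "commuting_family G (conj_seq G a g)"
begin

lemma peval_pCons:
  "peval G (conj_seq G a g) (pCons c p) = a [^] c \<otimes> (inv g \<otimes> peval G (conj_seq G a g) p \<otimes> g)"
proof -
  let ?z = "conj_seq G a g"
  have "peval G ?z (pCons c p) = eprod G ?z (coeff (pCons c p)) (Suc (Suc (degree p)))"
    using a g degree_pCons_le[of c p] by (intro peval_eq[symmetric]) auto
  also have "\<dots> = a [^] c \<otimes> eprod G (\<lambda>i. ?z (Suc i)) (coeff p) (Suc (degree p))"
    by (subst eprod_Suc_shift) (use a g in auto)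
  also have "eprod G (\<lambda>i. ?z (Suc i)) (coeff p) (Suc (degree p)) = inv g \<otimes> peval G ?z p \<otimes> g"
    unfolding conj_seq_Suc[OF a g] peval_def by (rule eprod_conj) (use a g in auto)
  finally show ?thesis .
qed

lemma peval_monom_mult:
  "peval G (conj_seq G a g) (monom 1 m * p) = inv (g [^] m) \<otimes> peval G (conj_seq G a g) p \<otimes> g [^] m"
proof (induction m)
  case (Suc m)
  have "monom 1 (Suc m) * p = pCons 0 (monom 1 m * p)" by (simp add: monom_Suc)
  then show ?case using a g by (simp add: peval_pCons Suc m_assoc inv_mult_group)
qed (use a g in simp)

text \<open>The polynomials that kill \<open>a\<close> form an ideal: integer combinations preserve
  triviality, and multiplication by X is conjugation by \<open>g\<close>.\<close>

lemma peval_mult_trivial: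
  assumes "peval G (conj_seq G a g) f = \<one>"
  shows "peval G (conj_seq G a g) (f * q) = \<one>"
proof (induction q)
  case (pCons c q)
  have "f * pCons c q = smult c f + pCons 0 (f * q)" by simp
  then show ?case
    using pCons a g peval_smult_trivial[OF comm assms] by (simp add: peval_add[OF comm] peval_pCons)
qed simp

lemma commute_conj_int_pow:
  "a \<otimes> (inv (g [^] (k::int)) \<otimes> a \<otimes> g [^] k) = (inv (g [^] k) \<otimes> a \<otimes> g [^] k) \<otimes> a"
proof -
  have *: "a \<otimes> conj_seq G a g n = conj_seq G a g n \<otimes> a" for n
    using comm a unfolding commuting_family_def by (metis conj_seq_0)
  show ?thesis
  proof (cases k rule: int_cases2)
    case (nonneg n)
    then show ?thesis using *[of n] by (simp add: conj_seq_def int_pow_int)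
  next
    case (nonpos n)
    \<comment> \<open>For a negative exponent, conjugation by \<open>inv (g [^] n)\<close> sends the
      \<open>n\<close>-th conjugate back to \<open>a\<close> and \<open>a\<close> to the conjugate
      in question.\<close>
    have "inv (inv (g [^] n)) \<otimes> conj_seq G a g n \<otimes> inv (g [^] n) = a"
      using a g by (simp add: conj_seq_def m_assoc)
    then show ?thesis
      using commute_conj[of a "conj_seq G a g n" "inv (g [^] n)"] a g *[of n] nonpos
      by (simp add: int_pow_neg_int)
  qed
qed

lemma peval_conj_nat_pow:
  "peval G (conj_seq G a g) p \<otimes> g [^] m = g [^] m \<otimes> peval G (conj_seq G a g) (monom 1 m * p)"
  using a g by (simp add: peval_monom_mult m_assoc)

text \<open>Polynomials only reach conjugates under nonnegative powers of \<open>g\<close>; the two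
  outer powers, not necessarily inverse to each other, take care of the rest. In a product, the
  power of \<open>g\<close> between two polynomials moves left past the first if it is nonnegative
  and right past the second otherwise, at the cost of a factor \<open>monom 1 n\<close>.\<close>

lemma generate_pair:
  assumes "x \<in> generate G {a, g}"
  shows "\<exists>(j::int) p (l::int). x = g [^] j \<otimes> peval G (conj_seq G a g) p \<otimes> g [^] l"
proof -
  let ?E = "peval G (conj_seq G a g)"
  have E: "?E p \<in> carrier G" for p using a g by simp
  define X where "X = {g [^] (j::int) \<otimes> ?E p \<otimes> g [^] (l::int) | j p l. True}"
  have "subgroup X G"
  proof (rule subgroupI)
    show "X \<subseteq> carrier G" "X \<noteq> {}" using E g by (auto simp: X_def)
  next
    fix x assume "x \<in> X"
    then obtain j l :: int and p where x: "x = g [^] j \<otimes> ?E p \<otimes> g [^] l" by (auto simp: X_def)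
    have "inv x = g [^] (- l) \<otimes> ?E (- p) \<otimes> g [^] (- j)"
      using E g by (simp add: x inv_mult_group m_assoc peval_uminus[OF comm] int_pow_neg)
    then show "inv x \<in> X" unfolding X_def by blast
  next
    fix x y assume "x \<in> X" "y \<in> X"
    then obtain j l j' l' :: int and p q
      where x: "x = g [^] j \<otimes> ?E p \<otimes> g [^] l" and y: "y = g [^] j' \<otimes> ?E q \<otimes> g [^] l'"
      by (auto simp: X_def)
    have "x \<otimes> y = g [^] j \<otimes> ?E p \<otimes> (g [^] l \<otimes> g [^] j') \<otimes> ?E q \<otimes> g [^] l'"
      using E g by (simp add: x y m_assoc)
    then have xy: "x \<otimes> y = g [^] j \<otimes> ?E p \<otimes> g [^] (l + j') \<otimes> ?E q \<otimes> g [^] l'"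
      using g by (simp add: int_pow_mult)
    show "x \<otimes> y \<in> X"
    proof (cases "l + j'" rule: int_cases2)
      case (nonneg n)
      have "x \<otimes> y = g [^] j \<otimes> (?E p \<otimes> g [^] n) \<otimes> ?E q \<otimes> g [^] l'"
        using E g by (simp add: xy nonneg int_pow_int m_assoc)
      also have "\<dots> = (g [^] j \<otimes> g [^] int n) \<otimes> (?E (monom 1 n * p) \<otimes> ?E q) \<otimes> g [^] l'"
        using E g by (simp add: peval_conj_nat_pow int_pow_int m_assoc)
      also have "\<dots> = g [^] (j + int n) \<otimes> ?E (monom 1 n * p + q) \<otimes> g [^] l'"
        using g by (simp only: int_pow_mult peval_add[OF comm])
      finally show ?thesis unfolding X_def by blast
    next
      case (nonpos n)
      have "inv (g [^] n) \<otimes> ?E q = ?E (monom 1 n * q) \<otimes> inv (g [^] n)"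
        using E g by (simp add: peval_monom_mult m_assoc)
      then have "inv (g [^] n) \<otimes> ?E q \<otimes> g [^] l' = ?E (monom 1 n * q) \<otimes> (inv (g [^] n) \<otimes> g [^] l')"
        using E g by (simp add: m_assoc)
      then have "x \<otimes> y = g [^] j \<otimes> (?E p \<otimes> ?E (monom 1 n * q)) \<otimes> (g [^] (- int n) \<otimes> g [^] l')"
        using E g by (simp add: xy nonpos int_pow_neg_int m_assoc)
      also have "\<dots> = g [^] j \<otimes> ?E (p + monom 1 n * q) \<otimes> g [^] (- int n + l')"
        using g by (simp only: int_pow_mult peval_add[OF comm])
      finally show ?thesis unfolding X_def by blast
    qed
  qed
  moreover have "a \<in> X"
  proof -
    have "?E [:1:] = a" using a g by (simp add: peval_pCons)
    then have "a = g [^] (0::int) \<otimes> ?E [:1:] \<otimes> g [^] (0::int)" using a by simp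
    then show ?thesis unfolding X_def by blast
  qed
  moreover have "g \<in> X"
  proof -
    have "g = g [^] (1::int) \<otimes> ?E 0 \<otimes> g [^] (0::int)" using g by simp
    then show ?thesis unfolding X_def by blast
  qed
  ultimately have "generate G {a, g} \<subseteq> X" by (intro generate_subgroup_incl) auto
  then show ?thesis using assms by (auto simp: X_def)
qed

end

end

section \<open>Gc-groups\<close>

context group
begin

lemma weval_Gc_conj:
  assumes "range v \<subseteq> carrier G"
  shows "weval G v (Gc_conj k) = inv (v Alpha [^] k) \<otimes> v Beta \<otimes> v Alpha [^] k"
proof -
  have "v x \<in> carrier G" for x using assms by auto
  then show ?thesis by (simp add: Gc_conj_def weval_word_conj[OF assms] weval_word_pow[OF assms])
qed

lemma weval_Gc_relation:
  assumes "range v \<subseteq> carrier G"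
  shows "weval G v (concat (map (\<lambda>i. word_pow (Gc_conj (int i)) (c i)) [0..<n]))
    = eprod G (conj_seq G (v Beta) (v Alpha)) c n"
  by (induction n) (auto simp: weval_append[OF assms] weval_word_pow[OF assms]
      weval_Gc_conj[OF assms] conj_seq_def int_pow_int)

lemma weval_Gc_relators:
  assumes "range v \<subseteq> carrier G"
  shows "(\<forall>r\<in>Gc_relators s c. weval G v r = \<one>) \<longleftrightarrow>
    (\<forall>k::int. v Beta \<otimes> (inv (v Alpha [^] k) \<otimes> v Beta \<otimes> v Alpha [^] k)
       = (inv (v Alpha [^] k) \<otimes> v Beta \<otimes> v Alpha [^] k) \<otimes> v Beta) \<and>
    eprod G (conj_seq G (v Beta) (v Alpha)) c (Suc s) = \<one>"
proof -
  have "v Beta \<in> carrier G" using assms by auto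
  then show ?thesis
    unfolding Gc_relators_def
    by (simp add: ball_Un weval_word_comm[OF assms] weval_Gc_conj[OF assms] weval_Gc_relation[OF assms]
        conj_commute del: upt_Suc)
qed

text \<open>An element of \<open>Gc\<close> has the form \<open>\<alpha>\<^sup>j p(\<beta>) \<alpha>\<^sup>l\<close> with \<open>p\<close> an integer polynomial. If it is
  killed in \<open>G\<close>, then \<open>j + l = 0\<close> and \<open>f\<close> divides \<open>p\<close>, so it is already trivial in \<open>Gc\<close>.\<close>

lemma iso_Gc:
  assumes a: "a \<in> carrier G" and g: "g \<in> carrier G"
    and comm: "commuting_family G (conj_seq G a g)"
    and rel: "peval G (conj_seq G a g) f = \<one>"
    and min: "\<And>p. peval G (conj_seq G a g) p = \<one> \<Longrightarrow> f dvd p"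
    and free: "\<And>k::int. g [^] k \<otimes> a = a \<otimes> g [^] k \<Longrightarrow> k = 0"
  shows "G\<lparr>carrier := generate G {a, g}\<rparr> \<cong> Gc (degree f) (coeff f)"
proof -
  let ?R = "Gc_relators (degree f) (coeff f)"
  let ?P = "Gc (degree f) (coeff f)"
  have P_def: "?P = presented_group ?R" by (simp add: Gc_def)
  interpret P: group ?P unfolding P_def by (rule group_presented_group)
  define v where "v = case_Gc_gen g a"
  have v: "v Alpha = g" "v Beta = a" "range v \<subseteq> carrier G"
    using a g by (auto simp: v_def split: Gc_gen.splits)
  have "\<forall>r\<in>?R. weval G v r = \<one>"
    using commute_conj_int_pow[OF a g comm] rel by (simp add: weval_Gc_relators v peval_def)
  then obtain h where h: "h \<in> hom ?P G" "\<And>w. h (pres_class ?R w) = weval G v w"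
    using hom_presented_group[OF v(3), of ?R] by (auto simp: P_def)
  interpret h: group_hom ?P G h by unfold_locales (rule h)
  define u where "u x = pres_class ?R [(x, True)]" for x
  have u: "range u \<subseteq> carrier ?P" by (auto simp: u_def P_def presented_group_def)
  have uc: "u x \<in> carrier ?P" for x using u by auto
  have cls: "pres_class ?R w = weval ?P u w" for w
    unfolding P_def u_def by (rule pres_class_weval)
  have hu: "h (u Alpha) = g" "h (u Beta) = a"
    using a g by (simp_all add: u_def h v)
  have "weval ?P u r = \<one>\<^bsub>?P\<^esub>" if "r \<in> ?R" for r
    unfolding cls[symmetric] using pres_eq.relator[OF that]
    by (simp add: P_def presented_group_def pres_class_eq_iff)
  then have rels: "\<forall>k::int. u Beta \<otimes>\<^bsub>?P\<^esub> (inv\<^bsub>?P\<^esub> (u Alpha [^]\<^bsub>?P\<^esub> k) \<otimes>\<^bsub>?P\<^esub> u Beta \<otimes>\<^bsub>?P\<^esub> u Alpha [^]\<^bsub>?P\<^esub> k)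
      = (inv\<^bsub>?P\<^esub> (u Alpha [^]\<^bsub>?P\<^esub> k) \<otimes>\<^bsub>?P\<^esub> u Beta \<otimes>\<^bsub>?P\<^esub> u Alpha [^]\<^bsub>?P\<^esub> k) \<otimes>\<^bsub>?P\<^esub> u Beta"
    and relP: "eprod ?P (conj_seq ?P (u Beta) (u Alpha)) (coeff f) (Suc (degree f)) = \<one>\<^bsub>?P\<^esub>"
    using P.weval_Gc_relators[OF u, of "degree f" "coeff f"] by blast+
  let ?z = "conj_seq ?P (u Beta) (u Alpha)"
  have commP: "commuting_family ?P ?z"
  proof (rule P.commuting_conj_seq[OF uc uc])
    show "u Beta \<otimes>\<^bsub>?P\<^esub> ?z i = ?z i \<otimes>\<^bsub>?P\<^esub> u Beta" for i
      using rels[rule_format, of "int i"] by (simp add: conj_seq_def int_pow_int)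
  qed
  have fP: "peval ?P ?z f = \<one>\<^bsub>?P\<^esub>" using relP by (simp add: peval_def)
  have "weval ?P u w \<in> generate ?P {u Beta, u Alpha}" for w
  proof (induction w)
    case Nil
    then show ?case by (simp add: generate.one)
  next
    case (Cons x w)
    have "u (fst x) \<in> {u Beta, u Alpha}" by (cases "fst x") auto
    from generate.incl[OF this, of ?P] generate.inv[OF this, of ?P] Cons
    show ?case by (simp add: generate.eng)
  qed
  then have clsgen: "pres_class ?R w \<in> generate ?P {u Beta, u Alpha}" for w by (simp only: cls)
  have "carrier ?P = range (pres_class ?R)" by (simp add: P_def presented_group_def)
  then have "carrier ?P \<subseteq> generate ?P {u Beta, u Alpha}"
    using clsgen by (simp only: image_subset_iff) simp
  moreover have "generate ?P {u Beta, u Alpha} \<subseteq> carrier ?P"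
    by (rule P.generate_incl) (simp add: uc)
  ultimately have gen: "generate ?P {u Beta, u Alpha} = carrier ?P" by (rule subset_antisym[rotated])
  have hz: "h (?z i) = conj_seq G a g i" for i
    using uc hu by (simp add: conj_seq_def h.hom_nat_pow)
  have hpeval: "h (peval ?P ?z p) = peval G (conj_seq G a g) p" for p
    unfolding peval_def using uc by (subst h.hom_eprod) (auto simp: hz)
  have ker: "x = \<one>\<^bsub>?P\<^esub>" if x: "x \<in> carrier ?P" and hx: "h x = \<one>" for x
  proof -
    obtain j l :: int and p where x_eq: "x = u Alpha [^]\<^bsub>?P\<^esub> j \<otimes>\<^bsub>?P\<^esub> peval ?P ?z p \<otimes>\<^bsub>?P\<^esub> u Alpha [^]\<^bsub>?P\<^esub> l"
      using P.generate_pair[OF uc uc commP, of x] gen x by blast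
    let ?e = "peval G (conj_seq G a g) p"
    have e: "?e \<in> carrier G" using a g by simp
    have ej: "g [^] j \<otimes> ?e \<otimes> g [^] l = \<one>"
      using hx uc by (simp add: x_eq hpeval h.hom_int_pow hu)
    have "?e = inv (g [^] j) \<otimes> (g [^] j \<otimes> ?e \<otimes> g [^] l) \<otimes> inv (g [^] l)"
      using e g by (simp add: m_assoc)
    also have "\<dots> = g [^] (- j + - l)"
      unfolding ej using g by (simp only: int_pow_mult int_pow_neg r_one inv_closed int_pow_closed)
    finally have e_eq: "?e = g [^] (- j + - l)" .
    \<comment> \<open>\<open>?e\<close> is a power of \<open>g\<close> that also lies in the abelian
      group generated by the conjugates of \<open>a\<close>. So it commutes with \<open>a\<close>,
      and \<open>free\<close> makes its exponent zero.\<close>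
    have "?e \<otimes> a = a \<otimes> ?e"
      unfolding peval_def using a g conj_seq_0[OF a, of g]
      by (intro commuting_family_generate[OF comm] eprod_in_generate generate.incl) (auto intro: range_eqI[of _ _ 0])
    then have "- j + - l = 0" unfolding e_eq by (rule free)
    then have l: "l = - j" and "?e = \<one>" using e_eq by auto
    then have "f dvd p" by (intro min)
    then have "peval ?P ?z p = \<one>\<^bsub>?P\<^esub>"
      using P.peval_mult_trivial[OF uc uc commP fP] by (auto elim: dvdE)
    then show ?thesis using uc by (simp add: x_eq l P.int_pow_neg)
  qed
  have img: "h ` carrier ?P = generate G {a, g}"
    using h.generate_img[of "{u Beta, u Alpha}"] uc gen hu by simp
  let ?K = "G\<lparr>carrier := generate G {a, g}\<rparr>"
  have K: "subgroup (generate G {a, g}) G" using a g by (intro generate_is_subgroup) auto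
  interpret K: group ?K by (rule subgroup_imp_group[OF K])
  have "h \<in> hom ?P ?K" using h(1) img by (auto simp: hom_def)
  moreover have "inj_on h (carrier ?P)" using ker by (simp add: h.inj_on_one_iff)
  ultimately have "h \<in> iso ?P ?K" using img by (simp add: iso_def bij_betw_def)
  then show ?thesis using P.iso_set_sym unfolding is_iso_def by blast
qed

end

text \<open>Free of polynomials, so that it can be re-established for suitable powers of lifts of
  \<open>a\<close> and \<open>g\<close>. One exponent \<open>n\<close> for both elements loses
  nothing: if \<open>a [^] m\<close> and \<open>g [^] n\<close> commute, so do the powers with
  exponent \<open>m * n\<close>.\<close>

definition Gc_pair :: "('a, 'b) monoid_scheme \<Rightarrow> 'a \<Rightarrow> 'a \<Rightarrow> bool" where
  "Gc_pair G a g \<longleftrightarrow> a \<in> carrier G \<and> g \<in> carrier G \<and> commuting_family G (conj_seq G a g) \<and>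
     torsion_free_set G (generate G (range (conj_seq G a g))) \<and>
     (\<forall>n::nat. n > 0 \<longrightarrow> a [^]\<^bsub>G\<^esub> n \<otimes>\<^bsub>G\<^esub> g [^]\<^bsub>G\<^esub> n \<noteq> g [^]\<^bsub>G\<^esub> n \<otimes>\<^bsub>G\<^esub> a [^]\<^bsub>G\<^esub> n)"

text \<open>The obstruction by which a Gc-group coming from a pair is seen to be proper: some powers
  of \<open>x\<close> and \<open>y\<close> lie in the abelian subgroup of finite index.\<close>

lemma virtually_abelian_commuting_powers:
  assumes "group G" "virtually_abelian G" "x \<in> carrier G" "y \<in> carrier G"
  shows "\<exists>n::nat. n > 0 \<and> x [^]\<^bsub>G\<^esub> n \<otimes>\<^bsub>G\<^esub> y [^]\<^bsub>G\<^esub> n = y [^]\<^bsub>G\<^esub> n \<otimes>\<^bsub>G\<^esub> x [^]\<^bsub>G\<^esub> n"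
proof -
  interpret group G by fact
  obtain A where A: "subgroup A G" "comm_group (G\<lparr>carrier := A\<rparr>)" "finite (rcosets\<^bsub>G\<^esub> A)"
    using assms(2) by (auto simp: virtually_abelian_def)
  obtain m :: nat where m: "m > 0" "x [^]\<^bsub>G\<^esub> m \<in> A" by (rule finite_index_pow[OF A(1,3) assms(3)])
  obtain n :: nat where n: "n > 0" "y [^]\<^bsub>G\<^esub> n \<in> A" by (rule finite_index_pow[OF A(1,3) assms(4)])
  have pA: "u [^]\<^bsub>G\<^esub> k \<in> A" if "u \<in> A" for u and k :: nat
    using subgroup_int_pow_closed[OF A(1) that, of "int k"] by (simp add: int_pow_int)
  have "x [^]\<^bsub>G\<^esub> (m * n) \<in> A" "y [^]\<^bsub>G\<^esub> (m * n) \<in> A"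
    using pA[OF m(2), of n] pA[OF n(2), of m] assms by (simp_all add: nat_pow_pow mult.commute)
  then have "x [^]\<^bsub>G\<^esub> (m * n) \<otimes>\<^bsub>G\<^esub> y [^]\<^bsub>G\<^esub> (m * n) = y [^]\<^bsub>G\<^esub> (m * n) \<otimes>\<^bsub>G\<^esub> x [^]\<^bsub>G\<^esub> (m * n)"
    using comm_monoid.m_comm[OF comm_group.axioms(1)[OF A(2)]] by simp
  then show ?thesis using m n by (intro exI[of _ "m * n"]) auto
qed

context group
begin

lemma peval_smult:
  assumes "commuting_family G z"
  shows "peval G z (smult k p) = peval G z p [^] k"
proof (cases k rule: int_cases2)
  case (nonneg n)
  then show ?thesis using peval_smult_nat[OF assms] by (simp add: int_pow_int)
next
  case (nonpos n)
  then have "smult k p = - smult (int n) p" by simp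
  moreover have "peval G z p \<in> carrier G" using assms by (simp add: commuting_family_def)
  ultimately show ?thesis
    using nonpos by (simp only: peval_uminus[OF assms] peval_smult_nat[OF assms] int_pow_neg_int)
qed

lemma eprod_peval:
  assumes "commuting_family G z"
  shows "eprod G (\<lambda>i. peval G z (q i)) c n = peval G z (\<Sum>i<n. smult (c i) (q i))"
  by (induction n) (auto simp: peval_add[OF assms] peval_smult[OF assms])

text \<open>Everything is read off the ideal of polynomials that kill \<open>a\<close>. Without an
  independent family in the derived subgroup this ideal is nonzero; torsion-freeness makes it the
  principal ideal of a primitive polynomial \<open>f\<close>; and the last clause of
  \<open>Gc_pair\<close> gives the hypothesis \<open>free\<close> of \<open>iso_Gc\<close> as well
  as properness.\<close>

lemma proper_Gc_group_of_pair:
  assumes pair: "Gc_pair G a g"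
    and no_family: "\<And>z. commuting_family G z \<Longrightarrow> range z \<subseteq> derived G (carrier G) \<Longrightarrow> \<not> independent_on G UNIV z"
  shows "proper_Gc_group (G\<lparr>carrier := generate G {a, g}\<rparr>)"
proof -
  let ?z = "conj_seq G a g"
  have a: "a \<in> carrier G" and g: "g \<in> carrier G" and comm: "commuting_family G ?z"
    and tf: "torsion_free_set G (generate G (range ?z))"
    and nopow: "\<And>n::nat. n > 0 \<Longrightarrow> a [^] n \<otimes> g [^] n \<noteq> g [^] n \<otimes> a [^] n"
    using pair by (auto simp: Gc_pair_def)
  have z: "range ?z \<subseteq> carrier G" using a g by simp
  have peval_gen: "peval G ?z p \<in> generate G (range ?z)" for p
    unfolding peval_def by (rule eprod_in_generate[OF z])
  have a1: "a \<noteq> \<one>" using nopow[of 1] g by auto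
  have agen: "a \<in> generate G (range ?z)" using conj_seq_0[OF a, of g] by (metis generate.incl rangeI)
  have "\<exists>p. p \<noteq> 0 \<and> peval G ?z p = \<one>"
  proof -
    \<comment> \<open>\<open>q i\<close> is X^i (X - 1), so \<open>b i\<close> is the conjugate of
      the commutator of \<open>a\<close> and \<open>g\<close> under \<open>g [^] i\<close>. The
      factor X - 1 is what brings the family into the derived subgroup.\<close>
    define q :: "nat \<Rightarrow> int poly" where "q i = monom 1 i * [:-1, 1:]" for i
    define b where "b i = peval G ?z (q i)" for i
    define b0 where "b0 = inv a \<otimes> inv g \<otimes> a \<otimes> g"
    have b: "b i = inv (g [^] i) \<otimes> b0 \<otimes> g [^] i" for i
      unfolding b_def q_def peval_monom_mult[OF a g comm] b0_def
      using a g by (simp add: peval_pCons[OF a g comm] int_pow_neg m_assoc)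
    have "b0 = inv a \<otimes> inv g \<otimes> inv (inv a) \<otimes> inv (inv g)" using a g by (simp add: b0_def)
    then have "b0 \<in> derived G (carrier G)"
      unfolding derived_def using a g
      by (intro generate.incl UN_I[of "inv a" "carrier G"] UN_I[of "inv g" "carrier G"]) auto
    then have "range b \<subseteq> derived G (carrier G)"
      using normal.inv_op_closed1[OF derived_self_is_normal] g by (auto simp: b)
    moreover have "commuting_family G b"
      using commuting_family_generate[OF comm peval_gen peval_gen] z
      by (auto simp: commuting_family_def b_def)
    ultimately have "\<not> independent_on G UNIV b" by (rule no_family[rotated])
    then obtain c n i where c: "eprod G b c n = \<one>" "i < n" "c i \<noteq> 0"
      by (auto simp: independent_on_def)
    define p where "p = (\<Sum>i<n. monom (c i) i)"
    have "coeff p i = c i" using c(2) by (simp add: p_def coeff_sum)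
    then have "p \<noteq> 0" using c(3) by auto
    moreover have "(\<Sum>i<n. smult (c i) (q i)) = p * [:-1, 1:]"
      by (simp only: p_def sum_distrib_right q_def mult_smult_left[symmetric] smult_monom mult_1_right)
    then have "peval G ?z (p * [:-1, 1:]) = \<one>"
      using c(1) eprod_peval[OF comm, of q c n] unfolding b_def by simp
    moreover have "p * [:-1, 1:] \<noteq> 0" using \<open>p \<noteq> 0\<close> by (simp del: mult_pCons_right)
    ultimately show ?thesis by blast
  qed
  then obtain f0 where f0: "f0 \<noteq> 0" "peval G ?z f0 = \<one>"
    and least: "\<And>p. p \<noteq> 0 \<Longrightarrow> peval G ?z p = \<one> \<Longrightarrow> degree f0 \<le> degree p"
    using exists_least_iff[of "\<lambda>n. \<exists>p. p \<noteq> 0 \<and> peval G ?z p = \<one> \<and> degree p = n"] by (metis not_le)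
  \<comment> \<open>Removing the content is harmless: the \<open>content f0\<close>-th power of the
    value of \<open>f\<close> is trivial, and the conjugates of \<open>a\<close> generate a
    torsion-free group.\<close>
  define f where "f = primitive_part f0"
  have f: "f \<noteq> 0" "content f = 1" "degree f = degree f0" using f0(1) by (simp_all add: f_def)
  have rel: "peval G ?z f = \<one>"
  proof (rule torsion_free_int_pow[OF tf peval_gen])
    show "peval G ?z f [^] content f0 = \<one>"
      using f0(2) by (simp add: f_def flip: peval_smult[OF comm])
  qed (use z f0 in auto)
  \<comment> \<open>Over the integers only pseudo-division is available. The remainder vanishes by
    minimality of the degree. By Gauss's lemma the multiplier \<open>k\<close> divides the content
    of \<open>q\<close>, since \<open>f\<close> has content 1, and so it cancels.\<close>
  have dvd: "f dvd p" if p: "peval G ?z p = \<one>" for p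
  proof -
    obtain k q where kq: "k \<noteq> 0" "smult k p = f * q + pseudo_mod p f"
      using pseudo_mod(1)[OF f(1), of p] by blast
    have "peval G ?z (smult k p) = \<one>" using peval_smult_trivial[OF comm p] .
    moreover have "peval G ?z (f * q) = \<one>" by (rule peval_mult_trivial[OF a g comm rel])
    ultimately have "peval G ?z (pseudo_mod p f) = \<one>"
      using z unfolding kq(2) peval_add[OF comm] by simp
    then have "pseudo_mod p f = 0"
      using pseudo_mod(2)[OF f(1), of p] least[of "pseudo_mod p f"] f(3) by (metis not_le)
    then have eq: "smult k p = f * q" using kq by simp
    have "k dvd content (smult k p)" by simp
    then have "k dvd content q" unfolding eq by (simp add: content_mult f(2))
    then have "[:k:] dvd q" by (simp add: const_poly_dvd_iff_dvd_content)
    then obtain r where "q = [:k:] * r" by (elim dvdE)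
    then have "smult k p = smult k (f * r)" using eq by simp
    then have "p = f * r" using kq(1) by (metis smult_cancel)
    then show ?thesis by simp
  qed
  \<comment> \<open>A constant \<open>f\<close> would give \<open>a\<close> finite order.\<close>
  have s: "degree f \<ge> 1"
  proof (rule ccontr)
    assume "\<not> degree f \<ge> 1"
    then obtain c where c: "f = [:c:]" using degree_eq_zeroE by (metis less_one not_le)
    then have "a [^] c = \<one>" using rel a g by (simp add: peval_pCons[OF a g comm])
    then show False using torsion_free_int_pow[OF tf agen a, of c] a1 f(1) c by auto
  qed
  \<comment> \<open>If X divided \<open>f\<close>, the quotient would also kill \<open>a\<close>,
    conjugation by \<open>g\<close> being injective, and its degree would be too small.\<close>
  have c0: "coeff f 0 \<noteq> 0"
  proof
    assume "coeff f 0 = 0"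
    then obtain q where q: "f = pCons 0 q" by (metis coeff_pCons_0 pCons_cases)
    then have "inv g \<otimes> peval G ?z q \<otimes> g = \<one>" using rel a g by (simp add: peval_pCons[OF a g comm])
    then have "g \<otimes> (inv g \<otimes> peval G ?z q \<otimes> g) \<otimes> inv g = \<one>" using g by simp
    then have "peval G ?z q = \<one>" using g z by (simp add: m_assoc)
    moreover have "q \<noteq> 0" using q f(1) by auto
    ultimately have "degree f \<le> degree q" using least f(3) by simp
    then show False using q \<open>q \<noteq> 0\<close> by simp
  qed
  have free: "k = 0" if k: "g [^] k \<otimes> a = a \<otimes> g [^] k" for k :: int
  proof (rule ccontr)
    assume "k \<noteq> 0"
    obtain n where n: "k = int n \<or> k = - int n" by (metis int_cases2)
    have "(g [^] k) [^] (sgn k) \<otimes> a = a \<otimes> (g [^] k) [^] (sgn k)"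
      by (rule commute_int_pow[OF k]) (use a g in auto)
    moreover have "(g [^] k) [^] (sgn k) = g [^] n"
      using n \<open>k \<noteq> 0\<close> g by (auto simp: int_pow_pow int_pow_int sgn_if)
    ultimately have "a \<otimes> g [^] n = g [^] n \<otimes> a" by simp
    then have "a [^] n \<otimes> g [^] n = g [^] n \<otimes> a [^] n"
      by (rule group_commutes_pow) (use a g in auto)
    then show False using nopow[of n] n \<open>k \<noteq> 0\<close> by auto
  qed
  let ?K = "G\<lparr>carrier := generate G {a, g}\<rparr>"
  have K: "group ?K" using a g by (intro subgroup_imp_group generate_is_subgroup) auto
  have "coeff f ` {0..degree f} = set (coeffs f)"
    using f(1) by (simp add: coeffs_def atLeast0AtMost lessThan_Suc_atMost atLeast0LessThan del: upt_Suc)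
  then have "Gcd (coeff f ` {0..degree f}) = 1"
    using f(2) by (simp add: content_def)
  then have "Gc_group ?K"
    unfolding Gc_group_def using K s c0 f(1) iso_Gc[OF a g comm rel dvd free]
    by (intro conjI exI[of _ "degree f"] exI[of _ "coeff f"]) auto
  moreover have "\<not> virtually_abelian ?K"
  proof
    assume "virtually_abelian ?K"
    from virtually_abelian_commuting_powers[OF K this, of a g] nopow show False
      by (auto simp: generate.incl simp flip: nat_pow_consistent)
  qed
  ultimately show ?thesis by (simp add: proper_Gc_group_def)
qed

end

section \<open>Lifting along homomorphisms with torsion kernel\<close>

context group
begin

text \<open>Two of the conjugates coincide; conjugating back by the smaller power of
  \<open>g\<close> leaves a positive power that fixes \<open>x\<close>.\<close>

lemma finite_conj_seq_commute:
  assumes x: "x \<in> carrier G" and g: "g \<in> carrier G" and fin: "finite (range (conj_seq G x g))"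
  shows "\<exists>n::nat. n > 0 \<and> x \<otimes> g [^] n = g [^] n \<otimes> x"
proof -
  obtain m n where n: "n > 0" "conj_seq G x g (m + n) = conj_seq G x g m"
    using ex_pow_collision[OF fin] by blast
  have c: "conj_seq G x g n \<in> carrier G" using x g by simp
  have *: "inv (g [^] m) \<otimes> conj_seq G x g n \<otimes> g [^] m = inv (g [^] m) \<otimes> x \<otimes> g [^] m"
    using n(2) conj_seq_add[OF x g, of m n] by (simp add: conj_seq_def)
  have "conj_seq G x g n = g [^] m \<otimes> (inv (g [^] m) \<otimes> conj_seq G x g n \<otimes> g [^] m) \<otimes> inv (g [^] m)"
    using c g by (simp add: m_assoc)
  also have "\<dots> = x" unfolding * using x g by (simp add: m_assoc)
  finally have "conj_seq G x g n = x" .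
  then show ?thesis
    using n(1) conj_iff_commute[of x "g [^] n"] x g by (auto simp: conj_seq_def)
qed

lemma commute_pow_pow:
  assumes "x \<otimes> y = y \<otimes> x" "x \<in> carrier G" "y \<in> carrier G"
  shows "x [^] (m::nat) \<otimes> y [^] (n::nat) = y [^] n \<otimes> x [^] m"
proof -
  have "y [^] n \<otimes> x = x \<otimes> y [^] n"
    using assms by (intro group_commutes_pow) auto
  then have "x [^] m \<otimes> y [^] n = y [^] n \<otimes> x [^] m"
    using assms by (intro group_commutes_pow) auto
  then show ?thesis .
qed

lemma conj_seq_pow_pow:
  assumes "a \<in> carrier G" "g \<in> carrier G"
  shows "conj_seq G (a [^] (m::nat)) (g [^] (n::nat)) i = conj_seq G a g (n * i) [^] m"
  using assms by (simp add: conj_seq_def conj_nat_pow nat_pow_pow)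

lemma torsion_set_finite_subgroup:
  assumes "subgroup U G" "finite U"
  shows "\<exists>k::nat. k > 0 \<and> (\<forall>u\<in>U. u [^] k = \<one>)"
proof (rule common_multiple[OF assms(2)])
  fix u assume u: "u \<in> U"
  then have uc: "u \<in> carrier G" using subgroup.subset[OF assms(1)] by auto
  have "u [^] (i::nat) \<in> U" for i
    using subgroup_int_pow_closed[OF assms(1) u, of "int i"] by (simp add: int_pow_int)
  then have "finite (range (\<lambda>i::nat. u [^] i))"
    using assms(2) by (meson finite_subset image_subsetI)
  then obtain m k :: nat where "k > 0" "u [^] (m + k) = u [^] m"
    using ex_pow_collision[of "\<lambda>i::nat. u [^] i"] by blast
  then have "u [^] k = \<one>"
    using uc nat_pow_mult[of u m k] by (metis l_cancel_one nat_pow_closed)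
  then show "\<exists>k::nat. k > 0 \<and> u [^] k = \<one>" using \<open>k > 0\<close> by blast
next
  fix u and n k :: nat assume "u \<in> U" "u [^] n = \<one>"
  then have "u \<in> carrier G" using subgroup.subset[OF assms(1)] by auto
  then show "u [^] (n * k) = \<one>" using \<open>u [^] n = \<one>\<close> by (simp flip: nat_pow_pow)
qed

lemma independent_family_torsion_free:
  assumes "commuting_family G w" "independent_on G UNIV w"
  shows "torsion_free_set G (generate G (range w))"
  unfolding torsion_free_set_def
proof (intro ballI allI impI)
  fix x n assume x: "x \<in> generate G (range w)" and n: "(n::nat) > 0" "x [^] n = \<one>"
  obtain c m where c: "x = eprod G w c m" using generate_range_eprod[OF assms(1) x] by blast
  have "eprod G w (\<lambda>i. int n * c i) m = \<one>" using n(2) eprod_nat_pow[OF assms(1)] c by simp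
  then have "\<forall>i<m. int n * c i = 0" using assms(2) unfolding independent_on_def by blast
  then have "\<forall>i<m. c i = 0" using n(1) by simp
  then show "x = \<one>" unfolding c by (intro eprod_trivial) auto
qed

end

lemma (in group_hom) hom_conj_seq:
  "a \<in> carrier G \<Longrightarrow> g \<in> carrier G \<Longrightarrow> h (conj_seq G a g i) = conj_seq H (h a) (h g) i"
  by (simp add: conj_seq_def hom_nat_pow)

text \<open>Powers of lifts of the members of the family commute with the earlier lifts, because
  commutators of lifts take only finitely many values.\<close>

lemma (in group_hom) lift_independent_family:
  assumes surj: "h ` carrier G = carrier H"
    and fin: "\<And>S. finite S \<Longrightarrow> S \<subseteq> carrier G \<Longrightarrow> comm_group (H\<lparr>carrier := generate H (h ` S)\<rparr>) \<Longrightarrow>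
      torsion_free_set H (generate H (h ` S)) \<Longrightarrow> finite (generate G S \<inter> kernel G H h)"
    and w: "commuting_family H w" "range w \<subseteq> derived H (carrier H)" "independent_on H UNIV w"
  shows "\<exists>z. commuting_family G z \<and> range z \<subseteq> derived G (carrier G) \<and> independent_on G UNIV z"
proof -
  have "\<exists>k. k \<in> derived G (carrier G) \<and> h k = w i" for i
  proof -
    \<comment> \<open>A surjection maps the derived subgroup onto the derived subgroup, so the lifts
      can be chosen in \<open>derived G (carrier G)\<close>.\<close>
    have "w i \<in> h ` derived G (carrier G)"
      unfolding derived_img[OF subset_refl, symmetric] surj using w(2) by auto
    then show ?thesis by (elim imageE) auto
  qed
  then obtain k where k: "\<And>i. k i \<in> derived G (carrier G)" "\<And>i. h (k i) = w i" by metis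
  have kc: "k i \<in> carrier G" for i using k(1) G.derived_in_carrier[of "carrier G"] by auto
  have wc: "range w \<subseteq> carrier H" and wcomm: "w i \<otimes>\<^bsub>H\<^esub> w j = w j \<otimes>\<^bsub>H\<^esub> w i" for i j
    using w(1) unfolding commuting_family_def by blast+
  have "\<exists>m::nat. m > 0 \<and> (\<forall>j\<in>{..<i}. k j \<otimes> k i [^] m = k i [^] m \<otimes> k j)" for i
  proof (rule common_multiple)
    show "finite {..<i}" by simp
  next
    fix j assume j: "j \<in> {..<i}"
    \<comment> \<open>Only the indices up to \<open>i\<close> matter here, so \<open>fin\<close>
      applies. As \<open>w i\<close> and \<open>w j\<close> commute, conjugation by powers of
      \<open>k i\<close> changes \<open>k j\<close> only by factors from the finite kernel
      part.\<close>
    let ?S = "k ` {..i}"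
    have S: "finite ?S" "?S \<subseteq> carrier G" using kc by auto
    have hS: "h ` ?S = w ` {..i}" by (auto simp: k image_image)
    have "comm_group (H\<lparr>carrier := generate H (h ` ?S)\<rparr>)"
      unfolding hS using wc wcomm by (intro H.comm_group_generate) auto
    moreover have "torsion_free_set H (generate H (h ` ?S))"
      using H.independent_family_torsion_free[OF w(1,3)] H.mono_generate[of "h ` ?S" "range w"]
      unfolding hS torsion_free_set_def by blast
    ultimately have finU: "finite (generate G ?S \<inter> kernel G H h)" by (intro fin S)
    have kS: "k i \<in> generate G ?S" "k j \<in> generate G ?S" using j by (auto intro!: generate.incl)
    have sub: "subgroup (generate G ?S) G" by (rule G.generate_is_subgroup[OF S(2)])
    have "conj_seq G (k j) (k i) n \<in> (\<lambda>u. u \<otimes> k j) ` (generate G ?S \<inter> kernel G H h)" for n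
    proof -
      have "conj_seq G (k j) (k i) n \<otimes> inv (k j) \<in> generate G ?S"
        unfolding conj_seq_def
        using subgroup.m_closed[OF sub] subgroup.m_inv_closed[OF sub] kS
          G.subgroup_int_pow_closed[OF sub kS(1), of "int n"] by (simp add: int_pow_int)
      moreover have "h (conj_seq G (k j) (k i) n \<otimes> inv (k j)) = \<one>\<^bsub>H\<^esub>"
      proof -
        have wij: "w i \<in> carrier H" "w j \<in> carrier H" using wc by auto
        have "w j \<otimes>\<^bsub>H\<^esub> w i [^]\<^bsub>H\<^esub> n = w i [^]\<^bsub>H\<^esub> n \<otimes>\<^bsub>H\<^esub> w j"
          using H.commute_pow_pow[OF wcomm[of j i], of 1 n] wij by simp
        then have "conj_seq H (w j) (w i) n = w j"
          using H.conj_iff_commute[of "w j" "w i [^]\<^bsub>H\<^esub> n"] wij by (simp add: conj_seq_def)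
        then show ?thesis using kc wij by (simp add: hom_conj_seq k)
      qed
      ultimately have "conj_seq G (k j) (k i) n \<otimes> inv (k j) \<in> generate G ?S \<inter> kernel G H h"
        using kc by (simp add: kernel_def)
      moreover have "conj_seq G (k j) (k i) n = conj_seq G (k j) (k i) n \<otimes> inv (k j) \<otimes> k j"
        using kc by (simp add: G.m_assoc)
      ultimately show ?thesis by (rule rev_image_eqI)
    qed
    then have "range (conj_seq G (k j) (k i)) \<subseteq> (\<lambda>u. u \<otimes> k j) ` (generate G ?S \<inter> kernel G H h)" by blast
    then have "finite (range (conj_seq G (k j) (k i)))"
      using finU finite_subset by blast
    then show "\<exists>m::nat. m > 0 \<and> k j \<otimes> k i [^] m = k i [^] m \<otimes> k j"
      by (intro G.finite_conj_seq_commute kc)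
  next
    fix j and n l :: nat assume "k j \<otimes> k i [^] n = k i [^] n \<otimes> k j"
    then show "k j \<otimes> k i [^] (n * l) = k i [^] (n * l) \<otimes> k j"
      using G.commute_pow_pow[of "k j" "k i [^] n" 1 l] kc by (simp add: G.nat_pow_pow)
  qed
  then obtain m :: "nat \<Rightarrow> nat"
    where m: "\<And>i. m i > 0" "\<And>i j. j < i \<Longrightarrow> k j \<otimes> k i [^] m i = k i [^] m i \<otimes> k j"
    by (metis lessThan_iff)
  \<comment> \<open>Each \<open>z i\<close> commutes with every earlier \<open>k j\<close>, hence
    with its power \<open>z j\<close>. Independence survives because the exponents
    \<open>m i\<close> are positive.\<close>
  define z where "z i = k i [^] m i" for i
  have zc: "range z \<subseteq> carrier G" using kc by (auto simp: z_def)
  have *: "z j \<otimes> z i = z i \<otimes> z j" if "j < i" for i j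
    unfolding z_def using G.commute_pow_pow[OF m(2)[OF that], of "m j" 1] kc by simp
  have "commuting_family G z"
    unfolding commuting_family_def using zc * by (metis linorder_neqE_nat)
  moreover have "range z \<subseteq> derived G (carrier G)"
    using G.subgroup_int_pow_closed[OF G.derived_is_subgroup[of "carrier G"] k(1)]
    by (auto simp: z_def simp flip: int_pow_int)
  moreover have "independent_on G UNIV z"
    unfolding independent_on_def
  proof (intro allI impI)
    fix c n i assume e: "eprod G z c n = \<one>" and i: "i < n"
    have "h (z i) = w i [^]\<^bsub>H\<^esub> int (m i)" for i
      using kc by (simp add: z_def hom_nat_pow k int_pow_int)
    then have "eprod H w (\<lambda>i. int (m i) * c i) n = \<one>\<^bsub>H\<^esub>"
      using hom_eprod[OF zc, of c n] e by (simp add: H.eprod_pow[OF wc])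
    then have "int (m i) * c i = 0" using w(3) i unfolding independent_on_def by blast
    then show "c i = 0" using m(1)[of i] by simp
  qed
  ultimately show ?thesis by blast
qed

text \<open>Successive powers repair the lift. Let \<open>U\<close> be the finite part of the kernel
  and \<open>k\<close> an exponent of it. The power \<open>a1\<close> of \<open>a\<close>
  centralizes \<open>U\<close>; then \<open>a2 = a1 [^] k\<close> commutes with its conjugates under
  \<open>g1\<close>; and one further \<open>k\<close>-th power \<open>a3\<close> removes torsion. No
  powers of \<open>a3\<close> and \<open>g1\<close> commute, because their images are powers of
  \<open>h a\<close> and \<open>h g\<close>.\<close>

lemma (in group_hom) lift_Gc_pair:
  assumes a: "a \<in> carrier G" and g: "g \<in> carrier G" and pair: "Gc_pair H (h a) (h g)"
    and fin: "finite (generate G {a, g} \<inter> kernel G H h)"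
  shows "\<exists>a' g'. Gc_pair G a' g'"
proof -
  let ?K = "generate G {a, g}"
  define U where "U = ?K \<inter> kernel G H h"
  define B where "B = generate H (range (conj_seq H (h a) (h g)))"
  have commH: "commuting_family H (conj_seq H (h a) (h g))" and tfB: "torsion_free_set H B"
    and nopow: "\<And>n::nat. n > 0 \<Longrightarrow> h a [^]\<^bsub>H\<^esub> n \<otimes>\<^bsub>H\<^esub> h g [^]\<^bsub>H\<^esub> n \<noteq> h g [^]\<^bsub>H\<^esub> n \<otimes>\<^bsub>H\<^esub> h a [^]\<^bsub>H\<^esub> n"
    using pair by (auto simp: Gc_pair_def B_def)
  have K: "subgroup ?K G" using a g by (intro G.generate_is_subgroup) auto
  have ag: "a \<in> ?K" "g \<in> ?K" by (auto intro: generate.incl)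
  have powK: "x [^] n \<in> ?K" if "x \<in> ?K" for x and n :: nat
    using G.subgroup_int_pow_closed[OF K that, of "int n"] by (simp add: int_pow_int)
  have conjK: "conj_seq G x y i \<in> ?K" if "x \<in> ?K" "y \<in> ?K" for x y i
    unfolding conj_seq_def using subgroup.m_closed[OF K] subgroup.m_inv_closed[OF K] powK that by simp
  have Kc: "x \<in> carrier G" if "x \<in> ?K" for x using subgroup.mem_carrier[OF K that] .
  have Usub: "subgroup U G" unfolding U_def by (intro G.subgroups_Inter_pair K subgroup_kernel)
  have Uc: "u \<in> carrier G" if "u \<in> U" for u using subgroup.mem_carrier[OF Usub that] .
  have conjU: "conj_seq G u x i \<in> U" if u: "u \<in> U" and x: "x \<in> ?K" for u x i
  proof -
    have "h (conj_seq G u x i) = \<one>\<^bsub>H\<^esub>"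
      using u Uc[OF u] Kc[OF x] by (simp add: hom_conj_seq U_def kernel_def) (simp add: conj_seq_def)
    then show ?thesis using conjK[OF _ x] u Uc[OF u] Kc[OF x] by (simp add: U_def kernel_def)
  qed
  have centr: "\<exists>n::nat. n > 0 \<and> (\<forall>u\<in>U. u \<otimes> x [^] n = x [^] n \<otimes> u)" if x: "x \<in> ?K" for x
  proof (rule common_multiple)
    show "finite U" using fin by (simp add: U_def)
  next
    fix u assume u: "u \<in> U"
    have "finite (range (conj_seq G u x))"
      using conjU[OF u x] fin unfolding U_def by (meson finite_subset image_subsetI)
    then show "\<exists>n::nat. n > 0 \<and> u \<otimes> x [^] n = x [^] n \<otimes> u"
      by (intro G.finite_conj_seq_commute Uc[OF u] Kc[OF x])
  next
    fix u and n l :: nat assume "u \<in> U" "u \<otimes> x [^] n = x [^] n \<otimes> u"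
    then show "u \<otimes> x [^] (n * l) = x [^] (n * l) \<otimes> u"
      using G.commute_pow_pow[of u "x [^] n" 1 l] Uc Kc[OF x] by (simp add: G.nat_pow_pow)
  qed
  obtain M :: nat where M: "M > 0" "\<And>u. u \<in> U \<Longrightarrow> u \<otimes> a [^] M = a [^] M \<otimes> u" using centr[OF ag(1)] by blast
  obtain N :: nat where N: "N > 0" "\<And>u. u \<in> U \<Longrightarrow> u \<otimes> g [^] N = g [^] N \<otimes> u" using centr[OF ag(2)] by blast
  obtain k :: nat where k: "k > 0" "\<And>u. u \<in> U \<Longrightarrow> u [^] k = \<one>"
    using G.torsion_set_finite_subgroup[OF Usub] fin unfolding U_def by blast
  define a1 where "a1 = a [^] M"
  define g1 where "g1 = g [^] N"
  have ag1: "a1 \<in> ?K" "g1 \<in> ?K" unfolding a1_def g1_def by (intro powK ag)+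
  have c1: "a1 \<in> carrier G" "g1 \<in> carrier G" using ag1 Kc by auto
  have hz: "h (conj_seq G a1 g1 i) = conj_seq H (h a) (h g) (N * i) [^]\<^bsub>H\<^esub> M" for i
    unfolding a1_def g1_def using a g by (simp add: hom_conj_seq hom_nat_pow H.conj_seq_pow_pow)
  \<comment> \<open>If \<open>y\<close> commutes with \<open>a1\<close> modulo \<open>U\<close>,
    then conjugation by \<open>y\<close> sends \<open>a1\<close> to \<open>a1 \<otimes> u\<close>
    with \<open>u\<close> in \<open>U\<close>. Since \<open>u\<close> commutes with
    \<open>a1\<close>, the \<open>k\<close>-th power of \<open>a1 \<otimes> u\<close> is that of
    \<open>a1\<close>.\<close>
  have a1k: "a1 [^] k \<otimes> y = y \<otimes> a1 [^] k" if y: "y \<in> ?K" and hy: "h a1 \<otimes>\<^bsub>H\<^esub> h y = h y \<otimes>\<^bsub>H\<^esub> h a1" for y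
  proof -
    have yc: "y \<in> carrier G" using Kc y .
    define u where "u = inv a1 \<otimes> (inv y \<otimes> a1 \<otimes> y)"
    have "inv\<^bsub>H\<^esub> h y \<otimes>\<^bsub>H\<^esub> h a1 \<otimes>\<^bsub>H\<^esub> h y = h a1" using hy c1 yc by (simp add: H.conj_iff_commute)
    then have "h u = \<one>\<^bsub>H\<^esub>" using c1 yc by (simp add: u_def)
    moreover have "u \<in> ?K"
      unfolding u_def using subgroup.m_closed[OF K] subgroup.m_inv_closed[OF K] ag1 y by simp
    ultimately have u: "u \<in> U" using Kc by (simp add: U_def kernel_def)
    have eq: "inv y \<otimes> a1 \<otimes> y = a1 \<otimes> u" using c1 yc by (simp add: u_def)
    have "inv y \<otimes> a1 [^] k \<otimes> y = (a1 \<otimes> u) [^] k"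
      unfolding eq[symmetric] using c1 yc by (simp add: G.conj_nat_pow)
    also have "\<dots> = a1 [^] k \<otimes> u [^] k"
      using M(2)[OF u] c1 Uc[OF u] by (intro G.pow_mult_distrib) (auto simp: a1_def)
    also have "\<dots> = a1 [^] k" using k(2)[OF u] c1 by simp
    finally show ?thesis using c1 yc by (simp add: G.conj_iff_commute)
  qed
  have "a1 [^] k \<otimes> conj_seq G a1 g1 i = conj_seq G a1 g1 i \<otimes> a1 [^] k" for i
  proof (rule a1k[OF conjK[OF ag1]])
    have "h a1 = conj_seq H (h a) (h g) 0 [^]\<^bsub>H\<^esub> M" using a by (simp add: a1_def hom_nat_pow)
    moreover have "conj_seq H (h a) (h g) 0 \<otimes>\<^bsub>H\<^esub> conj_seq H (h a) (h g) (N * i)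
        = conj_seq H (h a) (h g) (N * i) \<otimes>\<^bsub>H\<^esub> conj_seq H (h a) (h g) 0"
      using commH unfolding commuting_family_def by blast
    ultimately show "h a1 \<otimes>\<^bsub>H\<^esub> h (conj_seq G a1 g1 i) = h (conj_seq G a1 g1 i) \<otimes>\<^bsub>H\<^esub> h a1"
      unfolding hz using a g by (simp only: H.commute_pow_pow H.conj_seq_closed hom_closed)
  qed
  then have comm: "(a1 [^] k) [^] r \<otimes> conj_seq G a1 g1 i [^] s = conj_seq G a1 g1 i [^] s \<otimes> (a1 [^] k) [^] r"
    for i and r s :: nat
    using c1 by (intro G.commute_pow_pow) auto
  have seq: "conj_seq G (a1 [^] r) g1 i = conj_seq G a1 g1 i [^] r" for r :: nat and i
    using G.conj_seq_pow_pow[OF c1, of r 1 i] c1 by simp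
  define a2 where "a2 = a1 [^] k"
  \<comment> \<open>Elements generated by the conjugates of \<open>a3\<close> are
    \<open>k\<close>-th powers of elements \<open>e\<close> generated by those of \<open>a2\<close>.
    If such a power is torsion, then \<open>h e\<close> is trivial by torsion-freeness in
    \<open>H\<close>, so \<open>e\<close> lies in \<open>U\<close> and its \<open>k\<close>-th power
    is \<open>\<one>\<close>.\<close>
  define a3 where "a3 = a2 [^] k"
  have c2: "a2 \<in> carrier G" "a3 \<in> carrier G" "a2 \<in> ?K" using c1 powK ag1 by (simp_all add: a2_def a3_def)
  have comm2: "commuting_family G (conj_seq G a2 g1)"
    using comm[of 1] c1 by (intro G.commuting_conj_seq) (auto simp: a2_def seq)
  have comm3: "commuting_family G (conj_seq G a3 g1)"
    using comm[of k _ "k * k"] c1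
    by (intro G.commuting_conj_seq) (auto simp: a3_def a2_def seq G.nat_pow_pow)
  have "torsion_free_set G (generate G (range (conj_seq G a3 g1)))"
    unfolding torsion_free_set_def
  proof (intro ballI allI impI)
    fix x n assume x: "x \<in> generate G (range (conj_seq G a3 g1))" and n: "(n::nat) > 0" "x [^] n = \<one>"
    obtain c m where "x = eprod G (conj_seq G a3 g1) c m" using G.generate_range_eprod[OF comm3 x] by blast
    also have "conj_seq G a3 g1 = (\<lambda>i. conj_seq G a2 g1 i [^] int k)"
      using G.conj_seq_pow_pow[OF c2(1) c1(2), of k 1] c1(2) by (auto simp: a3_def int_pow_int)
    also have "eprod G \<dots> c m = eprod G (conj_seq G a2 g1) c m [^] k"
      using c1 c2 by (simp add: G.eprod_pow G.eprod_nat_pow[OF comm2])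
    finally have x_eq: "x = eprod G (conj_seq G a2 g1) c m [^] k" .
    define e where "e = eprod G (conj_seq G a2 g1) c m"
    have eK: "e \<in> ?K" unfolding e_def by (intro G.eprod_in_subgroup[OF K] conjK c2 ag1)
    have "h e = eprod H (\<lambda>i. h (conj_seq G a2 g1 i)) c m"
      unfolding e_def using c1 c2 by (intro hom_eprod) auto
    moreover have "h (conj_seq G a2 g1 i) \<in> B" for i
    proof -
      have "subgroup B H" unfolding B_def using a g by (intro H.generate_is_subgroup) auto
      moreover have "conj_seq H (h a) (h g) (N * i) \<in> B" unfolding B_def by (intro generate.incl) auto
      ultimately have "conj_seq H (h a) (h g) (N * i) [^]\<^bsub>H\<^esub> int (M * k) \<in> B"
        by (rule H.subgroup_int_pow_closed)
      then show ?thesis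
        using c1 a g by (simp add: a2_def seq hom_nat_pow hz H.nat_pow_pow int_pow_int del: of_nat_mult)
    qed
    ultimately have "h e \<in> B"
      unfolding B_def using a g by (simp add: H.eprod_in_subgroup H.generate_is_subgroup)
    moreover have "h e [^]\<^bsub>H\<^esub> (k * n) = \<one>\<^bsub>H\<^esub>"
      using n(2) Kc[OF eK] by (simp add: x_eq e_def[symmetric] G.nat_pow_pow flip: hom_nat_pow)
    ultimately have "h e = \<one>\<^bsub>H\<^esub>"
      using tfB k(1) n(1) unfolding torsion_free_set_def by (metis nat_0_less_mult_iff)
    then have "e \<in> U" using eK Kc[OF eK] by (simp add: U_def kernel_def)
    then show "x = \<one>" using k(2) by (simp add: x_eq e_def)
  qed
  moreover have "a3 [^] n \<otimes> g1 [^] n \<noteq> g1 [^] n \<otimes> a3 [^] n" if n: "n > 0" for n :: nat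
  proof
    assume "a3 [^] n \<otimes> g1 [^] n = g1 [^] n \<otimes> a3 [^] n"
    \<comment> \<open>\<open>a3\<close> is \<open>a\<close> to the power \<open>M * k * k\<close>
      and \<open>g1\<close> is \<open>g\<close> to the power \<open>N\<close>; raising each to the
      exponent of the other makes the two exponents equal.\<close>
    then have "(a3 [^] n) [^] N \<otimes> (g1 [^] n) [^] (M * k * k) = (g1 [^] n) [^] (M * k * k) \<otimes> (a3 [^] n) [^] N"
      by (rule G.commute_pow_pow) (use c1 c2 in auto)
    moreover have "(a3 [^] n) [^] N = a [^] (M * k * k * n * N)"
      using a by (simp add: a3_def a2_def a1_def G.nat_pow_pow mult_ac)
    moreover have "(g1 [^] n) [^] (M * k * k) = g [^] (M * k * k * n * N)"
      using g by (simp add: g1_def G.nat_pow_pow mult_ac)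
    ultimately have *: "a [^] (M * k * k * n * N) \<otimes> g [^] (M * k * k * n * N)
      = g [^] (M * k * k * n * N) \<otimes> a [^] (M * k * k * n * N)" by simp
    have "h a [^]\<^bsub>H\<^esub> (M * k * k * n * N) \<otimes>\<^bsub>H\<^esub> h g [^]\<^bsub>H\<^esub> (M * k * k * n * N)
      = h g [^]\<^bsub>H\<^esub> (M * k * k * n * N) \<otimes>\<^bsub>H\<^esub> h a [^]\<^bsub>H\<^esub> (M * k * k * n * N)"
      using arg_cong[OF *, of h] a g by (simp add: hom_nat_pow)
    moreover have "M * k * k * n * N > 0" using M(1) N(1) k(1) n by simp
    ultimately show False using nopow by blast
  qed
  ultimately have "Gc_pair G a3 g1" using c1 c2 comm3 by (simp add: Gc_pair_def)
  then show ?thesis by blast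
qed

section \<open>Torsion radical and Heisenberg pairs\<close>

definition torsion_radical :: "('a, 'b) monoid_scheme \<Rightarrow> 'a set" where
  "torsion_radical G = \<Union>{N. N \<lhd> G \<and> torsion_set G N}"

context group
begin

text \<open>Modulo \<open>M\<close> the product \<open>x \<otimes> y\<close> is \<open>y\<close>, so
  its \<open>n\<close>-th power falls into \<open>M\<close> once \<open>y [^] n = \<one>\<close>,
  and \<open>M\<close> is torsion.\<close>

lemma torsion_set_mult_normal:
  assumes M: "M \<lhd> G" "torsion_set G M" and N: "N \<lhd> G" "torsion_set G N"
  shows "torsion_set G (M <#> N)"
  unfolding torsion_set_def
proof
  interpret M: normal M G by fact
  interpret N: normal N G by fact
  fix u assume "u \<in> M <#> N"
  then obtain x y where xy: "x \<in> M" "y \<in> N" "u = x \<otimes> y" by (auto simp: set_mult_def)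
  obtain n :: nat where n: "n > 0" "y [^] n = \<one>" using N(2) xy(2) by (auto simp: torsion_set_def)
  have c: "x \<in> carrier G" "y \<in> carrier G" using xy by auto
  have "\<exists>m\<in>M. (x \<otimes> y) [^] k = m \<otimes> y [^] k" for k :: nat
  proof (induction k)
    case 0
    then show ?case using M.one_closed by force
  next
    case (Suc k)
    then obtain m where m: "m \<in> M" "(x \<otimes> y) [^] k = m \<otimes> y [^] k" by blast
    have "(x \<otimes> y) [^] Suc k = m \<otimes> (y [^] k \<otimes> x \<otimes> inv (y [^] k)) \<otimes> y [^] Suc k"
      using m c by (simp add: m_assoc)
    moreover have "m \<otimes> (y [^] k \<otimes> x \<otimes> inv (y [^] k)) \<in> M"
      using m xy c by (intro M.m_closed M.inv_op_closed2) auto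
    ultimately show ?case by blast
  qed
  then obtain m where m: "m \<in> M" "u [^] n = m" using n(2) M.subset xy(3) by (metis M.mem_carrier r_one)
  then obtain l :: nat where "l > 0" "m [^] l = \<one>" using M(2) by (auto simp: torsion_set_def)
  then have "u [^] (n * l) = \<one>" using m c xy(3) by (simp flip: nat_pow_pow)
  then show "\<exists>n::nat. n > 0 \<and> u [^] n = \<one>" using n(1) \<open>l > 0\<close> by (intro exI[of _ "n * l"]) simp
qed

lemma torsion_radical: "torsion_radical G \<lhd> G" "torsion_set G (torsion_radical G)"
proof -
  let ?T = "torsion_radical G"
  have one: "{\<one>} \<lhd> G \<and> torsion_set G {\<one>}" by (auto simp: one_is_normal torsion_set_def)
  have memE: "\<exists>N. N \<lhd> G \<and> torsion_set G N \<and> x \<in> N" if "x \<in> ?T" for x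
    using that by (auto simp: torsion_radical_def)
  have memI: "x \<in> ?T" if "N \<lhd> G" "torsion_set G N" "x \<in> N" for x N
    using that by (auto simp: torsion_radical_def)
  show "?T \<lhd> G"
  proof (rule normal_invI)
    show "subgroup ?T G"
    proof (rule subgroupI)
      show "?T \<subseteq> carrier G" using memE normal_imp_subgroup subgroup.subset by blast
      show "?T \<noteq> {}" using one memI[of "{\<one>}" \<one>] by blast
    next
      fix a assume "a \<in> ?T"
      then obtain N where N: "N \<lhd> G" "torsion_set G N" "a \<in> N" using memE by blast
      then show "inv a \<in> ?T"
        using memI[OF N(1,2)] subgroup.m_inv_closed[OF normal_imp_subgroup[OF N(1)]] by blast
    next
      fix a b assume "a \<in> ?T" "b \<in> ?T"
      then obtain M N where M: "M \<lhd> G" "torsion_set G M" "a \<in> M" and N: "N \<lhd> G" "torsion_set G N" "b \<in> N"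
        using memE by meson
      have "a \<otimes> b \<in> M <#> N" using M N by (auto simp: set_mult_def)
      then show "a \<otimes> b \<in> ?T"
        by (intro memI[OF normal_subgroup_set_mult_closed[OF M(1) N(1)] torsion_set_mult_normal[OF M(1,2) N(1,2)]])
    qed
  next
    fix x a assume x: "x \<in> carrier G" and "a \<in> ?T"
    then obtain N where N: "N \<lhd> G" "torsion_set G N" "a \<in> N" using memE by blast
    show "x \<otimes> a \<otimes> inv x \<in> ?T" by (rule memI[OF N(1,2) normal.inv_op_closed2[OF N(1) x N(3)]])
  qed
  show "torsion_set G ?T" using memE unfolding torsion_set_def by blast
qed

text \<open>The elements of finite order in an abelian normal subgroup form a subgroup stable under
  conjugation in \<open>G\<close>, hence a normal torsion subgroup.\<close>

lemma torsion_free_of_no_torsion_normal: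
  assumes no_torsion: "\<And>N. N \<lhd> G \<Longrightarrow> torsion_set G N \<Longrightarrow> N = {\<one>}"
    and A: "A \<lhd> G" and comm: "\<And>x y. x \<in> A \<Longrightarrow> y \<in> A \<Longrightarrow> x \<otimes> y = y \<otimes> x"
  shows "torsion_free_set G A"
proof -
  interpret A: normal A G by fact
  define T where "T = {x \<in> A. \<exists>n::nat. n > 0 \<and> x [^] n = \<one>}"
  have "T \<lhd> G"
  proof (rule normal_invI)
    show "subgroup T G"
    proof (rule subgroupI)
      show "T \<subseteq> carrier G" by (auto simp: T_def)
      have "\<exists>n::nat. n > 0 \<and> \<one> [^] n = \<one>" by (intro exI[of _ 1]) simp
      then have "\<one> \<in> T" by (simp add: T_def)
      then show "T \<noteq> {}" by blast
    next
      fix a assume "a \<in> T"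
      then show "inv a \<in> T" by (auto simp: T_def nat_pow_inv)
    next
      fix a b assume "a \<in> T" "b \<in> T"
      then obtain m n :: nat where ab: "a \<in> A" "b \<in> A" "m > 0" "a [^] m = \<one>" "n > 0" "b [^] n = \<one>"
        by (auto simp: T_def)
      have "a [^] (m * n) = \<one>" using ab by (simp flip: nat_pow_pow)
      moreover have "b [^] (m * n) = \<one>"
        unfolding mult.commute[of m n] using ab by (simp flip: nat_pow_pow)
      moreover have "(a \<otimes> b) [^] (m * n) = a [^] (m * n) \<otimes> b [^] (m * n)"
        using ab comm by (intro pow_mult_distrib) auto
      ultimately have "(a \<otimes> b) [^] (m * n) = \<one>" by simp
      then show "a \<otimes> b \<in> T" using ab unfolding T_def by (auto intro!: exI[of _ "m * n"])
    qed
  next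
    fix x a assume x: "x \<in> carrier G" and a: "a \<in> T"
    then obtain n :: nat where n: "a \<in> A" "n > 0" "a [^] n = \<one>" by (auto simp: T_def)
    have "(inv (inv x) \<otimes> a \<otimes> inv x) [^] n = \<one>" using n x by (subst conj_nat_pow) auto
    then have "(x \<otimes> a \<otimes> inv x) [^] n = \<one>" using x by simp
    then show "x \<otimes> a \<otimes> inv x \<in> T" using n x A.inv_op_closed2 unfolding T_def by blast
  qed
  moreover have "torsion_set G T" by (auto simp: torsion_set_def T_def)
  ultimately have "T = {\<one>}" by (rule no_torsion)
  then show ?thesis unfolding torsion_free_set_def T_def by blast
qed

lemma exp_of_derived_is_normal: "C \<lhd> G \<Longrightarrow> (derived G ^^ n) C \<lhd> G"
  by (induction n) (auto intro: derived_is_normal)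

lemma centralizer_normal:
  assumes "A \<lhd> G"
  shows "centralizer G A \<lhd> G"
proof (rule normal_invI)
  interpret A: normal A G by fact
  show "subgroup (centralizer G A) G" by (rule subgroup_centralizer[OF A.subset])
  fix x c assume x: "x \<in> carrier G" and c: "c \<in> centralizer G A"
  have cc: "c \<in> carrier G" using c by (simp add: centralizer_def)
  have "(x \<otimes> c \<otimes> inv x) \<otimes> s = s \<otimes> (x \<otimes> c \<otimes> inv x)" if s: "s \<in> A" for s
  proof -
    have sc: "s \<in> carrier G" using s by simp
    have "inv x \<otimes> s \<otimes> x \<in> A" by (rule A.inv_op_closed1[OF x s])
    then have "c \<otimes> (inv x \<otimes> s \<otimes> x) = (inv x \<otimes> s \<otimes> x) \<otimes> c" using c by (auto simp: centralizer_def)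
    from commute_conj[of _ _ "inv x", OF cc _ _ this] show ?thesis
      using x sc by (simp add: m_assoc)
  qed
  then show "x \<otimes> c \<otimes> inv x \<in> centralizer G A" using x cc by (simp add: centralizer_def)
qed

lemma commutator_in_derived:
  assumes "x \<in> D" "y \<in> D" "subgroup D G"
  shows "inv x \<otimes> (inv y \<otimes> x \<otimes> y) \<in> derived G D"
proof -
  have c: "x \<in> carrier G" "y \<in> carrier G" "inv x \<in> D" "inv y \<in> D"
    using assms subgroup.mem_carrier[OF assms(3)] subgroup.m_inv_closed[OF assms(3)] by auto
  \<comment> \<open>\<open>derived\<close> is generated by the products
    \<open>x \<otimes> y \<otimes> inv x \<otimes> inv y\<close>, so the commutator is rewritten as
    that of the inverses.\<close>
  have "inv x \<otimes> (inv y \<otimes> x \<otimes> y) = inv x \<otimes> inv y \<otimes> inv (inv x) \<otimes> inv (inv y)"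
    using c by (simp add: m_assoc)
  also have "\<dots> \<in> derived G D"
    unfolding derived_def using c
    by (intro generate.incl UN_I[of "inv x" D] UN_I[of "inv y" D]) auto
  finally show ?thesis .
qed

text \<open>Here \<open>x\<close> and \<open>y\<close> generate a discrete Heisenberg group.\<close>

lemma Gc_pair_of_central_commutator:
  assumes c: "x \<in> carrier G" "y \<in> carrier G" "z \<in> carrier G"
    and conj: "inv y \<otimes> x \<otimes> y = x \<otimes> z" and xz: "x \<otimes> z = z \<otimes> x" and yz: "y \<otimes> z = z \<otimes> y"
    and z: "\<And>k::int. z [^] k = \<one> \<Longrightarrow> k = 0"
  shows "Gc_pair G x y"
proof -
  have conj_z: "inv y \<otimes> z [^] (l::int) \<otimes> y = z [^] l" for l
    using c yz commute_int_pow[of z y l] by (subst conj_iff_commute) auto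
  have xz_pow: "z [^] (l::int) \<otimes> x [^] (k::int) = x [^] k \<otimes> z [^] l" for k l
    using commute_int_pow[OF xz, of k] commute_int_pow[of z "x [^] k" l] c by simp
  have seq: "conj_seq G x y i = x \<otimes> z [^] i" for i
  proof (induction i)
    case (Suc i)
    have "conj_seq G x y (Suc i) = (inv y \<otimes> x \<otimes> y) \<otimes> (inv y \<otimes> z [^] int i \<otimes> y)"
      using c by (simp add: conj_seq_Suc Suc m_assoc int_pow_int)
    also have "\<dots> = x \<otimes> (z \<otimes> z [^] i)"
      unfolding conj_z conj using c by (simp add: m_assoc int_pow_int)
    finally show ?case using c by (simp only: nat_pow_Suc2)
  qed (use c in simp)
  have comm: "commuting_family G (conj_seq G x y)"
  proof (rule commuting_conj_seq[OF c(1,2)])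
    fix i :: nat
    have "z [^] i \<otimes> x = x \<otimes> z [^] i" by (rule group_commutes_pow[OF xz[symmetric] c(3,1)])
    then show "x \<otimes> conj_seq G x y i = conj_seq G x y i \<otimes> x"
      unfolding seq using c by (simp add: m_assoc)
  qed
  \<comment> \<open>An abelian subgroup containing every conjugate
    \<open>x \<otimes> z [^] i\<close>; it supplies coordinates for the torsion argument.\<close>
  define X where "X = {x [^] (k::int) \<otimes> z [^] (l::int) | k l. True}"
  have mult: "(x [^] k \<otimes> z [^] l) \<otimes> (x [^] k' \<otimes> z [^] l') = x [^] (k + k') \<otimes> z [^] (l + l')"
    for k l k' l' :: int
  proof -
    have "(x [^] k \<otimes> z [^] l) \<otimes> (x [^] k' \<otimes> z [^] l') = x [^] k \<otimes> (z [^] l \<otimes> x [^] k') \<otimes> z [^] l'"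
      using c by (simp add: m_assoc)
    then show ?thesis unfolding xz_pow using c by (simp add: m_assoc int_pow_mult)
  qed
  have "subgroup X G"
  proof (rule subgroupI)
    show "X \<subseteq> carrier G" "X \<noteq> {}" using c by (auto simp: X_def)
  next
    fix e assume "e \<in> X"
    then obtain k l :: int where e: "e = x [^] k \<otimes> z [^] l" by (auto simp: X_def)
    have "inv e = x [^] (- k) \<otimes> z [^] (- l)"
      using c mult[of "- k" "- l" k l] by (intro inv_equality) (auto simp: e)
    then show "inv e \<in> X" unfolding X_def by blast
  next
    fix e e' assume "e \<in> X" "e' \<in> X"
    then show "e \<otimes> e' \<in> X" unfolding X_def using mult by force
  qed
  moreover have "range (conj_seq G x y) \<subseteq> X"
  proof safe
    fix i
    have "conj_seq G x y i = x [^] (1::int) \<otimes> z [^] int i" using c by (simp add: seq int_pow_int)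
    then show "conj_seq G x y i \<in> X" unfolding X_def by blast
  qed
  ultimately have BX: "generate G (range (conj_seq G x y)) \<subseteq> X" by (intro generate_subgroup_incl)
  have "torsion_free_set G (generate G (range (conj_seq G x y)))"
    unfolding torsion_free_set_def
  proof (intro ballI allI impI)
    fix e n assume e: "e \<in> generate G (range (conj_seq G x y))" and n: "(n::nat) > 0" "e [^] n = \<one>"
    obtain k l :: int where kl: "e = x [^] k \<otimes> z [^] l" using e BX by (auto simp: X_def)
    have ec: "e \<in> carrier G" using kl c by simp
    have "inv y \<otimes> e \<otimes> y = (inv y \<otimes> x [^] k \<otimes> y) \<otimes> (inv y \<otimes> z [^] l \<otimes> y)"
      using c by (simp add: kl m_assoc)
    also have "\<dots> = (x \<otimes> z) [^] k \<otimes> z [^] l"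
      unfolding conj_z conj_int_pow[OF c(1,2), symmetric] conj ..
    also have "\<dots> = x [^] k \<otimes> z [^] k \<otimes> z [^] l" by (simp only: int_pow_mult_distrib[OF xz c(1,3)])
    also have "\<dots> = x [^] k \<otimes> (z [^] l \<otimes> z [^] k)"
      using c by (simp add: m_assoc add.commute flip: int_pow_mult)
    also have "\<dots> = e \<otimes> z [^] k" using c by (simp add: kl m_assoc)
    finally have ey: "inv y \<otimes> e \<otimes> y = e \<otimes> z [^] k" .
    have ez: "e \<otimes> z [^] k = z [^] k \<otimes> e"
      using c mult[of 0 k k l] mult[of k l 0 k] by (simp add: kl add.commute)
    \<comment> \<open>Conjugation by \<open>y\<close> multiplies \<open>e\<close> by
      \<open>z [^] k\<close>. Applied to \<open>e [^] n = \<one>\<close> it yields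
      \<open>z [^] (k * int n) = \<one>\<close>, so the infinite order of \<open>z\<close> alone
      forces \<open>k = 0\<close>.\<close>
    have "\<one> = inv y \<otimes> e [^] n \<otimes> y" using n(2) c by simp
    also have "\<dots> = (e \<otimes> z [^] k) [^] n"
      unfolding ey[symmetric] using c ec by (simp add: conj_nat_pow)
    also have "\<dots> = e [^] n \<otimes> (z [^] k) [^] n" using ez ec c by (intro pow_mult_distrib) auto
    also have "\<dots> = z [^] (k * int n)" using n(2) c int_pow_pow[of z k "int n"] by (simp add: int_pow_int)
    finally have "k = 0" using z[of "k * int n"] n(1) by simp
    then have el: "e = z [^] l" using c by (simp add: kl)
    then have "z [^] (l * int n) = \<one>" using n(2) c int_pow_pow[of z l "int n"] by (simp add: int_pow_int)
    then show "e = \<one>" using z[of "l * int n"] n(1) el by simp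
  qed
  moreover have "x [^] n \<otimes> y [^] n \<noteq> y [^] n \<otimes> x [^] n" if n: "n > 0" for n :: nat
  proof
    assume "x [^] n \<otimes> y [^] n = y [^] n \<otimes> x [^] n"
    then have "inv (y [^] n) \<otimes> x [^] n \<otimes> y [^] n = x [^] n" using c by (simp add: conj_iff_commute)
    moreover have "inv (y [^] n) \<otimes> x [^] n \<otimes> y [^] n = conj_seq G x y n [^] n"
      using c by (simp add: conj_seq_def conj_nat_pow)
    \<comment> \<open>Conjugating by \<open>y [^] n\<close> turns \<open>x\<close> into
      \<open>x \<otimes> z [^] n\<close>; the \<open>n\<close>-th power then squares the exponent of
      \<open>z\<close>.\<close>
    moreover have "conj_seq G x y n [^] n = x [^] n \<otimes> z [^] (n * n)"
    proof -
      have "x \<otimes> z [^] n = z [^] n \<otimes> x" using commute_pow_pow[OF xz, of 1 n] c by simp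
      from pow_mult_distrib[OF this, of n] show ?thesis unfolding seq using c by (simp add: nat_pow_pow)
    qed
    ultimately have "x [^] n \<otimes> z [^] (n * n) = x [^] n" by simp
    then have "z [^] (n * n) = \<one>" using c by (metis l_cancel_one nat_pow_closed)
    then have "z [^] int (n * n) = \<one>" by (simp only: int_pow_int)
    then show False using z[of "int (n * n)"] n by simp
  qed
  ultimately show ?thesis using c comm by (simp add: Gc_pair_def)
qed

end

section \<open>Self-centralizing abelian normal subgroups\<close>

context group
begin

text \<open>Zorn's lemma gives a maximal abelian normal \<open>A\<close>. If its centralizer is not
  inside \<open>A\<close>, solubility provides the last term \<open>D k\<close> of the derived
  series of the centralizer that is not. Commutators of \<open>D k\<close> lie in \<open>A\<close>,
  so they are central in \<open>D k\<close> and, unless trivial, of infinite order; noncommuting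
  elements would form a Heisenberg pair. Hence \<open>D k\<close> is abelian and, joined to
  \<open>A\<close>, contradicts maximality.\<close>

lemma self_centralizing_normal:
  assumes no_torsion: "\<And>N. N \<lhd> G \<Longrightarrow> torsion_set G N \<Longrightarrow> N = {\<one>}"
    and no_pair: "\<And>a g. \<not> Gc_pair G a g" and solv: "solvable G"
  shows "\<exists>A. A \<lhd> G \<and> (\<forall>x\<in>A. \<forall>y\<in>A. x \<otimes> y = y \<otimes> x) \<and> centralizer G A \<subseteq> A"
proof -
  define \<A> where "\<A> = {A. A \<lhd> G \<and> (\<forall>x\<in>A. \<forall>y\<in>A. x \<otimes> y = y \<otimes> x)}"
  have "{\<one>} \<in> \<A>" using one_is_normal by (simp add: \<A>_def)
  moreover have "\<Union>\<C> \<in> \<A>" if ne: "\<C> \<noteq> {}" and chain: "subset.chain \<A> \<C>" for \<C>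
  proof -
    have sub: "B \<lhd> G" "\<And>x y. x \<in> B \<Longrightarrow> y \<in> B \<Longrightarrow> x \<otimes> y = y \<otimes> x" if "B \<in> \<C>" for B
      using chain that by (auto simp: \<A>_def subset.chain_def)
    have two: "\<exists>B\<in>\<C>. x \<in> B \<and> y \<in> B" if "x \<in> \<Union>\<C>" "y \<in> \<Union>\<C>" for x y
    proof -
      obtain B B' where B: "B \<in> \<C>" "x \<in> B" "B' \<in> \<C>" "y \<in> B'" using \<open>x \<in> \<Union>\<C>\<close> \<open>y \<in> \<Union>\<C>\<close> by blast
      then have "B \<subseteq> B' \<or> B' \<subseteq> B" using chain by (auto simp: subset.chain_def)
      then show ?thesis using B by blast
    qed
    have nsub: "subgroup B G" if "B \<in> \<C>" for B using normal_imp_subgroup[OF sub(1)[OF that]] .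
    have "subgroup (\<Union>\<C>) G"
    proof (rule subgroupI)
      show "\<Union>\<C> \<subseteq> carrier G" using nsub subgroup.subset by (metis Union_least)
      obtain B where "B \<in> \<C>" using ne by blast
      then show "\<Union>\<C> \<noteq> {}" using subgroup.one_closed[OF nsub] by blast
    next
      fix a assume "a \<in> \<Union>\<C>"
      then obtain B where "B \<in> \<C>" "a \<in> B" by blast
      then show "inv a \<in> \<Union>\<C>" using subgroup.m_inv_closed[OF nsub] by (intro UnionI)
    next
      fix a b assume "a \<in> \<Union>\<C>" "b \<in> \<Union>\<C>"
      then obtain B where "B \<in> \<C>" "a \<in> B" "b \<in> B" using two by meson
      then show "a \<otimes> b \<in> \<Union>\<C>" using subgroup.m_closed[OF nsub] by (intro UnionI)
    qed
    moreover have "x \<otimes> a \<otimes> inv x \<in> \<Union>\<C>" if x: "x \<in> carrier G" and a: "a \<in> \<Union>\<C>" for x a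
    proof -
      obtain B where B: "B \<in> \<C>" "a \<in> B" using a by blast
      then have "x \<otimes> a \<otimes> inv x \<in> B" using normal.inv_op_closed2[OF sub(1)[OF B(1)] x B(2)] by simp
      then show ?thesis using B by blast
    qed
    ultimately have "\<Union>\<C> \<lhd> G" by (rule normal_invI)
    moreover have "\<forall>x\<in>\<Union>\<C>. \<forall>y\<in>\<Union>\<C>. x \<otimes> y = y \<otimes> x" using two sub(2) by meson
    ultimately show ?thesis by (simp add: \<A>_def)
  qed
  ultimately obtain A where A: "A \<in> \<A>" and max: "\<And>B. B \<in> \<A> \<Longrightarrow> A \<subseteq> B \<Longrightarrow> B = A"
    using subset_Zorn_nonempty[of \<A>] by blast
  have An: "A \<lhd> G" and Acomm: "\<And>x y. x \<in> A \<Longrightarrow> y \<in> A \<Longrightarrow> x \<otimes> y = y \<otimes> x"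
    using A by (auto simp: \<A>_def)
  interpret A: normal A G by (rule An)
  have tf: "torsion_free_set G A"
    by (rule torsion_free_of_no_torsion_normal[OF no_torsion An Acomm])
  let ?C = "centralizer G A"
  define D where "D n = (derived G ^^ n) ?C" for n
  have Dn: "D n \<lhd> G" for n
    unfolding D_def by (rule exp_of_derived_is_normal[OF centralizer_normal[OF An]])
  have DC: "D n \<subseteq> ?C" for n
  proof (induction n)
    case (Suc n)
    then show ?case unfolding D_def
      using derived_incl[OF _ normal_imp_subgroup[OF centralizer_normal[OF An]]] by simp
  qed (simp add: D_def)
  have "?C \<subseteq> A"
  proof (rule ccontr)
    assume notA: "\<not> ?C \<subseteq> A"
    obtain m where "(derived G ^^ m) (carrier G) = {\<one>}"
      using solv solvable_iff_trivial_derived_seq by auto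
    then have "D m \<subseteq> A"
      using mono_exp_of_derived[of ?C "carrier G" m] A.one_closed by (auto simp: D_def centralizer_def)
    then obtain n where n: "D n \<subseteq> A" "\<And>k. k < n \<Longrightarrow> \<not> D k \<subseteq> A"
      using exists_least_iff[of "\<lambda>n. D n \<subseteq> A"] by blast
    have "n \<noteq> 0" using n(1) notA by (auto simp: D_def)
    then obtain k where k: "n = Suc k" by (cases n) auto
    interpret D: normal "D k" G by (rule Dn)
    have DA: "derived G (D k) \<subseteq> A" using n(1) by (simp add: D_def k)
    have Dcomm: "x \<otimes> y = y \<otimes> x" if x: "x \<in> D k" and y: "y \<in> D k" for x y
    proof (rule ccontr)
      assume ne: "x \<otimes> y \<noteq> y \<otimes> x"
      define z where "z = inv x \<otimes> (inv y \<otimes> x \<otimes> y)"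
      have zA: "z \<in> A" unfolding z_def using commutator_in_derived[OF x y D.is_subgroup] DA by blast
      have c: "x \<in> carrier G" "y \<in> carrier G" "z \<in> carrier G" using x y zA by auto
      have eq: "inv y \<otimes> x \<otimes> y = x \<otimes> z" using c by (simp add: z_def)
      have "z \<noteq> \<one>" using eq ne c by (auto simp: conj_iff_commute)
      then have z: "j = 0" if "z [^] j = \<one>" for j :: int
        using torsion_free_int_pow[OF tf zA c(3) that] by blast
      have "x \<otimes> z = z \<otimes> x" "y \<otimes> z = z \<otimes> y" using x y DC zA by (auto simp: centralizer_def)
      from Gc_pair_of_central_commutator[OF c eq this z] show False using no_pair by blast
    qed
    let ?B = "generate G (A \<union> D k)"
    have sub: "A \<union> D k \<subseteq> carrier G" by auto
    have comm: "s \<otimes> t = t \<otimes> s" if "s \<in> A \<union> D k" "t \<in> A \<union> D k" for s t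
    proof -
      have "u \<otimes> w = w \<otimes> u" if "u \<in> D k" "w \<in> A" for u w
        using that DC[of k] by (auto simp: centralizer_def)
      then show ?thesis using that Acomm Dcomm by (elim UnE) simp_all
    qed
    have "?B \<lhd> G"
    proof (rule normal_generateI[OF sub])
      show "x \<otimes> y \<otimes> inv x \<in> A \<union> D k" if "y \<in> A \<union> D k" "x \<in> carrier G" for x y
        using that A.inv_op_closed2[of x y] D.inv_op_closed2[of x y] by blast
    qed
    moreover have "\<forall>x\<in>?B. \<forall>y\<in>?B. x \<otimes> y = y \<otimes> x"
      by (intro ballI commute_generate[OF sub sub comm])
    ultimately have "?B \<in> \<A>" by (simp add: \<A>_def)
    moreover have AD: "A \<union> D k \<subseteq> ?B" by (auto intro: generate.incl)
    ultimately have "?B = A" by (intro max) auto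
    then have "D k \<subseteq> A" using AD by blast
    then show False using n(2)[of k] k by blast
  qed
  then show ?thesis using An Acomm by blast
qed

text \<open>The centralizers in \<open>A\<close> of the powers \<open>g\<^sup>n\<^sup>!\<close> form a chain of pure subgroups with union \<open>A\<close>. If
  it does not stabilise, then elements \<open>a\<^sub>j\<close> taken from successive differences have independent
  commutators \<open>[a\<^sub>j, g]\<close>.\<close>

lemma ex_pow_in_centralizer:
  assumes A: "A \<lhd> G" and Acomm: "\<And>x y. x \<in> A \<Longrightarrow> y \<in> A \<Longrightarrow> x \<otimes> y = y \<otimes> x"
    and tf: "torsion_free_set G A" and no_pair: "\<And>a g. \<not> Gc_pair G a g"
    and no_family: "\<And>z. commuting_family G z \<Longrightarrow> range z \<subseteq> derived G (carrier G) \<Longrightarrow> \<not> independent_on G UNIV z"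
    and g: "g \<in> carrier G"
  shows "\<exists>n::nat. n > 0 \<and> g [^] n \<in> centralizer G A"
proof -
  interpret A: normal A G by fact
  \<comment> \<open>The commutator of \<open>a [^] k\<close> with \<open>y\<close> is the
    \<open>k\<close>-th power of that of \<open>a\<close> with \<open>y\<close>, since both factors
    lie in the abelian group \<open>A\<close>; torsion-freeness then removes
    \<open>k\<close>.\<close>
  have pure: "a \<otimes> y = y \<otimes> a"
    if a: "a \<in> A" and y: "y \<in> carrier G" and k: "k \<noteq> 0" "a [^] k \<otimes> y = y \<otimes> a [^] k" for a y and k :: int
  proof -
    have conjA: "inv y \<otimes> a \<otimes> y \<in> A" by (rule A.inv_op_closed1[OF y a])
    have "inv y \<otimes> a [^] k \<otimes> y = a [^] k" using k(2) a y by (simp add: conj_iff_commute)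
    then have "(inv y \<otimes> a \<otimes> y) [^] k = a [^] k" using a y by (simp add: conj_int_pow)
    moreover have "(inv a \<otimes> (inv y \<otimes> a \<otimes> y)) [^] k = (inv a) [^] k \<otimes> (inv y \<otimes> a \<otimes> y) [^] k"
      using conjA a y by (intro int_pow_mult_distrib Acomm) auto
    ultimately have "(inv a \<otimes> (inv y \<otimes> a \<otimes> y)) [^] k = \<one>" using a by (simp add: int_pow_inv)
    moreover have "inv a \<otimes> (inv y \<otimes> a \<otimes> y) \<in> A" using conjA a by simp
    ultimately have "inv a \<otimes> (inv y \<otimes> a \<otimes> y) = \<one>"
      using torsion_free_int_pow[OF tf _ _ _ k(1)] by simp
    then have "a \<otimes> (inv a \<otimes> (inv y \<otimes> a \<otimes> y)) = a" using a by simp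
    then have "inv y \<otimes> a \<otimes> y = a" using a y by simp
    then show ?thesis using a y by (simp add: conj_iff_commute)
  qed
  \<comment> \<open>Here the exponent still depends on \<open>a\<close>; the rest of the proof makes
    it uniform.\<close>
  have commute: "\<exists>n::nat. n > 0 \<and> a \<otimes> g [^] n = g [^] n \<otimes> a" if a: "a \<in> A" for a
  proof -
    have seqA: "conj_seq G a g i \<in> A" for i
      unfolding conj_seq_def using g a by (intro A.inv_op_closed1) auto
    then have "generate G (range (conj_seq G a g)) \<subseteq> A"
      by (intro generate_subgroup_incl A.is_subgroup) auto
    then have "torsion_free_set G (generate G (range (conj_seq G a g)))"
      using tf by (auto simp: torsion_free_set_def)
    moreover have "commuting_family G (conj_seq G a g)"
      using a g seqA by (intro commuting_conj_seq Acomm) auto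
    ultimately obtain n :: nat where n: "n > 0" "a [^] n \<otimes> g [^] n = g [^] n \<otimes> a [^] n"
      using no_pair[of a g] a g by (auto simp: Gc_pair_def)
    then have "a \<otimes> g [^] n = g [^] n \<otimes> a"
      using pure[OF a, of "g [^] n" "int n"] g by (simp add: int_pow_int)
    then show ?thesis using n(1) by blast
  qed
  \<comment> \<open>Each factorial divides the later ones and every positive integer divides some
    factorial. So the \<open>D n\<close> increase, and every element of \<open>A\<close> lies in one
    of them.\<close>
  define D where "D n = {a \<in> A. a \<otimes> g [^] (fact n :: nat) = g [^] (fact n :: nat) \<otimes> a}" for n :: nat
  have D_eq: "D n = A \<inter> centralizer G {g [^] (fact n :: nat)}" for n
    by (auto simp: D_def centralizer_def)
  have Dsub: "subgroup (D n) G" for n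
    unfolding D_eq using g by (intro subgroups_Inter_pair A.is_subgroup subgroup_centralizer) auto
  have dvd: "a \<in> D n" if aA: "a \<in> A" "a \<otimes> g [^] k = g [^] k \<otimes> a" and kn: "k dvd fact n" for a n and k :: nat
  proof -
    obtain l where l: "fact n = k * l" using kn by (elim dvdE)
    have "a \<otimes> g [^] (k * l) = g [^] (k * l) \<otimes> a"
      using commute_pow_pow[OF aA(2), of 1 l] aA(1) g by (simp add: nat_pow_pow)
    then show ?thesis using aA(1) by (simp add: D_def l)
  qed
  have mono: "D m \<subseteq> D n" if "m \<le> n" for m n
    using dvd[of _ "fact m" n] fact_dvd[OF that, where 'a=nat] by (auto simp: D_def)
  show ?thesis
  proof (rule ccontr)
    assume none: "\<not> ?thesis"
    have "\<exists>a m. a \<in> D m \<and> a \<notin> D n \<and> n \<le> m" for n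
    proof -
      have "g [^] (fact n :: nat) \<notin> centralizer G A" using none fact_gt_zero[of n, where 'a=nat] by blast
      then obtain a where a: "a \<in> A" "a \<notin> D n" using g by (auto simp: centralizer_def D_def)
      obtain k :: nat where k: "k > 0" "a \<otimes> g [^] k = g [^] k \<otimes> a" using commute[OF a(1)] by blast
      have "a \<in> D (max k n)" using k by (intro dvd[OF a(1) k(2)] dvd_fact) auto
      then show ?thesis using a by (intro exI[of _ a] exI[of _ "max k n"]) auto
    qed
    then obtain pick nxt where step: "\<And>n. pick n \<in> D (nxt n)" "\<And>n. pick n \<notin> D n" "\<And>n. n \<le> nxt n" by metis
    define l where "l i = (nxt ^^ i) 1" for i
    define a where "a i = pick (l i)" for i
    have lSuc: "l (Suc i) = nxt (l i)" for i by (simp add: l_def)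
    have lmono: "l i \<le> l j" if "i \<le> j" for i j
      using lift_Suc_mono_le[of l, OF _ that] step(3) lSuc by simp
    have aD: "a i \<in> D (l (Suc i))" "a i \<notin> D (l i)" for i using step by (auto simp: a_def lSuc)
    have aA: "a i \<in> A" for i using aD(1)[of i] by (simp add: D_def)
    \<comment> \<open>The commutator with \<open>g\<close> is an endomorphism of \<open>A\<close>
      because \<open>A\<close> is abelian and normal. Its kernel is the centralizer of
      \<open>g\<close> in \<open>A\<close>.\<close>
    define \<phi> where "\<phi> x = inv x \<otimes> (inv g \<otimes> x \<otimes> g)" for x
    have phiA: "\<phi> x \<in> A" if "x \<in> A" for x
      unfolding \<phi>_def using that A.inv_op_closed1[OF g that] by simp
    have phi_mult: "\<phi> (x \<otimes> y) = \<phi> x \<otimes> \<phi> y" if x: "x \<in> A" and y: "y \<in> A" for x y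
    proof -
      have xc: "x \<in> carrier G" "y \<in> carrier G" using x y by auto
      have "\<phi> (x \<otimes> y) = inv y \<otimes> (\<phi> x \<otimes> (inv g \<otimes> y \<otimes> g))"
        using xc g by (simp add: \<phi>_def inv_mult_group m_assoc)
      also have "\<dots> = inv y \<otimes> \<phi> x \<otimes> (inv g \<otimes> y \<otimes> g)"
        using xc g by (simp add: \<phi>_def m_assoc)
      also have "inv y \<otimes> \<phi> x = \<phi> x \<otimes> inv y" using phiA[OF x] y by (intro Acomm) auto
      also have "\<phi> x \<otimes> inv y \<otimes> (inv g \<otimes> y \<otimes> g) = \<phi> x \<otimes> \<phi> y"
        using xc g by (simp add: \<phi>_def m_assoc)
      finally show ?thesis .
    qed
    let ?A = "G\<lparr>carrier := A\<rparr>"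
    interpret AG: group ?A by (rule subgroup_imp_group[OF A.is_subgroup])
    interpret phi: group_hom ?A G \<phi>
      by (intro group_hom.intro group_hom_axioms.intro AG.is_group is_group homI)
        (use phiA phi_mult in auto)
    define z where "z i = \<phi> (a i)" for i
    have phi_e: "\<phi> (eprod G a c n) = eprod G z c n" for c n
    proof -
      have "range a \<subseteq> A" using aA by auto
      then show ?thesis
        using phi.hom_eprod[of a c n] eprod_consistent[OF A.is_subgroup, of a c n]
        by (simp add: z_def[abs_def])
    qed
    have zA: "z i \<in> A" for i unfolding z_def by (rule phiA[OF aA])
    have "commuting_family G z" using zA Acomm by (auto simp: commuting_family_def)
    moreover have "range z \<subseteq> derived G (carrier G)"
      unfolding z_def \<phi>_def using commutator_in_derived[OF _ g subgroup_self] aA by auto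
    ultimately have "\<not> independent_on G UNIV z" by (rule no_family)
    then obtain c n i where cn: "eprod G z c n = \<one>" "i < n" "c i \<noteq> 0" by (auto simp: independent_on_def)
    \<comment> \<open>At the largest index with nonzero exponent, all earlier \<open>a i\<close>
      already lie in \<open>D (l t)\<close>. The relation then puts a power of \<open>a t\<close>
      there, and purity puts \<open>a t\<close> itself there.\<close>
    define t where "t = Max {i. i < n \<and> c i \<noteq> 0}"
    have "t \<in> {i. i < n \<and> c i \<noteq> 0}" unfolding t_def using cn by (intro Max_in) auto
    then have t: "t < n" "c t \<noteq> 0" by auto
    have top: "c j = 0" if "t < j" "j < n" for j
      using that Max_ge[of "{i. i < n \<and> c i \<noteq> 0}" j] unfolding t_def by fastforce
    define e where "e = eprod G a c n"
    have ra: "range a \<subseteq> carrier G" using aA by auto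
    have eA: "e \<in> A" unfolding e_def by (intro eprod_in_subgroup A.is_subgroup aA)
    have "\<phi> e = \<one>" using phi_e cn(1) by (simp add: e_def)
    then have "e \<otimes> (inv e \<otimes> (inv g \<otimes> e \<otimes> g)) = e" using eA by (simp add: \<phi>_def)
    then have "inv g \<otimes> e \<otimes> g = e" using eA g by simp
    then have "e \<otimes> g = g \<otimes> e" using eA g by (simp add: conj_iff_commute)
    \<comment> \<open>\<open>e\<close> commutes with \<open>g\<close> itself and hence lies in every
      \<open>D n\<close>; the divisor used is 1.\<close>
    then have eD: "e \<in> D (l t)" using dvd[OF eA, of 1] g by simp
    have "e = eprod G a c (Suc t)"
      unfolding e_def using t top by (intro eprod_extend ra) auto
    then have e_split: "e = eprod G a c t \<otimes> a t [^] c t" by simp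
    have "a i \<in> D (l t)" if "i < t" for i
      using aD(1)[of i] mono[OF lmono[of "Suc i" t]] that by auto
    then have eD': "eprod G a c t \<in> D (l t)" by (intro eprod_in_subgroup Dsub)
    have "a t [^] c t = inv (eprod G a c t) \<otimes> e" unfolding e_split using ra aA by simp
    then have "a t [^] c t \<in> D (l t)"
      using eD eD' subgroup.m_closed[OF Dsub] subgroup.m_inv_closed[OF Dsub] by simp
    then have "a t [^] c t \<otimes> g [^] (fact (l t) :: nat) = g [^] (fact (l t) :: nat) \<otimes> a t [^] c t"
      by (simp add: D_def)
    then have "a t \<in> D (l t)" using pure[OF aA _ t(2)] aA g by (simp add: D_def)
    then show False using aD(2) by blast
  qed
qed

section \<open>A criterion for being virtually abelian\<close>

lemma finite_rcosetsI:
  assumes Z: "subgroup Z G" and fin: "finite (f ` carrier G)"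
    and inj: "\<And>x y. x \<in> carrier G \<Longrightarrow> y \<in> carrier G \<Longrightarrow> f x = f y \<Longrightarrow> x \<otimes> inv y \<in> Z"
  shows "finite (rcosets Z)"
proof -
  define r where "r t = (SOME x. x \<in> carrier G \<and> f x = t)" for t
  have "Z #> x \<in> (\<lambda>t. Z #> r t) ` f ` carrier G" if x: "x \<in> carrier G" for x
  proof -
    have r: "r (f x) \<in> carrier G \<and> f (r (f x)) = f x" unfolding r_def by (rule someI[of _ x]) (use x in simp)
    then have "x \<otimes> inv (r (f x)) \<in> Z" using inj[of x "r (f x)"] x by simp
    then have "x \<in> Z #> r (f x)" using subgroup.rcos_module_rev[OF Z is_group] r x by blast
    then have "Z #> r (f x) = Z #> x" using repr_independence[OF _ _ Z] r by blast
    then show ?thesis using x by blast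
  qed
  then have "rcosets Z \<subseteq> (\<lambda>t. Z #> r t) ` f ` carrier G" by (auto simp: RCOSETS_def)
  then show ?thesis using fin finite_surj by blast
qed

text \<open>The centralizer of a finite generating set of \<open>V\<close> has finite index in \<open>V\<close>, since conjugates in
  \<open>V\<close> of a generator differ by elements of the finite set \<open>T\<close>.\<close>

lemma virtually_abelian_finite_by_abelian:
  assumes V: "subgroup V G" and fi: "finite (rcosets V)" and fg: "finitely_generated (G\<lparr>carrier := V\<rparr>)"
    and T: "finite T" and derived: "derived G V \<subseteq> T"
  shows "virtually_abelian G"
proof -
  interpret V: subgroup V G by fact
  obtain S where S: "finite S" "S \<subseteq> V" "generate G S = V"
    using fg finitely_generated_subgroup_iff[OF V] by blast
  define Z where "Z = V \<inter> centralizer G S"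
  have SG: "S \<subseteq> carrier G" using S(2) V.subset by blast
  have Z: "subgroup Z G" unfolding Z_def by (intro subgroups_Inter_pair V subgroup_centralizer SG)
  \<comment> \<open>An element of \<open>Z\<close> centralizes \<open>S\<close>, hence the group
    \<open>V\<close> generated by \<open>S\<close>, and \<open>Z\<close> lies in
    \<open>V\<close>.\<close>
  have Zcomm: "x \<otimes> y = y \<otimes> x" if x: "x \<in> Z" and y: "y \<in> Z" for x y
  proof (rule commute_generate[of "{x}" S])
    show "{x} \<subseteq> carrier G" using x by (auto simp: Z_def)
    show "s \<otimes> t = t \<otimes> s" if "s \<in> {x}" "t \<in> S" for s t using that x by (auto simp: Z_def centralizer_def)
    show "y \<in> generate G S" using y S(3) by (simp add: Z_def)
  qed (auto intro: generate.incl SG[THEN subsetD])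
  define r where "r X = (SOME x. x \<in> X)" for X :: "'a set"
  have r: "r (V #> x) \<in> carrier G" "x \<otimes> inv (r (V #> x)) \<in> V" if x: "x \<in> carrier G" for x
  proof -
    have rx: "r (V #> x) \<in> V #> x" unfolding r_def using rcos_self[OF x V] by (rule someI)
    then show rc: "r (V #> x) \<in> carrier G" using V.elemrcos_carrier[OF is_group x] by blast
    have "inv (r (V #> x) \<otimes> inv x) \<in> V" using V.rcos_module_imp[OF is_group x rx] by (rule V.m_inv_closed)
    then show "x \<otimes> inv (r (V #> x)) \<in> V" using rc x by (simp add: inv_mult_group)
  qed
  define v where "v x = x \<otimes> inv (r (V #> x))" for x
  \<comment> \<open>\<open>f\<close> records the coset of \<open>x\<close> and the conjugation
    action of its \<open>V\<close>-part \<open>v x\<close> on the generators. When the records of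
    \<open>x\<close> and \<open>y\<close> agree, the representatives cancel in
    \<open>x \<otimes> inv y\<close>, which therefore lies in \<open>V\<close> and centralizes
    \<open>S\<close>.\<close>
  define f where "f x = (V #> x, \<lambda>s\<in>S. inv (v x) \<otimes> s \<otimes> v x)" for x
  have "f ` carrier G \<subseteq> (rcosets V) \<times> (PiE S (\<lambda>s. (\<lambda>t. s \<otimes> t) ` T))"
  proof (rule image_subsetI)
    fix x assume x: "x \<in> carrier G"
    have "V #> x \<in> rcosets V" using x by (intro rcosetsI V.subset)
    moreover
    have "inv (v x) \<otimes> s \<otimes> v x \<in> (\<lambda>t. s \<otimes> t) ` T" if s: "s \<in> S" for s
    proof -
      have vx: "v x \<in> V" using r x by (simp add: v_def)
      have sV: "s \<in> V" using s S by auto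
      have "inv s \<otimes> (inv (v x) \<otimes> s \<otimes> v x) \<in> T" using commutator_in_derived[OF sV vx V] derived by blast
      moreover have "inv (v x) \<otimes> s \<otimes> v x = s \<otimes> (inv s \<otimes> (inv (v x) \<otimes> s \<otimes> v x))" using sV vx by simp
      ultimately show ?thesis by (rule rev_image_eqI)
    qed
    then have "(\<lambda>s\<in>S. inv (v x) \<otimes> s \<otimes> v x) \<in> PiE S (\<lambda>s. (\<lambda>t. s \<otimes> t) ` T)" by simp
    ultimately show "f x \<in> (rcosets V) \<times> PiE S (\<lambda>s. (\<lambda>t. s \<otimes> t) ` T)" unfolding f_def by simp
  qed
  moreover have "finite ((rcosets V) \<times> (PiE S (\<lambda>s. (\<lambda>t. s \<otimes> t) ` T)))"
    using fi S(1) T by (intro finite_cartesian_product finite_PiE) auto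
  ultimately have "finite (f ` carrier G)" by (rule finite_subset)
  moreover have "x \<otimes> inv y \<in> Z" if x: "x \<in> carrier G" and y: "y \<in> carrier G" and xy: "f x = f y" for x y
  proof -
    have vV: "v x \<in> V" "v y \<in> V" using r x y by (simp_all add: v_def)
    then have c: "v x \<in> carrier G" "v y \<in> carrier G" by auto
    have "V #> x = V #> y" using xy by (simp add: f_def)
    then have eq: "x \<otimes> inv y = v x \<otimes> inv (v y)"
      unfolding v_def using r x y by (simp add: inv_mult_group m_assoc)
    have "(v x \<otimes> inv (v y)) \<otimes> s = s \<otimes> (v x \<otimes> inv (v y))" if s: "s \<in> S" for s
    proof -
      have sc: "s \<in> carrier G" using s SG by auto
      have conj: "inv (v x) \<otimes> s \<otimes> v x = inv (v y) \<otimes> s \<otimes> v y"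
      proof -
        have "restrict (\<lambda>s. inv (v x) \<otimes> s \<otimes> v x) S = restrict (\<lambda>s. inv (v y) \<otimes> s \<otimes> v y) S"
          using xy by (simp only: f_def prod.inject)
        from fun_cong[OF this, of s] s show ?thesis by simp
      qed
      have "s \<otimes> (v x \<otimes> inv (v y)) = v x \<otimes> (inv (v x) \<otimes> s \<otimes> v x) \<otimes> inv (v y)"
        using c sc by (simp add: m_assoc)
      also have "\<dots> = (v x \<otimes> inv (v y)) \<otimes> s" unfolding conj using c sc by (simp add: m_assoc)
      finally show ?thesis by simp
    qed
    then show ?thesis unfolding eq using vV c by (simp add: Z_def centralizer_def)
  qed
  ultimately have "finite (rcosets Z)" by (rule finite_rcosetsI[OF Z])
  moreover have "comm_group (G\<lparr>carrier := Z\<rparr>)"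
    using Zcomm by (intro group.group_comm_groupI subgroup_imp_group Z) auto
  ultimately show ?thesis using Z unfolding virtually_abelian_def by blast
qed

end

section \<open>Reduction modulo the torsion radical\<close>

lemma virtually_abelian_img:
  assumes "group_hom G H h" and surj: "h ` carrier G = carrier H" and va: "virtually_abelian G"
  shows "virtually_abelian H"
proof -
  interpret group_hom G H h by fact
  obtain A where A: "subgroup A G" "comm_group (G\<lparr>carrier := A\<rparr>)" "finite (rcosets\<^bsub>G\<^esub> A)"
    using va by (auto simp: virtually_abelian_def)
  interpret A: subgroup A G by (rule A(1))
  have hA: "subgroup (h ` A) H" by (rule subgroup_img_is_subgroup[OF A(1)])
  have Acomm: "x \<otimes>\<^bsub>G\<^esub> y = y \<otimes>\<^bsub>G\<^esub> x" if "x \<in> A" "y \<in> A" for x y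
    using comm_monoid.m_comm[OF comm_group.axioms(1)[OF A(2)]] that by simp
  have "comm_group (H\<lparr>carrier := h ` A\<rparr>)"
  proof (rule group.group_comm_groupI[OF H.subgroup_imp_group[OF hA]])
    fix x y assume "x \<in> carrier (H\<lparr>carrier := h ` A\<rparr>)" "y \<in> carrier (H\<lparr>carrier := h ` A\<rparr>)"
    then obtain u w where "u \<in> A" "w \<in> A" "x = h u" "y = h w" by auto
    then show "x \<otimes>\<^bsub>H\<lparr>carrier := h ` A\<rparr>\<^esub> y = y \<otimes>\<^bsub>H\<lparr>carrier := h ` A\<rparr>\<^esub> x"
      using arg_cong[OF Acomm[of u w], of h] by simp
  qed
  moreover have "rcosets\<^bsub>H\<^esub> (h ` A) \<subseteq> (\<lambda>X. h ` X) ` (rcosets\<^bsub>G\<^esub> A)"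
  proof
    fix Y assume "Y \<in> rcosets\<^bsub>H\<^esub> (h ` A)"
    then obtain y where y: "y \<in> h ` carrier G" "Y = h ` A #>\<^bsub>H\<^esub> y"
      unfolding surj by (auto simp: RCOSETS_def)
    then obtain x where x: "x \<in> carrier G" "Y = h ` A #>\<^bsub>H\<^esub> h x" by blast
    have "Y = h ` (A #>\<^bsub>G\<^esub> x)" unfolding x(2) using x(1) by (auto simp: r_coset_def image_UN)
    then show "Y \<in> (\<lambda>X. h ` X) ` (rcosets\<^bsub>G\<^esub> A)" using x(1) A.subset by (auto intro!: G.rcosetsI)
  qed
  then have "finite (rcosets\<^bsub>H\<^esub> (h ` A))" using A(3) finite_surj by blast
  ultimately show ?thesis using hA unfolding virtually_abelian_def by blast
qed

lemma proper_Gc_group_iso: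
  assumes "group G" "G \<cong> H" "proper_Gc_group H"
  shows "proper_Gc_group G"
proof -
  have H: "group H" "\<not> virtually_abelian H" using assms(3) by (auto simp: proper_Gc_group_def Gc_group_def)
  obtain \<phi> where \<phi>: "\<phi> \<in> iso G H" using assms(2) by (auto simp: is_iso_def)
  then have "group_hom G H \<phi>" "\<phi> ` carrier G = carrier H"
    using assms(1) H(1) by (auto simp: iso_def bij_betw_def group_hom_def group_hom_axioms_def)
  then have "\<not> virtually_abelian G" using virtually_abelian_img H(2) by blast
  moreover have "Gc_group G"
    using assms iso_trans unfolding proper_Gc_group_def Gc_group_def by blast
  ultimately show ?thesis by (simp add: proper_Gc_group_def)
qed

lemma torsion_free_comm_group_iso:
  assumes "group G" "G \<cong> H" "comm_group H" "torsion_free_set H (carrier H)"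
  shows "comm_group G" "torsion_free_set G (carrier G)"
proof -
  obtain \<phi> where \<phi>: "\<phi> \<in> iso G H" using assms(2) by (auto simp: is_iso_def)
  interpret G: group G by fact
  interpret H: comm_group H by fact
  interpret \<phi>: group_hom G H \<phi>
    using \<phi> by unfold_locales (auto simp: iso_def)
  have inj: "inj_on \<phi> (carrier G)" using \<phi> by (simp add: iso_def bij_betw_def)
  show "comm_group G"
  proof (rule G.group_comm_groupI)
    fix x y assume xy: "x \<in> carrier G" "y \<in> carrier G"
    then have "\<phi> (x \<otimes>\<^bsub>G\<^esub> y) = \<phi> (y \<otimes>\<^bsub>G\<^esub> x)" by (simp add: H.m_comm)
    from inj_onD[OF inj this] xy show "x \<otimes>\<^bsub>G\<^esub> y = y \<otimes>\<^bsub>G\<^esub> x" by simp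
  qed
  show "torsion_free_set G (carrier G)"
    unfolding torsion_free_set_def
  proof (intro ballI allI impI)
    fix x n assume x: "x \<in> carrier G" "(n::nat) > 0" "x [^]\<^bsub>G\<^esub> n = \<one>\<^bsub>G\<^esub>"
    then have "\<phi> x [^]\<^bsub>H\<^esub> n = \<one>\<^bsub>H\<^esub>" using \<phi>.hom_nat_pow[of x n] by simp
    then have "\<phi> x = \<one>\<^bsub>H\<^esub>" using assms(4) x(1,2) by (auto simp: torsion_free_set_def)
    then show "x = \<one>\<^bsub>G\<^esub>" using inj x(1) \<phi>.hom_one by (metis inj_onD G.one_closed)
  qed
qed

lemma (in group_hom) subgroup_vimage:
  assumes "subgroup N H"
  shows "subgroup {x \<in> carrier G. h x \<in> N} G"
proof (rule G.subgroupI)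
  have "\<one> \<in> {x \<in> carrier G. h x \<in> N}" using subgroup.one_closed[OF assms] by simp
  then show "{x \<in> carrier G. h x \<in> N} \<noteq> {}" by blast
qed (use subgroup.m_closed[OF assms] subgroup.m_inv_closed[OF assms] in auto)

lemma (in group_hom) normal_vimage:
  assumes "N \<lhd> H"
  shows "{x \<in> carrier G. h x \<in> N} \<lhd> G"
  using normal.inv_op_closed2[OF assms]
  by (intro G.normal_invI subgroup_vimage normal_imp_subgroup assms) auto

lemma (in group_hom) subgroup_FactGroup_iso:
  assumes K: "subgroup K G"
  shows "K \<inter> kernel G H h \<lhd> G\<lparr>carrier := K\<rparr>"
    and "G\<lparr>carrier := K\<rparr> Mod (K \<inter> kernel G H h) \<cong> H\<lparr>carrier := h ` K\<rparr>"
proof -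
  have hK: "subgroup (h ` K) H" by (rule subgroup_img_is_subgroup[OF K])
  interpret K: group "G\<lparr>carrier := K\<rparr>" by (rule G.subgroup_imp_group[OF K])
  interpret hK: group "H\<lparr>carrier := h ` K\<rparr>" by (rule H.subgroup_imp_group[OF hK])
  interpret r: group_hom "G\<lparr>carrier := K\<rparr>" "H\<lparr>carrier := h ` K\<rparr>" h
    using subgroup.subset[OF K] by unfold_locales (auto simp: hom_def subset_iff)
  have ker: "kernel (G\<lparr>carrier := K\<rparr>) (H\<lparr>carrier := h ` K\<rparr>) h = K \<inter> kernel G H h"
    using subgroup.subset[OF K] by (auto simp: kernel_def)
  show "K \<inter> kernel G H h \<lhd> G\<lparr>carrier := K\<rparr>"
    using r.normal_kernel unfolding ker .
  show "G\<lparr>carrier := K\<rparr> Mod (K \<inter> kernel G H h) \<cong> H\<lparr>carrier := h ` K\<rparr>"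
    using r.FactGroup_iso unfolding ker by simp
qed

section \<open>Groups in which (ii), (iii) and (iv) all fail\<close>

locale tame_group = group G for G (structure) +
  assumes no_Z_infinity:
      "\<not> (\<exists>K. subgroup K (G\<lparr>carrier := derived G (carrier G)\<rparr>) \<and>
        G\<lparr>carrier := K\<rparr> \<cong> free_Abelian_group (UNIV :: nat set))"
    and no_proper_Gc: "\<not> (\<exists>K. subgroup K G \<and> proper_Gc_group (G\<lparr>carrier := K\<rparr>))"
    and no_torsion_extension: "\<not> (\<exists>H U. subgroup H G \<and> finitely_generated (G\<lparr>carrier := H\<rparr>) \<and>
           U \<lhd> G\<lparr>carrier := H\<rparr> \<and> infinite U \<and> torsion_set G U \<and>
           (free_abelian (G\<lparr>carrier := H\<rparr> Mod U) \<or> proper_Gc_group (G\<lparr>carrier := H\<rparr> Mod U)))"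
begin

lemma no_independent_family:
  assumes "commuting_family G z" "range z \<subseteq> derived G (carrier G)"
  shows "\<not> independent_on G UNIV z"
proof
  assume ind: "independent_on G UNIV z"
  have D: "subgroup (derived G (carrier G)) G" by (rule derived_is_subgroup) simp
  have K: "subgroup (generate G (range z)) G"
    using assms(1) by (intro generate_is_subgroup) (simp add: commuting_family_def)
  have "subgroup (generate G (range z)) (G\<lparr>carrier := derived G (carrier G)\<rparr>)"
    using generate_subgroup_incl[OF assms(2) D] by (rule subgroup_incl[OF K D])
  then show False
    using no_Z_infinity free_Abelian_group_of_independent_family[OF assms(1) ind] by blast
qed

lemma no_Gc_pair: "\<not> Gc_pair G a g"
proof
  assume pair: "Gc_pair G a g"
  then have "subgroup (generate G {a, g}) G" by (intro generate_is_subgroup) (auto simp: Gc_pair_def)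
  then show False using proper_Gc_group_of_pair[OF pair no_independent_family] no_proper_Gc by blast
qed

context
  fixes Q :: "('c, 'd) monoid_scheme" and h
  assumes hom: "group_hom G Q h" and surj: "h ` carrier G = carrier Q"
    and tors: "torsion_set G (kernel G Q h)"
begin

interpretation h: group_hom G Q h by (rule hom)

text \<open>The free abelian case of (iv): \<open>K\<close> modulo its part of the kernel is
  finitely generated and torsion-free abelian, hence free abelian, so an infinite part would be the
  forbidden \<open>U\<close>.\<close>

lemma finite_kernel_of_free_image:
  assumes K: "subgroup K G" and fg: "finitely_generated (G\<lparr>carrier := K\<rparr>)"
    and comm: "comm_group (Q\<lparr>carrier := h ` K\<rparr>)" and tf: "torsion_free_set Q (h ` K)"
  shows "finite (K \<inter> kernel G Q h)"
proof (rule ccontr)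
  assume inf: "infinite (K \<inter> kernel G Q h)"
  let ?U = "K \<inter> kernel G Q h"
  let ?X = "G\<lparr>carrier := K\<rparr> Mod ?U"
  have U: "?U \<lhd> G\<lparr>carrier := K\<rparr>" and iso: "?X \<cong> Q\<lparr>carrier := h ` K\<rparr>"
    using h.subgroup_FactGroup_iso[OF K] by auto
  interpret U: normal ?U "G\<lparr>carrier := K\<rparr>" by (rule U)
  have X: "group ?X" by (rule U.factorgroup_is_group)
  have "torsion_free_set (Q\<lparr>carrier := h ` K\<rparr>) (carrier (Q\<lparr>carrier := h ` K\<rparr>))"
    using tf by (simp add: torsion_free_set_def flip: h.H.nat_pow_consistent)
  note X' = torsion_free_comm_group_iso[OF X iso comm this]
  have "group_hom (G\<lparr>carrier := K\<rparr>) ?X (\<lambda>x. ?U #>\<^bsub>G\<lparr>carrier := K\<rparr>\<^esub> x)"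
    by (intro group_hom.intro group_hom_axioms.intro X U.r_coset_hom_Mod U.is_group)
  then have "finitely_generated ?X"
    by (rule finitely_generated_img[OF _ _ fg]) (simp add: carrier_FactGroup)
  then have "free_abelian ?X" by (rule comm_group.free_abelian_of_torsion_free[OF X'(1) _ X'(2)])
  moreover have "torsion_set G ?U" using tors by (auto simp: torsion_set_def)
  ultimately show False using no_torsion_extension K fg U inf by blast
qed

lemma image_no_independent_family:
  assumes "commuting_family Q z" "range z \<subseteq> derived Q (carrier Q)"
  shows "\<not> independent_on Q UNIV z"
proof
  assume ind: "independent_on Q UNIV z"
  have "finite (generate G S \<inter> kernel G Q h)"
    if "finite S" "S \<subseteq> carrier G" "comm_group (Q\<lparr>carrier := generate Q (h ` S)\<rparr>)"
      "torsion_free_set Q (generate Q (h ` S))" for S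
    using that by (intro finite_kernel_of_free_image generate_is_subgroup finitely_generated_generate)
      (simp_all add: h.generate_img)
  from h.lift_independent_family[OF surj this assms(1,2) ind] show False
    using no_independent_family by blast
qed

text \<open>If the kernel part of the subgroup generated by lifts is finite, the pair lifts to
  \<open>G\<close>; if it is infinite, the quotient by it is a proper Gc-group and (iv) holds. The
  second case rests on \<open>image_no_independent_family\<close>, which turns the pair into a
  Gc-group.\<close>

lemma image_no_Gc_pair: "\<not> Gc_pair Q a' g'"
proof
  assume pair: "Gc_pair Q a' g'"
  then have "a' \<in> h ` carrier G" "g' \<in> h ` carrier G" by (simp_all add: Gc_pair_def surj)
  then obtain a g where ag: "a \<in> carrier G" "g \<in> carrier G" "a' = h a" "g' = h g" by auto
  let ?K = "generate G {a, g}"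
  let ?U = "?K \<inter> kernel G Q h"
  have S: "{a, g} \<subseteq> carrier G" using ag by simp
  have K: "subgroup ?K G" by (rule generate_is_subgroup[OF S])
  have fg: "finitely_generated (G\<lparr>carrier := ?K\<rparr>)" by (rule finitely_generated_generate[OF _ S]) simp
  have inf: "infinite ?U" using h.lift_Gc_pair[OF ag(1,2)] pair ag no_Gc_pair by blast
  have U: "?U \<lhd> G\<lparr>carrier := ?K\<rparr>" and iso: "G\<lparr>carrier := ?K\<rparr> Mod ?U \<cong> Q\<lparr>carrier := h ` ?K\<rparr>"
    using h.subgroup_FactGroup_iso[OF K] by auto
  have "h ` ?K = generate Q {a', g'}" using h.generate_img[OF S] ag by simp
  then have "proper_Gc_group (Q\<lparr>carrier := h ` ?K\<rparr>)"
    using h.H.proper_Gc_group_of_pair[OF pair image_no_independent_family] by simp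
  then have "proper_Gc_group (G\<lparr>carrier := ?K\<rparr> Mod ?U)"
    by (rule proper_Gc_group_iso[OF normal.factorgroup_is_group[OF U] iso])
  moreover have "torsion_set G ?U" using tors by (auto simp: torsion_set_def)
  ultimately show False using no_torsion_extension K fg U inf by blast
qed

end

lemma virtually_abelian:
  assumes fg: "finitely_generated G" and solv: "solvable G"
  shows "virtually_abelian G"
proof -
  let ?T = "torsion_radical G"
  interpret T: normal ?T G by (rule torsion_radical)
  let ?Q = "G Mod ?T"
  define h where "h x = ?T #> x" for x
  interpret Q: group ?Q by (rule T.factorgroup_is_group)
  interpret h: group_hom G ?Q h
    unfolding h_def by unfold_locales (rule T.r_coset_hom_Mod)
  have surj: "h ` carrier G = carrier ?Q" by (simp add: h_def carrier_FactGroup)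
  have kerT: "kernel G ?Q h = ?T"
    using coset_join1[OF _ _ T.is_subgroup] coset_join2[OF _ T.is_subgroup]
    by (auto simp: kernel_def h_def)
  have tors: "torsion_set G (kernel G ?Q h)" unfolding kerT by (rule torsion_radical(2))
  note Q_facts = h.group_hom_axioms surj tors
  \<comment> \<open>The preimage of a normal torsion subgroup is normal and, the kernel being
    torsion, again torsion; so it is contained in the radical.\<close>
  have no_torsion: "N = {\<one>\<^bsub>?Q\<^esub>}" if N: "N \<lhd> ?Q" "torsion_set ?Q N" for N
  proof -
    interpret N: normal N ?Q by (rule N(1))
    define M where "M = {x \<in> carrier G. h x \<in> N}"
    have "M \<lhd> G" unfolding M_def by (rule h.normal_vimage[OF N(1)])
    moreover have "torsion_set G M"
      unfolding torsion_set_def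
    proof
      fix x assume x: "x \<in> M"
      then obtain n :: nat where n: "n > 0" "h x [^]\<^bsub>?Q\<^esub> n = \<one>\<^bsub>?Q\<^esub>"
        using N(2) by (auto simp: M_def torsion_set_def)
      then have "x [^] n \<in> kernel G ?Q h"
        using x h.hom_nat_pow[of x n] by (simp add: M_def kernel_def del: one_FactGroup)
      then have "x [^] n \<in> ?T" by (simp only: kerT)
      then obtain m :: nat where "m > 0" "(x [^] n) [^] m = \<one>"
        using torsion_radical(2) by (auto simp: torsion_set_def)
      then show "\<exists>n::nat. n > 0 \<and> x [^] n = \<one>"
        using n(1) x by (intro exI[of _ "n * m"]) (simp add: M_def nat_pow_pow)
    qed
    ultimately have MT: "M \<subseteq> ?T" by (auto simp: torsion_radical_def)
    have "y = \<one>\<^bsub>?Q\<^esub>" if y: "y \<in> N" for y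
    proof -
      obtain x where x: "x \<in> carrier G" "y = h x" using y N.mem_carrier surj by blast
      then have "x \<in> ?T" using y MT by (auto simp: M_def)
      then have "x \<in> kernel G ?Q h" by (simp only: kerT)
      then show ?thesis using x by (simp add: kernel_def del: one_FactGroup)
    qed
    then show ?thesis using N.one_closed by blast
  qed
  have solvQ: "solvable ?Q" by (rule h.surj_hom_imp_solvable[OF surj solv])
  obtain A where A: "A \<lhd> ?Q" and Acomm: "\<And>x y. x \<in> A \<Longrightarrow> y \<in> A \<Longrightarrow> x \<otimes>\<^bsub>?Q\<^esub> y = y \<otimes>\<^bsub>?Q\<^esub> x"
    and cent: "centralizer ?Q A \<subseteq> A"
    using Q.self_centralizing_normal[OF no_torsion image_no_Gc_pair[OF Q_facts] solvQ] by blast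
  have tf: "torsion_free_set ?Q A"
    by (rule Q.torsion_free_of_no_torsion_normal[OF no_torsion A Acomm])
  interpret A: normal A ?Q by (rule A)
  let ?R = "?Q Mod A"
  interpret R: group ?R by (rule A.factorgroup_is_group)
  interpret p: group_hom ?Q ?R "\<lambda>y. A #>\<^bsub>?Q\<^esub> y"
    by unfold_locales (rule A.r_coset_hom_Mod)
  have surjR: "(\<lambda>y. A #>\<^bsub>?Q\<^esub> y) ` carrier ?Q = carrier ?R" by (simp add: carrier_FactGroup)
  have torsR: "torsion_set ?R (carrier ?R)"
    unfolding torsion_set_def surjR[symmetric]
  proof (intro ballI, elim imageE)
    fix u y assume y: "y \<in> carrier ?Q" and u: "u = A #>\<^bsub>?Q\<^esub> y"
    obtain n :: nat where n: "n > 0" "y [^]\<^bsub>?Q\<^esub> n \<in> A"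
      using Q.ex_pow_in_centralizer[OF A Acomm tf image_no_Gc_pair[OF Q_facts]
          image_no_independent_family[OF Q_facts] y] cent by blast
    have "u [^]\<^bsub>?R\<^esub> n = A #>\<^bsub>?Q\<^esub> (y [^]\<^bsub>?Q\<^esub> n)" unfolding u by (rule p.hom_nat_pow[OF y, symmetric])
    also have "\<dots> = \<one>\<^bsub>?R\<^esub>" using A.rcos_const[OF Q.is_group n(2)] by simp
    finally show "\<exists>n::nat. n > 0 \<and> u [^]\<^bsub>?R\<^esub> n = \<one>\<^bsub>?R\<^esub>" using n(1) by blast
  qed
  have fgQ: "finitely_generated ?Q" by (rule finitely_generated_img[OF h.group_hom_axioms surj fg])
  have fgR: "finitely_generated ?R" by (rule finitely_generated_img[OF p.group_hom_axioms surjR fgQ])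
  obtain n where "(derived ?R ^^ n) (carrier ?R) = {\<one>\<^bsub>?R\<^esub>}"
    using p.surj_hom_imp_solvable[OF surjR solvQ] R.solvable_iff_trivial_derived_seq by blast
  then have finR: "finite (carrier ?R)" by (rule finite_of_solvable_torsion[OF R.is_group fgR torsR])
  define V where "V = {x \<in> carrier G. h x \<in> A}"
  have V: "subgroup V G" unfolding V_def by (rule h.subgroup_vimage[OF A.is_subgroup])
  have hV: "h ` V = A"
  proof
    show "A \<subseteq> h ` V"
    proof
      fix y assume y: "y \<in> A"
      then have "y \<in> h ` carrier G" unfolding surj by (rule A.mem_carrier)
      then show "y \<in> h ` V" using y by (auto simp: V_def)
    qed
  qed (auto simp: V_def)
  have fi: "finite (rcosets V)"
  proof (rule finite_rcosetsI[OF V])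
    have "(\<lambda>x. A #>\<^bsub>?Q\<^esub> h x) ` carrier G \<subseteq> carrier ?R" using surj surjR by auto
    then show "finite ((\<lambda>x. A #>\<^bsub>?Q\<^esub> h x) ` carrier G)" using finR finite_subset by blast
    show "x \<otimes> inv y \<in> V" if xy: "x \<in> carrier G" "y \<in> carrier G" "A #>\<^bsub>?Q\<^esub> h x = A #>\<^bsub>?Q\<^esub> h y" for x y
    proof -
      have "h x \<in> A #>\<^bsub>?Q\<^esub> h y" using Q.rcos_self[OF _ A.is_subgroup, of "h x"] xy by simp
      then have "h x \<otimes>\<^bsub>?Q\<^esub> inv\<^bsub>?Q\<^esub> h y \<in> A" using A.rcos_module_imp[OF Q.is_group] xy by simp
      then show ?thesis using xy by (simp add: V_def)
    qed
  qed
  have fgV: "finitely_generated (G\<lparr>carrier := V\<rparr>)" by (rule finitely_generated_finite_index[OF fg V fi])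
  have commA: "comm_group (?Q\<lparr>carrier := A\<rparr>)"
    using Acomm by (intro group.group_comm_groupI Q.subgroup_imp_group A.is_subgroup) auto
  \<comment> \<open>\<open>V\<close> contains the whole kernel and maps onto the torsion-free
    abelian \<open>A\<close>, so finiteness of its kernel part is finiteness of the radical.\<close>
  have "finite (V \<inter> kernel G ?Q h)"
    using finite_kernel_of_free_image[OF Q_facts V fgV] hV commA tf by simp
  moreover have "?T \<subseteq> V"
  proof
    fix x assume "x \<in> ?T"
    then have "x \<in> kernel G ?Q h" by (simp only: kerT)
    then show "x \<in> V" using A.one_closed by (simp add: kernel_def V_def del: one_FactGroup)
  qed
  ultimately have finT: "finite ?T" unfolding kerT by (simp add: Int_absorb1)
  \<comment> \<open>\<open>V\<close> modulo the radical is the abelian group \<open>A\<close>, so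
    the commutators of \<open>V\<close> fall into the finite radical.\<close>
  have "derived ?Q A = {\<one>\<^bsub>?Q\<^esub>}"
    using comm_group.derived_eq_singleton[OF commA, of A] Q.derived_consistent[OF _ A.is_subgroup, of A]
    by simp
  then have "h ` derived G V = {\<one>\<^bsub>?Q\<^esub>}" using h.derived_img[of V] hV subgroup.subset[OF V] by simp
  then have "derived G V \<subseteq> kernel G ?Q h"
    using derived_in_carrier[OF subgroup.subset[OF V]] unfolding kernel_def by blast
  then have "derived G V \<subseteq> ?T" by (simp only: kerT)
  then show ?thesis by (rule virtually_abelian_finite_by_abelian[OF V fi fgV finT])
qed

end

theorem theorem5p2:
  fixes G :: "('a, 'b) monoid_scheme"
  assumes "group G"
    and "finitely_generated G"
    and "solvable G"
  shows "virtually_abelian G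
    \<or> (\<exists>K. subgroup K (G\<lparr>carrier := derived G (carrier G)\<rparr>) \<and>
           G\<lparr>carrier := K\<rparr> \<cong> free_Abelian_group (UNIV :: nat set))
    \<or> (\<exists>K. subgroup K G \<and> proper_Gc_group (G\<lparr>carrier := K\<rparr>))
    \<or> (\<exists>H U. subgroup H G \<and> finitely_generated (G\<lparr>carrier := H\<rparr>) \<and>
           U \<lhd> G\<lparr>carrier := H\<rparr> \<and> infinite U \<and> torsion_set G U \<and>
           (free_abelian (G\<lparr>carrier := H\<rparr> Mod U) \<or> proper_Gc_group (G\<lparr>carrier := H\<rparr> Mod U)))"
  (is "?vab \<or> ?ii \<or> ?iii \<or> ?iv")
proof -
  have "?vab" if "\<not> ?ii" "\<not> ?iii" "\<not> ?iv"
  proof -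
    interpret tame_group G
      by (intro tame_group.intro tame_group_axioms.intro assms(1) that)
    show ?thesis by (rule virtually_abelian[OF assms(2,3)])
  qed
  then show ?thesis by blast
qed

end
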